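(* Let $0<\delta\le1$ and let $(\tilde\Omega,\mathcal B,\mathbb Q,S)$ be the two-sided full shift over the alphabet $\{1,2,3,\dots\}$ with the Bernoulli measure of probability vector $(Z/n^{2+\delta})_{n\ge1}$, $Z$ being the normalization constant. Let $h(\omega)=\omega_0$ for $\omega=(\omega_n)_{n\in\mathbb Z}\in\tilde\Omega$. Let $(\Omega,\mathcal F,\mathbb P,\sigma)$ be the suspension of $S$ with roof function $h$: $\Omega=\{(\omega,i)\in\tilde\Omega\times\mathbb N:0\le i<h(\omega)\}$, $\sigma(\omega,i)=(\omega,i+1)$ if $i<h(\omega)-1$ and $\sigma(\omega,i)=(S\omega,0)$ if $i=h(\omega)-1$, and $\mathbb P(A)=\big(\int_{\tilde\Omega}h\,d\mathbb Q\big)^{-1}\sum_{i\ge0}\mathbb Q\big(\{\omega:(\omega,i)\in A\}\big)$. On $X=[0,1]$ with Lebesgue measure $m$ let $T_0$ be the doubling map and $T_1(x)=\frac12\big(E(2x)+\{4x\}\big)$, where $E$ and $\{\cdot\}$ are the integer and fractional parts, and put $T_{(\omega,i)}=T_1$ if $i<h(\omega)-1$ and $T_{(\omega,i)}=T_0$ if $i=h(\omega)-1$. Let $\phi=2\cdot\mathbf 1_{[0,1/2]}$ and $\psi=\phi-\int_{[0,1]}\phi\,dm$. Then the associated cocycle of transfer operators $(\mathcal L_{(\omega,i)})_{(\omega,i)\in\Omega}$ is good, with equivariant absolutely continuous measures $\mu_{(\omega,i)}=m$ for all $(\omega,i)\in\Omega$; the observable $\psi$ is of bounded variation and satisfies $\int\psi\,dm=0$;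 and yet $$\lim_{N\to\infty}\frac1N\int_{[0,1]}\Big(\sum_{n=0}^{N-1}\psi\circ T^n_{(\omega,i)}\Big)^2dm=+\infty\quad\text{for }\mathbb P\text{-a.e. }(\omega,i)\in\Omega.$$
   Context: $\mathbb N=\{0,1,2,\dots\}$. For $y\in\Omega$, $T^n_y=T_{\sigma^{n-1}y}\circ\dots\circ T_y$. $\mathrm{var}$ is the classical (essential) total variation on $[0,1]$, $BV$ the space of $g\in L^1(m)$ with $\mathrm{var}(g)<\infty$, $\|g\|_{BV}=\|g\|_1+\mathrm{var}(g)$. The transfer operator $\mathcal L_y$ on $L^1(m)$ is given by $\int(\mathcal L_yf)g\,dm=\int f\,(g\circ T_y)\,dm$ for $f\in L^1$, $g\in L^\infty$, and $\mathcal L^n_y=\mathcal L_{\sigma^{n-1}y}\circ\dots\circ\mathcal L_y$. Equivariance of measures $\mu_y=v_y\,dm$ (with $v_y\ge0$, $\int v_y\,dm=1$) means $\mathcal L_yv_y=v_{\sigma y}$. Good cocycle (over an invertible ergodic measure preserving system $(\Omega,\mathcal F,\mathbb P,\sigma)$): (i) $\Omega$ is a Borel subset of a separable complete metric space, $\sigma$ is a homeomorphism, and $\Omega$ is a countable union of measurable sets on each of which $y\mapsto\mathcal L_y$ (as bounded operators on $BV$) is continuous; (ii) there is $C:\Omega\to(0,\infty)$ with $\log C\in L^1(\mathbb P)$ and $\|\mathcal L_yf\|_{BV}\le C(y)\|f\|_{BV}$ for $\mathbb P$-a.e. $y$ and $f\in BV$; (iii) there are an integer $N\ge1$ and random variables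 $\alpha^N,K^N:\Omega\to(0,\infty)$ with $\int\log\alpha^N\,d\mathbb P<0$, $\log K^N\in L^1(\mathbb P)$ and $\mathrm{var}(\mathcal L^N_yf)\le\alpha^N(y)\mathrm{var}(f)+K^N(y)\|f\|_1$ for $\mathbb P$-a.e. $y$ and $f\in BV$; (iv) for each $a>0$ and $\mathbb P$-a.e. $y$ there are random numbers $n_c(y)<\infty$ and $\alpha_0(y),\alpha_1(y),\dots>0$ such that $\operatorname{essinf}\mathcal L^n_yf\ge\alpha_n(y)\|f\|_1$ for all $n\ge n_c(y)$ and all $f\in L^\infty(m)$ with $f\ge0$, $\mathrm{var}(f)\le a\|f\|_1$; (v) $\log(\operatorname{essinf}\mathcal L_y\mathbf 1)\in L^1(\mathbb P)$. *)

theory Defs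
  imports "HOL-Probability.Probability"
begin

text \<open>Elements of \<open>L\<^sup>1\<close>, \<open>L\<^sup>\<infinity>\<close> and \<open>BV\<close> are represented by functions; apart from
  \<open>total_var\<close>, the notions below depend only on the class of a function modulo equality almost
  everywhere. Norms and variations take values in \<open>ennreal\<close>, so that a finite upper bound
  also asserts finiteness.\<close>

definition leb01 :: "real measure" where
  "leb01 = restrict_space lborel {0..1}"

definition Linf :: "(real \<Rightarrow> real) set" where
  "Linf = {g \<in> borel_measurable leb01. \<exists>B. AE x in leb01. \<bar>g x\<bar> \<le> B}"

definition L1_norm :: "(real \<Rightarrow> real) \<Rightarrow> ennreal" where
  "L1_norm f = (\<integral>\<^sup>+ x. ennreal \<bar>f x\<bar> \<partial>leb01)"

definition total_var :: "(real \<Rightarrow> real) \<Rightarrow> ennreal" where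
  "total_var f = (SUP ts \<in> {ts. sorted ts \<and> set ts \<subseteq> {0..1}}.
     \<Sum>i<length ts - 1. ennreal \<bar>f (ts ! Suc i) - f (ts ! i)\<bar>)"

definition ess_var :: "(real \<Rightarrow> real) \<Rightarrow> ennreal" where
  "ess_var f = (INF g \<in> {g. AE x in leb01. g x = f x}. total_var g)"

definition BV :: "(real \<Rightarrow> real) set" where
  "BV = {f. integrable leb01 f \<and> ess_var f < \<infinity>}"

definition BV_norm :: "(real \<Rightarrow> real) \<Rightarrow> ennreal" where
  "BV_norm f = L1_norm f + ess_var f"

definition BV_opnorm :: "((real \<Rightarrow> real) \<Rightarrow> real \<Rightarrow> real) \<Rightarrow> ennreal" where
  "BV_opnorm A = (SUP f \<in> {f \<in> BV. BV_norm f \<le> 1}. BV_norm (A f))"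

definition essinf :: "(real \<Rightarrow> real) \<Rightarrow> ereal" where
  "essinf f = - esssup leb01 (\<lambda>x. - ereal (f x))"

definition nonsingular :: "(real \<Rightarrow> real) \<Rightarrow> bool" where
  "nonsingular T \<longleftrightarrow> T \<in> measurable leb01 leb01 \<and>
     (\<forall>A \<in> null_sets leb01. T -` A \<inter> space leb01 \<in> null_sets leb01)"

text \<open>For nonsingular \<open>T\<close> and integrable \<open>f\<close> the function chosen here exists and is unique up to
  equality almost everywhere.\<close>

definition transfer_op :: "(real \<Rightarrow> real) \<Rightarrow> (real \<Rightarrow> real) \<Rightarrow> real \<Rightarrow> real" where
  "transfer_op T f = (SOME u. integrable leb01 u \<and>
     (\<forall>g \<in> Linf. (\<integral>x. u x * g x \<partial>leb01) = (\<integral>x. f x * g (T x) \<partial>leb01)))"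

primrec cocycle :: "('y \<Rightarrow> 'y) \<Rightarrow> ('y \<Rightarrow> 'a \<Rightarrow> 'a) \<Rightarrow> nat \<Rightarrow> 'y \<Rightarrow> 'a \<Rightarrow> 'a" where
  "cocycle \<sigma> A 0 y = id"
| "cocycle \<sigma> A (Suc n) y = A ((\<sigma> ^^ n) y) \<circ> cocycle \<sigma> A n y"

definition invertible_ergodic_mps :: "'y measure \<Rightarrow> ('y \<Rightarrow> 'y) \<Rightarrow> bool" where
  "invertible_ergodic_mps M \<sigma> \<longleftrightarrow>
     prob_space M \<and>
     bij_betw \<sigma> (space M) (space M) \<and>
     \<sigma> \<in> measurable M M \<and>
     inv_into (space M) \<sigma> \<in> measurable M M \<and>
     distr M M \<sigma> = M \<and>
     (\<forall>A \<in> sets M. \<sigma> -` A \<inter> space M = A \<longrightarrow> emeasure M A = 0 \<or> emeasure M A = 1)"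

text \<open>The ambient separable complete metric space is the type \<open>'y\<close> with its topology, and the
  \<open>\<sigma>\<close>-algebra is the Borel one. In the application \<open>'y\<close> is \<open>(int \<Rightarrow> nat) \<times> nat\<close>, with the product
  of discrete topologies.\<close>

definition good_regular ::
  "'y::topological_space measure \<Rightarrow> ('y \<Rightarrow> 'y) \<Rightarrow> ('y \<Rightarrow> (real \<Rightarrow> real) \<Rightarrow> real \<Rightarrow> real) \<Rightarrow> bool" where
  "good_regular M \<sigma> L \<longleftrightarrow>
     completely_metrizable_space (euclidean :: 'y topology) \<and>
     separable_space (euclidean :: 'y topology) \<and>
     space M \<in> sets borel \<and>
     sets M = sets (restrict_space borel (space M)) \<and>
     (\<exists>\<tau>. homeomorphism (space M) (space M) \<sigma> \<tau>) \<and>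
     (\<forall>y \<in> space M. BV_opnorm (L y) < \<infinity>) \<and>
     (\<exists>U :: nat \<Rightarrow> 'y set. (\<forall>k. U k \<in> sets M) \<and> (\<Union>k. U k) = space M \<and>
        (\<forall>k. \<forall>y \<in> U k. ((\<lambda>z. BV_opnorm (\<lambda>f x. L z f x - L y f x)) \<longlongrightarrow> 0) (at y within U k)))"

definition good_bounded ::
  "'y measure \<Rightarrow> ('y \<Rightarrow> (real \<Rightarrow> real) \<Rightarrow> real \<Rightarrow> real) \<Rightarrow> bool" where
  "good_bounded M L \<longleftrightarrow>
     (\<exists>C :: 'y \<Rightarrow> real. (\<forall>y \<in> space M. 0 < C y) \<and>
        integrable M (\<lambda>y. ln (C y)) \<and>
        (AE y in M. \<forall>f \<in> BV. BV_norm (L y f) \<le> ennreal (C y) * BV_norm f))"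

text \<open>Integrability of \<open>ln \<alpha>\<close> in the next definition is no restriction: if the integral is \<open>-\<infinity>\<close>, it
  becomes finite and negative after replacing \<open>\<alpha>\<close> by \<open>max \<alpha> \<epsilon>\<close> with \<open>\<epsilon>\<close> small.\<close>

definition good_lasota_yorke ::
  "'y measure \<Rightarrow> ('y \<Rightarrow> 'y) \<Rightarrow> ('y \<Rightarrow> (real \<Rightarrow> real) \<Rightarrow> real \<Rightarrow> real) \<Rightarrow> bool" where
  "good_lasota_yorke M \<sigma> L \<longleftrightarrow>
     (\<exists>N :: nat. N \<ge> 1 \<and>
      (\<exists>\<alpha> \<in> borel_measurable M. \<exists>K \<in> borel_measurable M.
        (\<forall>y \<in> space M. 0 < (\<alpha> y :: real)) \<and> (\<forall>y \<in> space M. 0 < (K y :: real)) \<and>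
        integrable M (\<lambda>y. ln (\<alpha> y)) \<and> (\<integral>y. ln (\<alpha> y) \<partial>M) < 0 \<and>
        integrable M (\<lambda>y. ln (K y)) \<and>
        (AE y in M. \<forall>f \<in> BV. ess_var (cocycle \<sigma> L N y f)
           \<le> ennreal (\<alpha> y) * ess_var f + ennreal (K y) * L1_norm f)))"

definition good_covering ::
  "'y measure \<Rightarrow> ('y \<Rightarrow> 'y) \<Rightarrow> ('y \<Rightarrow> (real \<Rightarrow> real) \<Rightarrow> real \<Rightarrow> real) \<Rightarrow> bool" where
  "good_covering M \<sigma> L \<longleftrightarrow>
     (\<forall>a :: real. a > 0 \<longrightarrow>
      (\<exists>n\<^sub>c \<in> measurable M (count_space (UNIV :: nat set)). \<exists>\<alpha> :: nat \<Rightarrow> 'y \<Rightarrow> real.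
        (\<forall>n. \<alpha> n \<in> borel_measurable M) \<and> (\<forall>n. \<forall>y \<in> space M. 0 < \<alpha> n y) \<and>
        (AE y in M. \<forall>n \<ge> n\<^sub>c y. \<forall>f \<in> Linf.
           (AE x in leb01. 0 \<le> f x) \<longrightarrow> ess_var f \<le> ennreal a * L1_norm f \<longrightarrow>
           ereal (\<alpha> n y) * enn2ereal (L1_norm f) \<le> essinf (cocycle \<sigma> L n y f))))"

text \<open>Positivity has to be required separately since \<open>ln 0 = 0\<close>.\<close>

definition good_essinf ::
  "'y measure \<Rightarrow> ('y \<Rightarrow> (real \<Rightarrow> real) \<Rightarrow> real \<Rightarrow> real) \<Rightarrow> bool" where
  "good_essinf M L \<longleftrightarrow>
     (AE y in M. 0 < essinf (L y (\<lambda>_. 1))) \<and>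
     integrable M (\<lambda>y. ln (real_of_ereal (essinf (L y (\<lambda>_. 1)))))"

definition good_cocycle ::
  "'y::topological_space measure \<Rightarrow> ('y \<Rightarrow> 'y) \<Rightarrow> ('y \<Rightarrow> real \<Rightarrow> real) \<Rightarrow> bool" where
  "good_cocycle M \<sigma> T \<longleftrightarrow>
     invertible_ergodic_mps M \<sigma> \<and>
     (\<forall>y \<in> space M. nonsingular (T y)) \<and>
     good_regular M \<sigma> (\<lambda>y. transfer_op (T y)) \<and>
     good_bounded M (\<lambda>y. transfer_op (T y)) \<and>
     good_lasota_yorke M \<sigma> (\<lambda>y. transfer_op (T y)) \<and>
     good_covering M \<sigma> (\<lambda>y. transfer_op (T y)) \<and>
     good_essinf M (\<lambda>y. transfer_op (T y))"

definition equivariant_ac_measures ::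
  "'y measure \<Rightarrow> ('y \<Rightarrow> 'y) \<Rightarrow> ('y \<Rightarrow> real \<Rightarrow> real) \<Rightarrow> ('y \<Rightarrow> real measure) \<Rightarrow> bool" where
  "equivariant_ac_measures M \<sigma> T \<mu> \<longleftrightarrow>
     (\<exists>v :: 'y \<Rightarrow> real \<Rightarrow> real. \<forall>y \<in> space M.
        integrable leb01 (v y) \<and> (AE x in leb01. 0 \<le> v y x) \<and> (\<integral>x. v y x \<partial>leb01) = 1 \<and>
        \<mu> y = density leb01 (\<lambda>x. ennreal (v y x)) \<and>
        (AE x in leb01. transfer_op (T y) (v y) x = v (\<sigma> y) x))"

definition suspension_space :: "'w measure \<Rightarrow> ('w \<Rightarrow> nat) \<Rightarrow> ('w \<times> nat) set" where
  "suspension_space Q h = {(\<omega>, i). \<omega> \<in> space Q \<and> i < h \<omega>}"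

definition suspension_measure :: "'w measure \<Rightarrow> ('w \<Rightarrow> nat) \<Rightarrow> ('w \<times> nat) measure" where
  "suspension_measure Q h =
     measure_of (suspension_space Q h)
       (sets (restrict_space (Q \<Otimes>\<^sub>M count_space UNIV) (suspension_space Q h)))
       (\<lambda>A. (\<Sum>i. emeasure Q {\<omega> \<in> space Q. (\<omega>, i) \<in> A}) / (\<integral>\<^sup>+ \<omega>. of_nat (h \<omega>) \<partial>Q))"

definition suspension_map :: "('w \<Rightarrow> 'w) \<Rightarrow> ('w \<Rightarrow> nat) \<Rightarrow> 'w \<times> nat \<Rightarrow> 'w \<times> nat" where
  "suspension_map S h = (\<lambda>(\<omega>, i). if i < h \<omega> - 1 then (\<omega>, i + 1) else (S \<omega>, 0))"

definition letter_measure :: "real \<Rightarrow> nat measure" where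
  "letter_measure \<delta> =
     (let Z = 1 / (\<Sum>n. 1 / real (Suc n) powr (2 + \<delta>))
      in point_measure {1..} (\<lambda>n. ennreal (Z / real n powr (2 + \<delta>))))"

definition bernoulli_measure :: "real \<Rightarrow> (int \<Rightarrow> nat) measure" where
  "bernoulli_measure \<delta> = (\<Pi>\<^sub>M n\<in>UNIV. letter_measure \<delta>)"

definition shift :: "(int \<Rightarrow> nat) \<Rightarrow> int \<Rightarrow> nat" where
  "shift \<omega> = (\<lambda>n. \<omega> (n + 1))"

definition roof :: "(int \<Rightarrow> nat) \<Rightarrow> nat" where
  "roof \<omega> = \<omega> 0"

abbreviation base_measure :: "real \<Rightarrow> ((int \<Rightarrow> nat) \<times> nat) measure" where
  "base_measure \<delta> \<equiv> suspension_measure (bernoulli_measure \<delta>) roof"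

abbreviation base_map :: "(int \<Rightarrow> nat) \<times> nat \<Rightarrow> (int \<Rightarrow> nat) \<times> nat" where
  "base_map \<equiv> suspension_map shift roof"

definition T0 :: "real \<Rightarrow> real" where
  "T0 x = frac (2 * x)"

definition T1 :: "real \<Rightarrow> real" where
  "T1 x = (of_int \<lfloor>2 * x\<rfloor> + frac (4 * x)) / 2"

definition fibre_map :: "(int \<Rightarrow> nat) \<times> nat \<Rightarrow> real \<Rightarrow> real" where
  "fibre_map = (\<lambda>(\<omega>, i). if i < roof \<omega> - 1 then T1 else T0)"

definition phi :: "real \<Rightarrow> real" where
  "phi x = 2 * indicator {0..1/2} x"

definition psi :: "real \<Rightarrow> real" where
  "psi x = phi x - (\<integral>t. phi t \<partial>leb01)"

end

theory Submission
  imports Defs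
begin

text \<open>
  In binary digits, \<open>T0\<close> deletes the first digit and \<open>T1\<close> deletes the second one, while \<open>psi\<close> is
  \<open>1\<close> or \<open>- 1\<close> according to the first digit. Along a column of the suspension only \<open>T1\<close> acts until
  the top floor is reached, so \<open>psi\<close> keeps its sign for the whole block; on the top floor \<open>T0\<close> brings
  in a fresh digit, independent of the previous ones. On the level of transfer operators this is the
  pair of identities \<open>transfer_op T1 psi = psi\<close> and \<open>transfer_op T0 psi = 0\<close> (\<open>transfer_psi\<close>). The
  correlation of the terms at times \<open>n\<close> and \<open>m\<close> is therefore \<open>1\<close> if both times lie in the same block
  and \<open>0\<close> otherwise (\<open>psi_correlation\<close>), and the variance \<open>V\<close> of the Birkhoff sum of length \<open>N\<close>
  is the sum of the squares of the block lengths up to time \<open>N\<close> (\<open>variance_eq\<close>).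

  Block lengths are the letters \<open>\<omega> k\<close>, independent with finite mean and, since \<open>\<delta> \<le> 1\<close>, infinite
  second moment. Hence the sum of the squares of the first \<open>K\<close> letters exceeds every multiple of \<open>K\<close>
  eventually (\<open>coord_squares_superlinear\<close>, by truncation, Hoeffding's inequality and Borel-Cantelli).
  This growth relative to \<open>K\<close> turns into growth relative to \<open>N\<close>: if \<open>K\<close> blocks meet the first \<open>N\<close>
  times, then \<open>N\<^sup>2 \<le> K * V\<close> by the Cauchy-Schwarz inequality, and together with \<open>V \<ge> C\<^sup>2 * K\<close>
  this gives \<open>V \<ge> C * N\<close> (\<open>variance_superlinear\<close>).

  The cocycle is good for the following reasons. Both transfer operators have explicit pointwise
  forms \<open>P0\<close> and \<open>P1\<close>; the first one halves the variation and the second one does not increase it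
  (\<open>total_var_P0\<close>, \<open>total_var_P1\<close>), so the Lasota-Yorke inequality holds in one step with factor \<open>1/2\<close>
  on the top floor and \<open>1\<close> elsewhere, and the top floor has positive measure. For the covering
  property, a function with small variation compared to its integral is at least half its mean on
  some dyadic interval (\<open>exists_dyadic_above\<close>); each step enlarges this interval until
  it has length \<open>1/2\<close>, and the next passage through the top floor spreads it over the unit
  interval (\<open>level_eq_0\<close>). Ergodicity of the suspension reduces to ergodicity of the base
  (\<open>\<sigma>_ergodic\<close>), which follows from mixing of the Bernoulli shift (\<open>mixing\<close>).
\<close>

section \<open>Transfer operators of maps with slope-two branches on the quarters of the unit interval\<close>

lemma space_leb01 [simp]: "space leb01 = {0..1}"
  by (simp add: leb01_def space_restrict_space)

lemma measurable_leb01_borel: "f \<in> borel_measurable borel \<Longrightarrow> f \<in> borel_measurable leb01"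
  unfolding leb01_def by (intro measurable_restrict_space1) auto

lemma emeasure_leb01_space: "emeasure leb01 {0..1} = 1"
  by (simp add: leb01_def emeasure_restrict_space)

interpretation leb01: prob_space leb01
  by (rule prob_spaceI) (simp add: emeasure_leb01_space)

lemma AE_leb01: "(AE x in leb01. P x) \<longleftrightarrow> (AE x in lborel. x \<in> {0..1} \<longrightarrow> P x)"
  unfolding leb01_def by (subst AE_restrict_space_iff) auto

lemma integral_leb01: "(\<integral>x. f x \<partial>leb01) = (\<integral>x. indicator {0..1} x * (f x::real) \<partial>lborel)"
  unfolding leb01_def by (subst integral_restrict_space) auto

lemma integrable_leb01: "integrable leb01 f \<longleftrightarrow> integrable lborel (\<lambda>x. indicator {0..1} x * (f x::real))"
  unfolding leb01_def by (subst integrable_restrict_space) auto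

lemma measurable_leb01_iff:
  "f \<in> borel_measurable leb01 \<longleftrightarrow> (\<lambda>x. indicator {0..1} x * (f x::real)) \<in> borel_measurable borel"
  unfolding leb01_def by (subst borel_measurable_restrict_space_iff) auto

lemma Linf_mult_integrable:
  assumes f: "integrable leb01 f" and g: "g \<in> Linf"
  shows "integrable leb01 (\<lambda>x. f x * g x)"
proof -
  from g obtain B where B: "AE x in leb01. \<bar>g x\<bar> \<le> B" and [measurable]: "g \<in> borel_measurable leb01"
    by (auto simp: Linf_def)
  have [measurable]: "f \<in> borel_measurable leb01" using f by auto
  show ?thesis
  proof (rule Bochner_Integration.integrable_bound)
    show "integrable leb01 (\<lambda>x. B * f x)" using f by simp
    show "AE x in leb01. norm (f x * g x) \<le> norm (B * f x)"
      using B
    proof eventually_elim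
      case (elim x)
      have "\<bar>f x\<bar> * \<bar>g x\<bar> \<le> \<bar>f x\<bar> * \<bar>B\<bar>" using elim by (intro mult_left_mono) auto
      then show ?case by (simp add: abs_mult mult.commute)
    qed
  qed simp
qed

lemma Linf_integrable: "g \<in> Linf \<Longrightarrow> integrable leb01 g"
  using Linf_mult_integrable[of "\<lambda>_. 1" g] by simp

lemma Linf_boundedI: "g \<in> borel_measurable leb01 \<Longrightarrow> (\<And>x. \<bar>g x\<bar> \<le> B) \<Longrightarrow> g \<in> Linf"
  by (auto simp: Linf_def intro!: exI[of _ B])

text \<open>Uniqueness of the transferred density: the difference of two candidates is tested against its own sign.\<close>

lemma transfer_opI:
  assumes u: "integrable leb01 u"
    and dual: "\<And>g. g \<in> Linf \<Longrightarrow> (\<integral>x. u x * g x \<partial>leb01) = (\<integral>x. f x * g (T x) \<partial>leb01)"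
  shows "integrable leb01 (transfer_op T f)" and "AE x in leb01. transfer_op T f x = u x"
proof -
  let ?Q = "\<lambda>u. integrable leb01 u \<and> (\<forall>g \<in> Linf. (\<integral>x. u x * g x \<partial>leb01) = (\<integral>x. f x * g (T x) \<partial>leb01))"
  have "?Q u" using assms by blast
  then have Q: "?Q (transfer_op T f)"
    unfolding transfer_op_def by (rule someI[of ?Q])
  then show w: "integrable leb01 (transfer_op T f)" by blast
  let ?d = "\<lambda>x. transfer_op T f x - u x"
  have d: "integrable leb01 ?d" using w u by simp
  have [measurable]: "transfer_op T f \<in> borel_measurable leb01" "u \<in> borel_measurable leb01"
    using w u by auto
  have s: "(\<lambda>x. sgn (?d x)) \<in> Linf"
    by (rule Linf_boundedI[of _ 1]) (auto simp: sgn_if)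
  have "(\<integral>x. \<bar>?d x\<bar> \<partial>leb01) = (\<integral>x. transfer_op T f x * sgn (?d x) - u x * sgn (?d x) \<partial>leb01)"
    by (intro Bochner_Integration.integral_cong) (auto simp: sgn_if)
  also have "\<dots> = (\<integral>x. transfer_op T f x * sgn (?d x) \<partial>leb01) - (\<integral>x. u x * sgn (?d x) \<partial>leb01)"
    by (intro Bochner_Integration.integral_diff Linf_mult_integrable w u s)
  also have "\<dots> = 0" using Q dual s by simp
  finally have "AE x in leb01. \<bar>?d x\<bar> = 0"
    using d by (subst (asm) integral_nonneg_eq_0_iff_AE) auto
  then show "AE x in leb01. transfer_op T f x = u x" by eventually_elim simp
qed

text \<open>The exceptional set is enlarged to a measurable null set before it is transported. Arbitrary predicates matter because the representatives of small variation used later come without any measurability.\<close>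

lemma AE_lborel_affine:
  fixes R :: "real \<Rightarrow> bool"
  assumes "AE x in lborel. R x" and "c \<noteq> 0" shows "AE x in lborel. R (t + c * x)"
proof -
  obtain N where N: "{x \<in> space lborel. \<not> R x} \<subseteq> N" "N \<in> null_sets lborel"
    using assms(1) by (auto simp: eventually_ae_filter)
  have "AE x in lborel. x \<notin> N" using N(2) by (rule AE_not_in)
  moreover have "Measurable.pred borel (\<lambda>x. x \<notin> N)" using N(2) by auto
  ultimately have "AE x in lborel. t + c * x \<notin> N"
    using assms(2) by (intro AE_borel_affine[where P = "\<lambda>x. x \<notin> N"]) auto
  then show ?thesis by eventually_elim (use N(1) in auto)
qed

text \<open>Quarters are the coarsest common refinement of the branches of \<open>T0\<close> and \<open>T1\<close>, so that both maps are instances. Half-open quarters miss the point \<open>1\<close>, which is a null set.\<close>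

locale doubling_branches =
  fixes T :: "real \<Rightarrow> real" and c :: "nat \<Rightarrow> real"
  assumes meas [measurable]: "T \<in> borel_measurable borel"
    and range: "\<And>x. x \<in> {0..1} \<Longrightarrow> T x \<in> {0..1}"
    and branch: "\<And>j x. j < 4 \<Longrightarrow> x \<in> {real j / 4..<real (Suc j) / 4} \<Longrightarrow> T x = 2 * x - c j"
begin

abbreviation I :: "nat \<Rightarrow> real set" where "I j \<equiv> {real j / 4..<real (Suc j) / 4}"

text \<open>The indicator selects those inverse branches that are defined at \<open>y\<close>; each branch has slope \<open>2\<close>.\<close>

definition Pop :: "(real \<Rightarrow> real) \<Rightarrow> real \<Rightarrow> real" where
  "Pop f y = (\<Sum>j<4. indicator (I j) ((y + c j) / 2) * f ((y + c j) / 2)) / 2"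

lemma indicator_quarters:
  assumes "x \<noteq> 1" shows "indicator {0..1} x = (\<Sum>j<4. indicator (I j) x :: real)"
proof (cases "x \<in> {0..<1}")
  case True
  have "x \<in> I j \<longleftrightarrow> j = nat \<lfloor>4 * x\<rfloor>" for j
    using True by (auto simp: field_simps) linarith+
  then have "(\<Sum>j<4. indicator (I j) x :: real) = (\<Sum>j<4. if j = nat \<lfloor>4 * x\<rfloor> then 1 else 0)"
    by (simp add: indicator_def)
  also have "\<dots> = 1" using True by (simp add: nat_less_iff floor_less_iff)
  finally show ?thesis using True by simp
next
  case False
  then have "x \<notin> I j" if "j < 4" for j
    using that by (auto simp: field_simps)
  then show ?thesis using False assms by (auto simp: indicator_def intro!: sum.neutral)
qed

lemma measurable_T: "T \<in> measurable leb01 leb01"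
  unfolding leb01_def
  by (rule measurable_restrict_space3) (use range in auto)

lemma AE_T:
  assumes "AE x in leb01. Q x" shows "AE x in leb01. Q (T x)"
proof -
  have a: "AE x in lborel. x \<in> {0..1} \<longrightarrow> Q x" using assms by (simp add: AE_leb01)
  have "AE x in lborel. \<forall>j<4::nat. 2 * x - c j \<in> {0..1} \<longrightarrow> Q (2 * x - c j)"
  proof -
    have "AE x in lborel. - c j + 2 * x \<in> {0..1} \<longrightarrow> Q (- c j + 2 * x)" for j
      using AE_lborel_affine[OF a, of 2 "- c j"] by simp
    then have "AE x in lborel. \<forall>j::nat. - c j + 2 * x \<in> {0..1} \<longrightarrow> Q (- c j + 2 * x)"
      by (subst AE_all_countable) blast
    then show ?thesis by eventually_elim (simp add: algebra_simps)
  qed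
  moreover have "AE x in lborel. x \<noteq> (1::real)" by (rule AE_lborel_singleton)
  ultimately have "AE x in lborel. x \<in> {0..1} \<longrightarrow> Q (T x)"
  proof eventually_elim
    case (elim x)
    show ?case
    proof
      assume x: "x \<in> {0..1}"
      with elim(2) obtain j where j: "j < 4" "x \<in> I j"
      proof -
        show ?thesis using x elim(2)
          by (intro that[of "nat \<lfloor>4 * x\<rfloor>"]) (auto simp: nat_less_iff floor_less_iff field_simps, linarith+)
      qed
      then show "Q (T x)" using elim(1) branch[of j x] range[OF x] by auto
    qed
  qed
  then show ?thesis by (simp add: AE_leb01)
qed

lemma nonsingular: "nonsingular T"
  unfolding nonsingular_def
proof (intro conjI ballI)
  show "T \<in> measurable leb01 leb01" by (rule measurable_T)
  fix A assume A: "A \<in> null_sets leb01"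
  then have "AE x in leb01. x \<notin> A" by (rule AE_not_in)
  then have "AE x in leb01. T x \<notin> A" by (rule AE_T)
  moreover have s: "T -` A \<inter> space leb01 \<in> sets leb01"
    by (rule measurable_sets[OF measurable_T]) (use A in auto)
  ultimately have "AE x in leb01. x \<notin> T -` A \<inter> space leb01" by auto
  then show "T -` A \<inter> space leb01 \<in> null_sets leb01"
    using s by (simp add: AE_iff_null_sets)
qed

lemma Linf_comp: "g \<in> Linf \<Longrightarrow> (\<lambda>x. g (T x)) \<in> Linf"
  unfolding Linf_def using measurable_compose[OF measurable_T] AE_T[of "\<lambda>x. \<bar>g x\<bar> \<le> _"] by blast

text \<open>On each quarter the duality relation is the substitution \<open>x = (y + c j) / 2\<close>.\<close>

lemma
  assumes f: "integrable leb01 f"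
  shows Pop_integrable: "integrable leb01 (Pop f)"
    and Pop_dual: "g \<in> Linf \<Longrightarrow> (\<integral>x. Pop f x * g x \<partial>leb01) = (\<integral>x. f x * g (T x) \<partial>leb01)"
proof -
  have fj: "integrable lborel (\<lambda>x. indicator (I j) x * f x)" if "j < 4" for j
  proof -
    have "integrable lborel (\<lambda>x. indicator (I j) x *\<^sub>R (indicator {0..1} x * f x))"
      using f by (intro integrable_mult_indicator) (auto simp: integrable_leb01)
    moreover have "indicator (I j) x *\<^sub>R (indicator {0..1} x * f x) = indicator (I j) x * f x" for x
      using that by (cases "x \<in> I j") (simp_all add: indicator_def)
    ultimately show ?thesis by (simp only:)
  qed
  have yI: "y \<in> {0..1}" if "j < 4" "(y + c j) / 2 \<in> I j" for j y
  proof -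
    have x: "(y + c j) / 2 \<in> {0..1}" using that by auto
    show ?thesis using range[OF x] branch[OF that] by (simp add: field_simps)
  qed
  let ?F = "\<lambda>j y. indicator (I j) ((y + c j) / 2) * f ((y + c j) / 2)"
  have Fint: "integrable lborel (?F j)" if "j < 4" for j
    using lborel_integrable_real_affine[OF fj[OF that], of "1/2" "c j / 2"]
    by (simp add: field_simps)
  have P01: "indicator {0..1} y * Pop f y = Pop f y" for y
  proof (cases "y \<in> {0..1}")
    case False
    then have "indicator (I j) ((y + c j) / 2) * f ((y + c j) / 2) = 0" if "j < 4" for j
      using yI[OF that, of y] by (cases "(y + c j) / 2 \<in> I j") (simp_all only: indicator_simps, auto)
    then have "(\<Sum>j<4. indicator (I j) ((y + c j) / 2) * f ((y + c j) / 2)) = 0"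
      by (intro sum.neutral ballI) blast
    then have "Pop f y = 0" unfolding Pop_def by simp
    then show ?thesis by simp
  qed simp
  have "integrable lborel (Pop f)"
    unfolding Pop_def by (intro integrable_divide Bochner_Integration.integrable_sum Fint) auto
  then show P: "integrable leb01 (Pop f)" by (simp add: integrable_leb01 P01)
  assume g: "g \<in> Linf"
  let ?g = "\<lambda>x. indicator {0..1} x * g x"
  have gm: "?g \<in> borel_measurable borel" using g by (auto simp: Linf_def measurable_leb01_iff)
  have fgT: "integrable leb01 (\<lambda>x. f x * g (T x))"
    using f g Linf_comp by (intro Linf_mult_integrable) auto
  have fgTj: "integrable lborel (\<lambda>x. indicator (I j) x * (f x * ?g (2 * x - c j)))" if "j < 4" for j
  proof -
    have "integrable lborel (\<lambda>x. indicator (I j) x *\<^sub>R (indicator {0..1} x * (f x * g (T x))))"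
      using fgT by (intro integrable_mult_indicator) (auto simp: integrable_leb01)
    moreover have "indicator (I j) x *\<^sub>R (indicator {0..1} x * (f x * g (T x))) = indicator (I j) x * (f x * ?g (2 * x - c j))" for x
    proof -
      have "x \<in> I j \<Longrightarrow> x \<in> {0..1} \<and> T x = 2 * x - c j \<and> 2 * x - c j \<in> {0..1}"
        using that branch[OF that, of x] range[of x] by auto
      then show ?thesis by (cases "x \<in> I j") (simp_all add: indicator_def)
    qed
    ultimately show ?thesis by (simp only:)
  qed
  have tr: "(\<integral>x. indicator (I j) x * (f x * ?g (2 * x - c j)) \<partial>lborel) = (\<integral>y. ?F j y / 2 * ?g y \<partial>lborel)" for j
    by (subst lborel_integral_real_affine[of "1/2" _ "c j / 2"]) (simp_all add: field_simps)
  have trint: "integrable lborel (\<lambda>y. ?F j y / 2 * ?g y)" if "j < 4" for j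
    using lborel_integrable_real_affine[OF fgTj[OF that], of "1/2" "c j / 2"]
    by (simp add: field_simps)
  have "(\<integral>x. f x * g (T x) \<partial>leb01) = (\<integral>x. (\<Sum>j<4. indicator (I j) x * (f x * ?g (2 * x - c j))) \<partial>lborel)"
    unfolding integral_leb01
  proof (rule integral_cong_AE)
    show "(\<lambda>x. indicator {0..1} x * (f x * g (T x))) \<in> borel_measurable lborel"
      using fgT by (simp add: integrable_leb01 borel_measurable_integrable)
    show "(\<lambda>x. \<Sum>j<4. indicator (I j) x * (f x * ?g (2 * x - c j))) \<in> borel_measurable lborel"
      using fgTj by (intro borel_measurable_sum) (auto intro!: borel_measurable_integrable)
    have "AE x in lborel. x \<noteq> (1::real)" by (rule AE_lborel_singleton)
    then show "AE x in lborel. indicator {0..1} x * (f x * g (T x)) = (\<Sum>j<4. indicator (I j) x * (f x * ?g (2 * x - c j)))"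
    proof eventually_elim
      case (elim x)
      have "indicator (I j) x * (f x * g (T x)) = indicator (I j) x * (f x * ?g (2 * x - c j))" if "j < 4" for j
      proof (cases "x \<in> I j")
        case True
        then have "T x = 2 * x - c j" "x \<in> {0..1}" using branch[OF that True] that by auto
        with range[of x] show ?thesis by (simp add: indicator_def)
      qed auto
      then show ?case
        unfolding indicator_quarters[OF elim] sum_distrib_right by (intro sum.cong) auto
    qed
  qed
  also have "\<dots> = (\<Sum>j<4. \<integral>y. ?F j y / 2 * ?g y \<partial>lborel)"
    by (rule trans[OF Bochner_Integration.integral_sum[OF fgTj] sum.cong[OF refl tr]]) auto
  also have "\<dots> = (\<integral>y. (\<Sum>j<4. ?F j y / 2 * ?g y) \<partial>lborel)"
    by (rule Bochner_Integration.integral_sum[OF trint, symmetric]) auto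
  also have "\<dots> = (\<integral>x. Pop f x * g x \<partial>leb01)"
    unfolding integral_leb01
    unfolding Pop_def sum_divide_distrib sum_distrib_right sum_distrib_left
    by (intro Bochner_Integration.integral_cong sum.cong refl) (simp add: mult_ac)
  finally show "(\<integral>x. Pop f x * g x \<partial>leb01) = (\<integral>x. f x * g (T x) \<partial>leb01)" by simp
qed

text \<open>The essential variation is an infimum over all functions in the class of \<open>f\<close>, hence the pointwise operator must respect equality almost everywhere for arbitrary functions.\<close>

lemma Pop_cong_AE:
  assumes "AE x in leb01. f x = f' x" shows "AE x in leb01. Pop f x = Pop f' x"
proof -
  have a: "AE x in lborel. x \<in> {0..1} \<longrightarrow> f x = f' x" using assms by (simp add: AE_leb01)
  have "AE y in lborel. \<forall>j. c j / 2 + 1/2 * y \<in> {0..1} \<longrightarrow> f (c j / 2 + 1/2 * y) = f' (c j / 2 + 1/2 * y)"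
    by (subst AE_all_countable) (intro allI AE_lborel_affine[OF a], simp)
  then have "AE y in lborel. y \<in> {0..1} \<longrightarrow> Pop f y = Pop f' y"
  proof eventually_elim
    case (elim y)
    have "indicator (I j) ((y + c j) / 2) * f ((y + c j) / 2) = indicator (I j) ((y + c j) / 2) * f' ((y + c j) / 2)"
      if "j < 4" for j
    proof (cases "(y + c j) / 2 \<in> I j")
      case True
      then have "(y + c j) / 2 \<in> {0..1}" using that by auto
      moreover have "(y + c j) / 2 = c j / 2 + 1/2 * y" by (simp add: field_simps)
      ultimately have "f ((y + c j) / 2) = f' ((y + c j) / 2)" using elim by metis
      then show ?thesis by simp
    qed simp
    then have "(\<Sum>j<4. indicator (I j) ((y + c j) / 2) * f ((y + c j) / 2)) =
        (\<Sum>j<4. indicator (I j) ((y + c j) / 2) * f' ((y + c j) / 2))"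
      by (intro sum.cong refl) (simp only: lessThan_iff)
    then show ?case unfolding Pop_def by simp
  qed
  then show ?thesis by (simp add: AE_leb01)
qed

lemma
  assumes f: "integrable leb01 f"
  shows transfer_op_integrable: "integrable leb01 (transfer_op T f)"
    and transfer_op_AE_Pop: "AE x in leb01. transfer_op T f x = Pop f x"
    and transfer_op_dual: "g \<in> Linf \<Longrightarrow> (\<integral>x. transfer_op T f x * g x \<partial>leb01) = (\<integral>x. f x * g (T x) \<partial>leb01)"
proof -
  note I = transfer_opI[of "Pop f" f T, OF Pop_integrable[OF f] Pop_dual[OF f]]
  show int: "integrable leb01 (transfer_op T f)" and ae: "AE x in leb01. transfer_op T f x = Pop f x"
    using I by blast+
  assume g: "g \<in> Linf"
  have "(\<integral>x. transfer_op T f x * g x \<partial>leb01) = (\<integral>x. Pop f x * g x \<partial>leb01)"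
    using ae by (intro integral_cong_AE borel_measurable_integrable Linf_mult_integrable int g Pop_integrable f) auto
  with Pop_dual[OF f g] show "(\<integral>x. transfer_op T f x * g x \<partial>leb01) = (\<integral>x. f x * g (T x) \<partial>leb01)" by simp
qed

text \<open>Testing the transferred density against its own sign gives the contraction in \<open>L\<^sup>1\<close>.\<close>

lemma L1_norm_transfer_op:
  assumes f: "integrable leb01 f" shows "L1_norm (transfer_op T f) \<le> L1_norm f"
proof -
  let ?u = "transfer_op T f"
  have u: "integrable leb01 ?u" by (rule transfer_op_integrable[OF f])
  have [measurable]: "?u \<in> borel_measurable leb01" using u by auto
  have s: "(\<lambda>x. sgn (?u x)) \<in> Linf" by (rule Linf_boundedI[of _ 1]) (auto simp: sgn_if)
  have "(\<integral>x. \<bar>?u x\<bar> \<partial>leb01) = (\<integral>x. ?u x * sgn (?u x) \<partial>leb01)"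
    by (intro Bochner_Integration.integral_cong) (auto simp: sgn_if)
  also have "\<dots> = (\<integral>x. f x * sgn (?u (T x)) \<partial>leb01)" by (rule transfer_op_dual[OF f s])
  also have "\<dots> \<le> (\<integral>x. \<bar>f x\<bar> \<partial>leb01)"
    using f Linf_mult_integrable[OF f Linf_comp[OF s]]
    by (intro integral_mono) (auto simp: sgn_if)
  finally show ?thesis
    using f u unfolding L1_norm_def by (simp add: nn_integral_eq_integral)
qed

end

text \<open>Pointwise representatives of the transfer operators of \<open>T0\<close> and \<open>T1\<close> on the whole unit interval. Unlike \<open>transfer_op\<close>, which is chosen up to null sets, they allow pointwise estimates of variations.\<close>

definition P0 :: "(real \<Rightarrow> real) \<Rightarrow> real \<Rightarrow> real" where
  "P0 f y = (f (y / 2) + f (y / 2 + 1 / 2)) / 2"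

definition P1 :: "(real \<Rightarrow> real) \<Rightarrow> real \<Rightarrow> real" where
  "P1 f y = (if y < 1 / 2 then (f (y / 2) + f (y / 2 + 1 / 4)) / 2
             else (f (y / 2 + 1 / 4) + f (y / 2 + 1 / 2)) / 2)"

lemma less_4_cases: "(j::nat) < 4 \<Longrightarrow> j = 0 \<or> j = 1 \<or> j = 2 \<or> j = 3"
  by auto

lemma sum_lessThan_4: "(\<Sum>j<4. F j) = F 0 + F 1 + F 2 + (F (3::nat) :: real)"
  by (simp add: eval_nat_numeral)

interpretation D0: doubling_branches T0 "\<lambda>j. if j < 2 then 0 else 1"
proof
  show "T0 \<in> borel_measurable borel" unfolding T0_def frac_def by measurable
  show "T0 x \<in> {0..1}" for x using frac_ge_0[of "2 * x"] frac_lt_1[of "2 * x"] by (auto simp: T0_def)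
  show "T0 x = 2 * x - (if j < 2 then 0 else 1)"
    if "j < 4" "x \<in> {real j / 4..<real (Suc j) / 4}" for j x
    using less_4_cases[OF that(1)] that(2)
    by (elim disjE) (auto simp: T0_def frac_def floor_eq_iff)
qed

interpretation D1: doubling_branches T1 "\<lambda>j. if j = 0 then 0 else if j < 3 then 1 / 2 else 1"
proof
  show "T1 \<in> borel_measurable borel" unfolding T1_def frac_def by measurable
  show "T1 x \<in> {0..1}" if "x \<in> {0..1}" for x
  proof (cases "x = 1")
    case False
    then have "\<lfloor>2 * x\<rfloor> = 0 \<or> \<lfloor>2 * x\<rfloor> = 1"
      using that False by (cases "x < 1 / 2") (auto simp: floor_eq_iff)
    then show ?thesis using frac_ge_0[of "4 * x"] frac_lt_1[of "4 * x"]
      by (auto simp: T1_def)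
  qed (simp add: T1_def frac_def)
  show "T1 x = 2 * x - (if j = 0 then 0 else if j < 3 then 1 / 2 else 1)"
    if j: "j < 4" "x \<in> {real j / 4..<real (Suc j) / 4}" for j x
  proof -
    have "\<lfloor>4 * x\<rfloor> = int j" using j by (auto simp: floor_eq_iff)
    moreover have "\<lfloor>2 * x\<rfloor> = (if j < 2 then 0 else 1)"
      using less_4_cases[OF j(1)] j(2) by (elim disjE) (auto simp: floor_eq_iff)
    ultimately show ?thesis using less_4_cases[OF j(1)]
      by (elim disjE) (auto simp: T1_def frac_def)
  qed
qed

lemma Pop_eq_P0: "y \<in> {0..<1} \<Longrightarrow> D0.Pop f y = P0 f y"
  by (cases "y < 1 / 2")
     (auto simp: D0.Pop_def P0_def sum_lessThan_4 indicator_def add_divide_distrib)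

lemma Pop_eq_P1: "y \<in> {0..<1} \<Longrightarrow> D1.Pop f y = P1 f y"
  by (cases "y < 1 / 2")
     (auto simp: D1.Pop_def P1_def sum_lessThan_4 indicator_def add_divide_distrib)

lemma AE_leb01_halfopenI:
  assumes "\<And>x. x \<in> {0..<1} \<Longrightarrow> Q x" shows "AE x in leb01. Q x"
proof -
  have "AE x in lborel. x \<noteq> (1::real)" by (rule AE_lborel_singleton)
  then show ?thesis unfolding AE_leb01 by eventually_elim (use assms in auto)
qed

lemma transfer_op_T0:
  assumes "integrable leb01 f" "AE x in leb01. f x = f' x"
  shows "AE x in leb01. transfer_op T0 f x = P0 f' x"
proof -
  have "AE x in leb01. D0.Pop f' x = P0 f' x" by (rule AE_leb01_halfopenI) (rule Pop_eq_P0)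
  with D0.Pop_cong_AE[OF assms(2)] D0.transfer_op_AE_Pop[OF assms(1)]
  show ?thesis by eventually_elim simp
qed

lemma transfer_op_T1:
  assumes "integrable leb01 f" "AE x in leb01. f x = f' x"
  shows "AE x in leb01. transfer_op T1 f x = P1 f' x"
proof -
  have "AE x in leb01. D1.Pop f' x = P1 f' x" by (rule AE_leb01_halfopenI) (rule Pop_eq_P1)
  with D1.Pop_cong_AE[OF assms(2)] D1.transfer_op_AE_Pop[OF assms(1)]
  show ?thesis by eventually_elim simp
qed

section \<open>Variation under the two transfer operators\<close>

text \<open>The sums in \<open>total_var\<close> with real values and by recursion on the chain of points, which suits the concatenation of chains.\<close>

fun lvar :: "(real \<Rightarrow> real) \<Rightarrow> real list \<Rightarrow> real" where
  "lvar g (x # y # ts) = \<bar>g y - g x\<bar> + lvar g (y # ts)"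
| "lvar g _ = 0"

lemma lvar_nonneg: "0 \<le> lvar g ts"
  by (induction g ts rule: lvar.induct) auto

lemma sum_eq_lvar: "(\<Sum>i<length ts - 1. ennreal \<bar>g (ts ! Suc i) - g (ts ! i)\<bar>) = ennreal (lvar g ts)"
proof (induction g ts rule: lvar.induct)
  case (1 g x y ts)
  then show ?case
    by (simp add: sum.lessThan_Suc_shift lvar_nonneg ennreal_plus del: sum.lessThan_Suc)
qed auto

lemma total_var_ge: "sorted ts \<Longrightarrow> set ts \<subseteq> {0..1} \<Longrightarrow> ennreal (lvar g ts) \<le> total_var g"
  unfolding total_var_def sum_eq_lvar by (intro SUP_upper) auto

lemma total_var_leI:
  "(\<And>ts. sorted ts \<Longrightarrow> set ts \<subseteq> {0..1} \<Longrightarrow> ennreal (lvar g ts) \<le> B) \<Longrightarrow> total_var g \<le> B"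
  unfolding total_var_def sum_eq_lvar by (intro SUP_least) auto

lemma lvar_append:
  "xs \<noteq> [] \<Longrightarrow> ys \<noteq> [] \<Longrightarrow> lvar g (xs @ ys) = lvar g xs + \<bar>g (hd ys) - g (last xs)\<bar> + lvar g ys"
  by (induction g xs rule: lvar.induct) (auto simp: neq_Nil_conv)

lemma lvar_append_ge: "lvar g xs + lvar g ys \<le> lvar g (xs @ ys)"
  by (cases "xs = [] \<or> ys = []") (auto simp: lvar_append)

lemma lvar_map: "lvar g (map h ts) = lvar (\<lambda>x. g (h x)) ts"
  by (induction ts rule: induct_list012) auto

lemma lvar_cong: "(\<And>x. x \<in> set ts \<Longrightarrow> g x = h x) \<Longrightarrow> lvar g ts = lvar h ts"
  by (induction ts rule: induct_list012) auto

lemma lvar_average: "lvar (\<lambda>x. (a x + b x) / 2) ts \<le> (lvar a ts + lvar b ts) / 2"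
  by (induction ts rule: induct_list012) (auto simp: field_simps abs_if)

lemma lvar_abs: "lvar (\<lambda>x. \<bar>g x\<bar>) ts \<le> lvar g ts"
  by (induction ts rule: induct_list012) (auto intro!: add_mono)

lemma sorted_map_affine:
  "sorted ts \<Longrightarrow> sorted (map (\<lambda>x::real. x / 2) ts)" "sorted ts \<Longrightarrow> sorted (map (\<lambda>x::real. x / 2 + d) ts)"
  by (auto simp: sorted_wrt_map intro: sorted_wrt_mono_rel[rotated])

lemma total_var_abs: "total_var (\<lambda>x. \<bar>g x\<bar>) \<le> total_var g"
  by (rule total_var_leI) (rule order_trans[OF ennreal_leI[OF lvar_abs] total_var_ge])

lemma two_half: "2 * (ennreal (1 / 2) * x) = x"
proof -
  have "2 * ennreal (1 / 2) = ennreal (2 * (1 / 2))" by (subst ennreal_mult) simp_all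
  then show ?thesis by (simp only: mult.assoc[symmetric]) simp
qed

text \<open>The two preimages of a chain of points lie in the two halves of the interval, so they concatenate to one chain; the factor \<open>1/2\<close> comes from the slope.\<close>

lemma total_var_P0: "total_var (P0 g) \<le> ennreal (1 / 2) * total_var g"
proof (rule total_var_leI)
  fix ts :: "real list" assume ts: "sorted ts" "set ts \<subseteq> {0..1}"
  let ?A = "map (\<lambda>x. x / 2) ts @ map (\<lambda>x. x / 2 + 1 / 2) ts"
  have "lvar (P0 g) ts \<le> (lvar g (map (\<lambda>x. x / 2) ts) + lvar g (map (\<lambda>x. x / 2 + 1 / 2) ts)) / 2"
    unfolding P0_def lvar_map by (rule lvar_average)
  also have "\<dots> \<le> lvar g ?A / 2"
    using lvar_append_ge[of g "map (\<lambda>x. x / 2) ts" "map (\<lambda>x. x / 2 + 1 / 2) ts"] by simp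
  finally have "ennreal (lvar (P0 g) ts) \<le> ennreal (1 / 2 * lvar g ?A)" by (intro ennreal_leI) simp
  also have "\<dots> = ennreal (1 / 2) * ennreal (lvar g ?A)" by (rule ennreal_mult') simp
  also have "\<dots> \<le> ennreal (1 / 2) * total_var g"
  proof (intro mult_left_mono total_var_ge)
    have 01: "0 \<le> x" "x \<le> 1" if "x \<in> set ts" for x using ts(2) that by auto
    show "sorted ?A"
      unfolding sorted_append
    proof (intro conjI sorted_map_affine ts ballI, clarsimp)
      fix x y assume "x \<in> set ts" "y \<in> set ts"
      then show "x \<le> y + 1" using 01[of x] 01[of y] by linarith
    qed
    show "set ?A \<subseteq> {0..1}" using 01 by fastforce
  qed simp
  finally show "ennreal (lvar (P0 g) ts) \<le> ennreal (1 / 2) * total_var g" .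
qed

text \<open>Within each half of the interval the situation is that of \<open>T0\<close>, which costs half of the variation. In addition \<open>P1 g\<close> may jump at \<open>1/2\<close>, and this costs another half: \<open>T1\<close> preserves both halves, so its transfer operator fixes the jump of \<open>psi\<close> and no factor below \<open>1\<close> is possible.\<close>

lemma total_var_P1: "total_var (P1 g) \<le> total_var g"
proof (rule total_var_leI)
  fix ts :: "real list" assume ts: "sorted ts" "set ts \<subseteq> {0..1}"
  let ?a = "\<lambda>x::real. x / 2" and ?b = "\<lambda>x::real. x / 2 + 1 / 4" and ?d = "\<lambda>x::real. x / 2 + 1 / 2"
  define us where "us = takeWhile (\<lambda>x. x < 1 / 2) ts"
  define vs where "vs = dropWhile (\<lambda>x. x < 1 / 2) ts"
  have tsuv: "ts = us @ vs" by (simp add: us_def vs_def)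
  have us: "x < 1 / 2" if "x \<in> set us" for x using that unfolding us_def by (rule set_takeWhileD[THEN conjunct2])
  have s: "sorted us" "sorted vs" "set us \<subseteq> {0..1}" "set vs \<subseteq> {0..1}"
    using ts unfolding tsuv by (auto simp: sorted_append)
  have vs: "x \<ge> 1 / 2" if "x \<in> set vs" for x
  proof (cases vs)
    case (Cons v vs')
    then have "v \<ge> 1 / 2" by (metis hd_dropWhile list.sel(1) list.distinct(1) not_less vs_def)
    then show ?thesis using that s(2) Cons by auto
  qed (use that in auto)
  have lu: "lvar (P1 g) us \<le> (lvar g (map ?a us) + lvar g (map ?b us)) / 2"
    by (subst lvar_cong[of us _ "\<lambda>x. (g (?a x) + g (?b x)) / 2"])
       (use us lvar_average in \<open>auto simp: P1_def lvar_map\<close>)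
  have lv: "lvar (P1 g) vs \<le> (lvar g (map ?b vs) + lvar g (map ?d vs)) / 2"
  proof -
    have "lvar (P1 g) vs = lvar (\<lambda>x. (g (?b x) + g (?d x)) / 2) vs"
      by (rule lvar_cong) (use vs in \<open>force simp: P1_def\<close>)
    then show ?thesis using lvar_average[of "\<lambda>x. g (?b x)" "\<lambda>x. g (?d x)" vs] by (simp add: lvar_map)
  qed
  let ?A = "map ?a us @ map ?b us @ map ?b vs @ map ?d vs"
  have sA: "sorted ?A" using s(1,2)
    by (auto simp: sorted_append sorted_map_affine) (use us vs s in force)+
  have A01: "set ?A \<subseteq> {0..1}" using us vs s(3,4) by force
  have A: "lvar g ?A \<ge> lvar g (map ?a us) + (lvar g (map ?b us @ map ?b vs) + lvar g (map ?d vs))"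
    using lvar_append_ge[of g "map ?a us" "map ?b us @ map ?b vs @ map ?d vs"]
      lvar_append_ge[of g "map ?b us @ map ?b vs" "map ?d vs"] by simp
  \<comment> \<open>Half of the jump of \<open>P1 g\<close> at \<open>1/2\<close> is the gap in the middle of the list \<open>?A\<close>; the list \<open>B\<close> pays for the other half.\<close>
  obtain B where B: "sorted B" "set B \<subseteq> {0..1}" "lvar (P1 g) ts \<le> (lvar g ?A + lvar g B) / 2"
  proof (cases "us = [] \<or> vs = []")
    case True
    then have "lvar (P1 g) ts \<le> lvar g ?A / 2" using lu lv A by (auto simp: tsuv)
    then show ?thesis by (intro that[of "[]"]) auto
  next
    case False
    define u where "u = last us"
    define v where "v = hd vs"
    have uv: "u \<in> set us" "v \<in> set vs" using False by (auto simp: u_def v_def)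
    have "P1 g u = (g (?a u) + g (?b u)) / 2" "P1 g v = (g (?b v) + g (?d v)) / 2"
      using us[OF uv(1)] vs[OF uv(2)] by (auto simp: P1_def)
    then have "\<bar>P1 g v - P1 g u\<bar> \<le> (\<bar>g (?b v) - g (?b u)\<bar> + \<bar>g (?d v) - g (?a u)\<bar>) / 2"
      by (simp add: field_simps abs_if)
    moreover have "lvar g (map ?b us @ map ?b vs) = lvar g (map ?b us) + \<bar>g (?b v) - g (?b u)\<bar> + lvar g (map ?b vs)"
      using False by (subst lvar_append) (auto simp: u_def v_def hd_map last_map)
    moreover have "lvar (P1 g) ts = lvar (P1 g) us + \<bar>P1 g v - P1 g u\<bar> + lvar (P1 g) vs"
      unfolding tsuv using False by (subst lvar_append) (auto simp: u_def v_def)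
    ultimately have "lvar (P1 g) ts \<le> (lvar g ?A + lvar g [?a u, ?d v]) / 2"
      using A lu lv by (simp add: field_simps)
    moreover have "u \<in> {0..1}" "v \<in> {0..1}" using s uv by auto
    ultimately show ?thesis using us[OF uv(1)] vs[OF uv(2)] by (intro that[of "[?a u, ?d v]"]) auto
  qed
  have "ennreal (lvar (P1 g) ts) \<le> ennreal (1 / 2 * lvar g ?A + 1 / 2 * lvar g B)"
    using B(3) by (intro ennreal_leI) simp
  also have "\<dots> = ennreal (1 / 2) * ennreal (lvar g ?A) + ennreal (1 / 2) * ennreal (lvar g B)"
    by (subst ennreal_plus) (simp_all only: lvar_nonneg mult_nonneg_nonneg zero_le_divide_1_iff zero_le_numeral ennreal_mult'[of "1 / 2"])
  also have "\<dots> \<le> ennreal (1 / 2) * total_var g + ennreal (1 / 2) * total_var g"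
    by (intro add_mono mult_left_mono total_var_ge sA A01 B(1,2)) auto
  also have "\<dots> = (ennreal (1 / 2) + ennreal (1 / 2)) * total_var g" by (simp only: distrib_right)
  also have "ennreal (1 / 2) + ennreal (1 / 2) = 1" by (subst ennreal_plus[symmetric]) auto
  finally show "ennreal (lvar (P1 g) ts) \<le> total_var g" by simp
qed

lemma ess_var_le: "AE x in leb01. g x = f x \<Longrightarrow> ess_var f \<le> total_var g"
  unfolding ess_var_def by (rule INF_lower) simp

lemma ess_var_T0:
  assumes f: "integrable leb01 f"
  shows "ess_var (transfer_op T0 f) \<le> ennreal (1 / 2) * ess_var f"
proof -
  have "2 * ess_var (transfer_op T0 f) \<le> ess_var f"
    unfolding ess_var_def[of f]
  proof (rule INF_greatest, clarify)
    fix g assume "AE x in leb01. g x = f x"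
    then have "AE x in leb01. f x = g x" by eventually_elim simp
    from transfer_op_T0[OF f this] have "AE x in leb01. P0 g x = transfer_op T0 f x" by eventually_elim simp
    then have "ess_var (transfer_op T0 f) \<le> ennreal (1 / 2) * total_var g"
      using ess_var_le total_var_P0 order_trans by blast
    then have "2 * ess_var (transfer_op T0 f) \<le> 2 * (ennreal (1 / 2) * total_var g)" by (rule mult_left_mono) simp
    also have "\<dots> = total_var g"
      by (rule two_half)
    finally show "2 * ess_var (transfer_op T0 f) \<le> total_var g" .
  qed
  then have "ennreal (1 / 2) * (2 * ess_var (transfer_op T0 f)) \<le> ennreal (1 / 2) * ess_var f"
    by (rule mult_left_mono) simp
  then show ?thesis by (subst (asm) mult.left_commute) (simp only: two_half)
qed

lemma ess_var_T1:
  assumes f: "integrable leb01 f"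
  shows "ess_var (transfer_op T1 f) \<le> ess_var f"
  unfolding ess_var_def[of f]
proof (rule INF_greatest, clarify)
  fix g assume "AE x in leb01. g x = f x"
  then have "AE x in leb01. f x = g x" by eventually_elim simp
  from transfer_op_T1[OF f this] have "AE x in leb01. P1 g x = transfer_op T1 f x" by eventually_elim simp
  then show "ess_var (transfer_op T1 f) \<le> total_var g"
    using ess_var_le total_var_P1 order_trans by blast
qed

section \<open>Covering by dyadic intervals\<close>

definition dyadic :: "nat \<Rightarrow> nat \<Rightarrow> real set" where
  "dyadic k j = {real j / 2 ^ k<..<(real j + 1) / 2 ^ k}"

definition above_on_dyadic :: "nat \<Rightarrow> (real \<Rightarrow> real) \<Rightarrow> real \<Rightarrow> bool" where
  "above_on_dyadic k h c \<longleftrightarrow> (\<exists>j<2 ^ k. \<forall>x\<in>dyadic k j. c \<le> h x)"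

lemma P0_nonneg: "(\<And>x. 0 \<le> h x) \<Longrightarrow> 0 \<le> P0 h y"
  by (simp add: P0_def)

lemma P1_nonneg: "(\<And>x. 0 \<le> h x) \<Longrightarrow> 0 \<le> P1 h y"
  by (simp add: P1_def)

text \<open>\<open>T0\<close> doubles a dyadic interval as long as it is contained in one half, and for each point of the image one of the two terms of \<open>P0\<close> is a value on the original interval.\<close>

lemma above_on_dyadic_P0:
  assumes h: "\<And>x. 0 \<le> h x" and c: "0 \<le> c" and k: "above_on_dyadic k h c"
  shows "above_on_dyadic (k - 1) (P0 h) (c / 2)"
proof (cases k)
  case 0
  have "c / 2 \<le> P0 h x" if "x \<in> dyadic 0 0" for x
  proof -
    have "x / 2 \<in> dyadic 0 0" using that by (auto simp: dyadic_def)
    then have "c \<le> h (x / 2)" using k 0 by (auto simp: above_on_dyadic_def)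
    with h[of "x / 2 + 1 / 2"] show ?thesis by (simp add: P0_def)
  qed
  then show ?thesis using 0 by (auto simp: above_on_dyadic_def)
next
  case (Suc l)
  define m :: nat where "m = 2 ^ l"
  have m: "0 < m" "2 ^ k = 2 * m" "(2::real) ^ l = real m" by (auto simp: m_def Suc)
  from k obtain j where j: "j < 2 * m" "\<And>x. x \<in> dyadic k j \<Longrightarrow> c \<le> h x"
    by (auto simp: above_on_dyadic_def m)
  have J: "dyadic k j = {real j / (2 * real m)<..<(real j + 1) / (2 * real m)}"
    by (simp add: dyadic_def Suc m)
  define i where "i = (if j < m then j else j - m)"
  have "c / 2 \<le> P0 h y" if y: "y \<in> dyadic l i" for y
  proof (cases "j < m")
    case True
    have "y / 2 \<in> dyadic k j" using y True m(1) unfolding J by (simp add: i_def dyadic_def m field_simps)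
    from j(2)[OF this] h[of "y / 2 + 1 / 2"] show ?thesis by (simp add: P0_def)
  next
    case False
    have "y / 2 + 1 / 2 \<in> dyadic k j" using y False m(1) unfolding J
      by (simp add: i_def dyadic_def m field_simps of_nat_diff)
    from j(2)[OF this] h[of "y / 2"] show ?thesis by (simp add: P0_def)
  qed
  moreover have "i < m" using j(1) by (auto simp: i_def)
  ultimately show ?thesis unfolding above_on_dyadic_def Suc by (auto simp: m_def)
qed

text \<open>The image under \<open>T1\<close> of a dyadic interval inside a quarter has twice its length; the index \<open>i\<close> of the image depends on the quarter, where the two middle quarters share the same offset.\<close>

lemma above_on_dyadic_P1_aux:
  assumes h: "\<And>x. 0 \<le> h x" and c: "0 \<le> c" and k: "above_on_dyadic (Suc (Suc l)) h c"
  shows "above_on_dyadic (Suc l) (P1 h) (c / 2)"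
proof -
  define m :: nat where "m = 2 ^ l"
  have m: "0 < m" "2 ^ l = m" "(2::real) ^ l = real m" by (auto simp: m_def)
  from k obtain j where j: "j < 4 * m" "\<And>x. x \<in> dyadic (Suc (Suc l)) j \<Longrightarrow> c \<le> h x"
    by (auto simp: above_on_dyadic_def m)
  have J: "dyadic (Suc (Suc l)) j = {real j / (4 * real m)<..<(real j + 1) / (4 * real m)}"
    by (simp add: dyadic_def m)
  have I: "dyadic (Suc l) i = {real i / (2 * real m)<..<(real i + 1) / (2 * real m)}" for i
    by (simp add: dyadic_def m)
  define i where "i = (if j < m then j else if j < 3 * m then j - m else j - 2 * m)"
  have i: "i < 2 * m" using j(1) by (auto simp: i_def)
  have "c / 2 \<le> P1 h y" if y: "y \<in> dyadic (Suc l) i" for y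
  proof -
    have lt: "y < 1 / 2" if "i < m"
    proof -
      have "y < (real i + 1) / (2 * real m)" using y by (simp add: I)
      also have "\<dots> \<le> real m / (2 * real m)" using that by (intro divide_right_mono) auto
      finally show ?thesis using m(1) by simp
    qed
    have ge: "\<not> y < 1 / 2" if "i \<ge> m"
    proof -
      have "real m / (2 * real m) \<le> real i / (2 * real m)" using that by (intro divide_right_mono) auto
      also have "\<dots> < y" using y by (simp add: I)
      finally show ?thesis using m(1) by simp
    qed
    consider "j < m" | "m \<le> j" "j < 3 * m" | "3 * m \<le> j" by linarith
    then show ?thesis
    proof cases
      case 1
      then have "i = j" by (simp add: i_def)
      then have "y / 2 \<in> dyadic (Suc (Suc l)) j" using y m(1) unfolding J I by (simp add: field_simps)
      from j(2)[OF this] h[of "y / 2 + 1 / 4"] show ?thesis using lt 1 \<open>i = j\<close> by (simp add: P1_def)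
    next
      case 2
      then have "i = j - m" by (simp add: i_def)
      then have "y / 2 + 1 / 4 \<in> dyadic (Suc (Suc l)) j" using y m(1) 2 unfolding J I
        by (simp add: field_simps of_nat_diff)
      from j(2)[OF this] h[of "y / 2"] h[of "y / 2 + 1 / 2"] show ?thesis by (simp add: P1_def)
    next
      case 3
      then have i: "i = j - 2 * m" using m(1) by (simp add: i_def)
      then have "y / 2 + 1 / 2 \<in> dyadic (Suc (Suc l)) j" using y m(1) 3 unfolding J I
        by (simp add: field_simps of_nat_diff)
      from j(2)[OF this] h[of "y / 2 + 1 / 4"] show ?thesis using ge 3 i by (simp add: P1_def)
    qed
  qed
  with i show ?thesis unfolding above_on_dyadic_def by (auto simp: m)
qed

text \<open>Once the interval is one of the two halves, \<open>T1\<close> leaves it invariant: this is why level \<open>1\<close> is not improved.\<close>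

lemma above_on_dyadic_P1:
  assumes h: "\<And>x. 0 \<le> h x" and c: "0 \<le> c" and k: "above_on_dyadic k h c"
  shows "above_on_dyadic (if k \<le> 1 then k else k - 1) (P1 h) (c / 2)"
proof -
  consider "k = 0" | "k = 1" | l where "k = Suc (Suc l)" by (metis One_nat_def not0_implies_Suc)
  then show ?thesis
  proof cases
    case 1
    have "c / 2 \<le> P1 h x" if "x \<in> dyadic 0 0" for x
    proof -
      have "x / 2 + 1 / 4 \<in> dyadic 0 0" using that by (auto simp: dyadic_def)
      then have "c \<le> h (x / 2 + 1 / 4)" using k 1 by (auto simp: above_on_dyadic_def)
      with h[of "x / 2"] h[of "x / 2 + 1 / 2"] show ?thesis by (simp add: P1_def)
    qed
    then show ?thesis using 1 by (auto simp: above_on_dyadic_def)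
  next
    case 2
    from k obtain j where j: "j < 2" "\<And>x. x \<in> dyadic 1 j \<Longrightarrow> c \<le> h x"
      by (auto simp: above_on_dyadic_def 2)
    have "c / 2 \<le> P1 h x" if x: "x \<in> dyadic 1 j" for x
    proof (cases "j = 0")
      case True
      then have "x / 2 \<in> dyadic 1 j" using x by (auto simp: dyadic_def)
      from j(2)[OF this] h[of "x / 2 + 1 / 4"] show ?thesis using x True by (simp add: P1_def dyadic_def)
    next
      case False
      then have "x / 2 + 1 / 2 \<in> dyadic 1 j" using x j by (auto simp: dyadic_def)
      from j(2)[OF this] h[of "x / 2 + 1 / 4"] show ?thesis using x False j(1) by (auto simp add: P1_def dyadic_def)
    qed
    then show ?thesis using 2 j(1) by (auto simp: above_on_dyadic_def)
  next
    case 3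
    then show ?thesis using above_on_dyadic_P1_aux[OF h c k[unfolded 3]] by simp
  qed
qed

text \<open>Points chosen in consecutive cells, two in each, form a chain after sorting each pair.\<close>

lemma lvar_grid_pairs:
  assumes n: "0 < n"
    and x: "\<And>j. j < n \<Longrightarrow> x j \<in> {real j / real n..(real j + 1) / real n}"
    and y: "\<And>j. j < n \<Longrightarrow> y j \<in> {real j / real n..(real j + 1) / real n}"
  shows "ennreal (\<Sum>j<n. \<bar>g (y j) - g (x j)\<bar>) \<le> total_var g"
proof -
  have "\<exists>ts. sorted ts \<and> set ts \<subseteq> {0..real p / real n} \<and> (\<Sum>j<p. \<bar>g (y j) - g (x j)\<bar>) \<le> lvar g ts"
    if "p \<le> n" for p
    using that
  proof (induction p)
    case 0
    then show ?case by (intro exI[of _ "[]"]) auto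
  next
    case (Suc p)
    then obtain ts where ts: "sorted ts" "set ts \<subseteq> {0..real p / real n}" "(\<Sum>j<p. \<bar>g (y j) - g (x j)\<bar>) \<le> lvar g ts"
      by auto
    have xy: "x p \<in> {real p / real n..(real p + 1) / real n}" "y p \<in> {real p / real n..(real p + 1) / real n}"
      using x y Suc.prems by auto
    let ?e = "[min (x p) (y p), max (x p) (y p)]"
    have e: "lvar g ?e = \<bar>g (y p) - g (x p)\<bar>" by (auto simp: min_def max_def abs_minus_commute)
    have m: "real p / real n \<le> (real p + 1) / real n" by (intro divide_right_mono) auto
    have 0: "0 \<le> real p / real n" by simp
    have "sorted (ts @ ?e)"
      using ts(1,2) xy by (auto simp: sorted_append min_def max_def subset_iff)
    moreover have "set (ts @ ?e) \<subseteq> {0..real (Suc p) / real n}"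
    proof -
      have "0 \<le> t \<and> t \<le> (real p + 1) / real n" if "t \<in> set ts \<or> t = x p \<or> t = y p" for t
        using that
      proof (elim disjE)
        assume "t \<in> set ts" then show ?thesis using ts(2) m by force
      qed (use xy 0 in \<open>auto intro: order_trans[OF 0]\<close>)
      then show ?thesis by (auto simp: min_def max_def add.commute)
    qed
    moreover have "(\<Sum>j<Suc p. \<bar>g (y j) - g (x j)\<bar>) \<le> lvar g (ts @ ?e)"
      using lvar_append_ge[of g ts ?e] ts(3) e by simp
    ultimately show ?case by blast
  qed
  from this[of n] obtain ts where "sorted ts" "set ts \<subseteq> {0..1}" "(\<Sum>j<n. \<bar>g (y j) - g (x j)\<bar>) \<le> lvar g ts"
    using n by auto
  then show ?thesis by (meson ennreal_leI total_var_ge order_trans)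
qed

lemma sum_lessThan_double: "(\<Sum>j<2 * n. F j) = (\<Sum>j<n. F (2 * j) + F (2 * j + 1 :: nat) :: real)"
  by (induction n) auto

text \<open>Iterating \<open>P0\<close> averages over the points with the same relative position in all dyadic intervals of level \<open>k\<close>.\<close>

lemma P0_pow: "(P0 ^^ k) g t = (\<Sum>j<2 ^ k. g ((t + real j) / 2 ^ k)) / 2 ^ k"
proof (induction k arbitrary: t)
  case (Suc k)
  have "(P0 ^^ Suc k) g t = ((\<Sum>j<2 ^ k. g ((t / 2 + real j) / 2 ^ k)) + (\<Sum>j<2 ^ k. g ((t / 2 + 1 / 2 + real j) / 2 ^ k))) / 2 ^ Suc k"
    by (simp add: P0_def Suc.IH add_divide_distrib)
  also have "\<dots> = (\<Sum>j<2 ^ k. g ((t + real (2 * j)) / 2 ^ Suc k) + g ((t + real (2 * j + 1)) / 2 ^ Suc k)) / 2 ^ Suc k"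
    unfolding sum.distrib[symmetric]
    by (rule arg_cong[where f = "\<lambda>s. s / 2 ^ Suc k"], rule sum.cong[OF refl],
        rule arg_cong2[where f = "(+)"]; rule arg_cong[where f = g]; simp add: field_simps)
  also have "\<dots> = (\<Sum>j<2 ^ Suc k. g ((t + real j) / 2 ^ Suc k)) / 2 ^ Suc k"
    unfolding power_Suc sum_lessThan_double ..
  finally show ?case .
qed simp

lemma integral_P0_pow:
  assumes f: "integrable leb01 f" and g: "AE x in leb01. f x = g x"
  shows "\<exists>u. integrable leb01 u \<and> (\<integral>x. u x \<partial>leb01) = (\<integral>x. f x \<partial>leb01) \<and> (AE x in leb01. u x = (P0 ^^ k) g x)"
proof (induction k)
  case 0 then show ?case using f g by auto
next
  case (Suc k)
  then obtain u where u: "integrable leb01 u" "(\<integral>x. u x \<partial>leb01) = (\<integral>x. f x \<partial>leb01)" "AE x in leb01. u x = (P0 ^^ k) g x"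
    by blast
  have "(\<lambda>_. 1) \<in> Linf" by (rule Linf_boundedI[of _ 1]) auto
  from D0.transfer_op_dual[OF u(1) this] have "(\<integral>x. transfer_op T0 u x \<partial>leb01) = (\<integral>x. f x \<partial>leb01)"
    using u(2) by simp
  then show ?case
    using D0.transfer_op_integrable[OF u(1)] transfer_op_T0[OF u(1,3)]
    by (intro exI[of _ "transfer_op T0 u"]) simp
qed

text \<open>Let \<open>F\<close> be the integral. If \<open>g\<close> fell below \<open>F / 2\<close> somewhere in each interval of level \<open>k\<close>, then all values of \<open>(P0 ^^ k) g\<close> would be at most \<open>F / 2 + b / 2 ^ k < F\<close>, although the integral of this function is \<open>F\<close>.\<close>

lemma exists_dyadic_above:
  assumes f: "integrable leb01 f" and fg: "AE x in leb01. f x = g x"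
    and var: "total_var g \<le> ennreal b" and b: "0 \<le> b" "2 * b < 2 ^ k * (\<integral>x. f x \<partial>leb01)"
  shows "above_on_dyadic k g ((\<integral>x. f x \<partial>leb01) / 2)"
proof (rule ccontr)
  let ?F = "\<integral>x. f x \<partial>leb01" and ?n = "2 ^ k :: nat"
  assume "\<not> above_on_dyadic k g (?F / 2)"
  then have "\<forall>j<?n. \<exists>x\<in>dyadic k j. g x < ?F / 2" by (auto simp: above_on_dyadic_def not_le)
  then obtain x where x: "\<And>j. j < ?n \<Longrightarrow> x j \<in> dyadic k j" "\<And>j. j < ?n \<Longrightarrow> g (x j) < ?F / 2"
    by metis
  have bnd: "(P0 ^^ k) g t \<le> ?F / 2 + b / 2 ^ k" if t: "t \<in> {0..<1}" for t
  proof -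
    let ?y = "\<lambda>j. (t + real j) / 2 ^ k"
    have "ennreal (\<Sum>j<?n. \<bar>g (?y j) - g (x j)\<bar>) \<le> total_var g"
    proof (rule lvar_grid_pairs)
      fix j assume "j < ?n"
      then show "x j \<in> {real j / real ?n..(real j + 1) / real ?n}"
        using x(1)[of j] by (simp add: dyadic_def less_imp_le)
      show "?y j \<in> {real j / real ?n..(real j + 1) / real ?n}"
        using t by (simp add: divide_right_mono)
    qed simp
    also note var
    finally have *: "(\<Sum>j<?n. \<bar>g (?y j) - g (x j)\<bar>) \<le> b" using b(1) by (simp add: sum_nonneg)
    have "(\<Sum>j<?n. g (?y j)) \<le> (\<Sum>j<?n. ?F / 2 + \<bar>g (?y j) - g (x j)\<bar>)"
      by (intro sum_mono) (use x(2) in force)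
    also have "\<dots> \<le> ?n * (?F / 2) + b" using * by (simp add: sum.distrib)
    finally have "(P0 ^^ k) g t \<le> (?n * (?F / 2) + b) / 2 ^ k"
      unfolding P0_pow by (rule divide_right_mono) simp
    then show ?thesis by (simp add: add_divide_distrib)
  qed
  obtain u where u: "integrable leb01 u" "(\<integral>x. u x \<partial>leb01) = ?F" "AE x in leb01. u x = (P0 ^^ k) g x"
    using integral_P0_pow[OF f fg, of k] by auto
  have "AE x in leb01. (P0 ^^ k) g x \<le> ?F / 2 + b / 2 ^ k" by (rule AE_leb01_halfopenI) (rule bnd)
  with u(3) have "AE x in leb01. u x \<le> ?F / 2 + b / 2 ^ k" by eventually_elim simp
  then have "(\<integral>x. u x \<partial>leb01) \<le> ?F / 2 + b / 2 ^ k" 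
    by (rule leb01.integral_le_const[OF u(1)])
  then have "?F \<le> 2 * b / 2 ^ k" using u(2) by (simp add: field_simps)
  then show False using b(2) by (simp add: field_simps)
qed

text \<open>\<open>R\<close> marks the base points over which the fresh digit is brought in.\<close>

locale two_map_cocycle =
  fixes \<sigma> :: "'y \<Rightarrow> 'y" and R :: "'y \<Rightarrow> bool" and T :: "'y \<Rightarrow> real \<Rightarrow> real"
  assumes T_def: "T y = (if R y then T0 else T1)"
begin

definition P :: "'y \<Rightarrow> (real \<Rightarrow> real) \<Rightarrow> real \<Rightarrow> real" where
  "P y = (if R y then P0 else P1)"

lemma transfer_integrable: "integrable leb01 f \<Longrightarrow> integrable leb01 (transfer_op (T y) f)"
  by (simp add: T_def D0.transfer_op_integrable D1.transfer_op_integrable)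

lemma transfer_P:
  "integrable leb01 f \<Longrightarrow> AE x in leb01. f x = f' x \<Longrightarrow> AE x in leb01. transfer_op (T y) f x = P y f' x"
  by (simp add: T_def P_def transfer_op_T0 transfer_op_T1)

abbreviation "L \<equiv> (\<lambda>y. transfer_op (T y))"

lemma cocycle_P:
  assumes "integrable leb01 f" "AE x in leb01. f x = f' x"
  shows "integrable leb01 (cocycle \<sigma> L n y f)" "AE x in leb01. cocycle \<sigma> L n y f x = cocycle \<sigma> P n y f' x"
proof -
  have "integrable leb01 (cocycle \<sigma> L n y f) \<and> (AE x in leb01. cocycle \<sigma> L n y f x = cocycle \<sigma> P n y f' x)"
    by (induction n) (use assms transfer_integrable transfer_P in auto)
  then show "integrable leb01 (cocycle \<sigma> L n y f)" "AE x in leb01. cocycle \<sigma> L n y f x = cocycle \<sigma> P n y f' x"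
    by auto
qed

text \<open>An upper bound for the level of the dyadic interval on which the iterates of the transfer operators stay large: it drops by one at each step down to level \<open>1\<close>, and only a \<open>T0\<close>-step leads from level \<open>1\<close> to level \<open>0\<close>.\<close>

fun level :: "nat \<Rightarrow> 'y \<Rightarrow> nat \<Rightarrow> nat" where
  "level k y 0 = k"
| "level k y (Suc n) = (let l = level k y n in if R ((\<sigma> ^^ n) y) then l - 1 else if l \<le> 1 then l else l - 1)"

lemma level_le: "level k y n \<le> max (k - n) 1"
  by (induction n) (auto simp: Let_def max_def split: if_splits)

lemma level_0_mono: "level k y m = 0 \<Longrightarrow> level k y (m + d) = 0"
  by (induction d) (auto simp: Let_def)

lemma level_eq_0:
  assumes "R ((\<sigma> ^^ m) y)" "k \<le> m" "m < n" shows "level k y n = 0"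
proof -
  have "level k y m \<le> 1" using level_le[of k y m] assms(2) by simp
  then have "level k y (Suc m) = 0" using assms(1) by (simp add: Let_def)
  from level_0_mono[OF this, of "n - Suc m"] assms(3) show ?thesis by simp
qed

lemma cocycle_P_nonneg: "(\<And>x. 0 \<le> f x) \<Longrightarrow> 0 \<le> cocycle \<sigma> P n y f x"
  by (induction n arbitrary: x) (auto simp: P_def P0_nonneg P1_nonneg)

lemma above_on_dyadic_cocycle:
  assumes "\<And>x. 0 \<le> f x" "0 \<le> c" "above_on_dyadic k f c"
  shows "above_on_dyadic (level k y n) (cocycle \<sigma> P n y f) (c / 2 ^ n)"
proof (induction n)
  case (Suc n)
  have "above_on_dyadic (level k y (Suc n)) (P ((\<sigma> ^^ n) y) (cocycle \<sigma> P n y f)) (c / 2 ^ n / 2)"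
    using above_on_dyadic_P0[OF cocycle_P_nonneg[OF assms(1)] _ Suc]
      above_on_dyadic_P1[OF cocycle_P_nonneg[OF assms(1)] _ Suc] assms(2)
    by (simp add: P_def[of "(\<sigma> ^^ n) y"] Let_def split: if_splits)
  then show ?case by (simp add: mult.commute)
qed (use assms in simp)

text \<open>The representative of \<open>f\<close> is made nonnegative by taking absolute values, which does not increase the variation. The bound \<open>4 * a < 2 ^ k\<close> leaves a factor \<open>2\<close> to pass from the infimum in \<open>ess_var\<close> to an actual representative.\<close>

lemma covering:
  assumes a: "0 < a" and k: "4 * a < 2 ^ k"
    and R: "R ((\<sigma> ^^ m) y)" and mn: "k \<le> m" "m < n"
    and f: "f \<in> Linf" "AE x in leb01. 0 \<le> f x" and var: "ess_var f \<le> ennreal a * L1_norm f"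
  shows "ereal (1 / 2 ^ Suc n) * enn2ereal (L1_norm f) \<le> essinf (cocycle \<sigma> L n y f)"
proof -
  let ?F = "\<integral>x. f x \<partial>leb01"
  let ?u = "cocycle \<sigma> L n y f"
  have fi: "integrable leb01 f" using f(1) by (rule Linf_integrable)
  have F0: "0 \<le> ?F" using f(2) by (rule integral_nonneg_AE)
  have "L1_norm f = (\<integral>\<^sup>+ x. ennreal (f x) \<partial>leb01)"
    unfolding L1_norm_def using f(2) by (intro nn_integral_cong_AE) auto
  also have "\<dots> = ennreal ?F" using fi f(2) by (rule nn_integral_eq_integral)
  finally have L1: "L1_norm f = ennreal ?F" .
  have "AE x in leb01. ?F / 2 / 2 ^ n \<le> ?u x"
  proof (cases "?F = 0")
    case True
    have "AE x in leb01. f x = \<bar>f x\<bar>" using f(2) by eventually_elim simp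
    from cocycle_P(2)[OF fi this, of n y] show ?thesis
    proof eventually_elim
      case (elim x)
      then show ?case using cocycle_P_nonneg[of "\<lambda>x. \<bar>f x\<bar>" n y x] True by simp
    qed
  next
    case False
    then have F: "0 < ?F" using F0 by simp
    have "ess_var f < ennreal (2 * a * ?F)"
      using var unfolding L1 ennreal_mult'[OF less_imp_le[OF a], symmetric]
      by (rule le_less_trans) (use F a in \<open>auto intro!: ennreal_lessI\<close>)
    then obtain g0 where g0: "AE x in leb01. g0 x = f x" "total_var g0 < ennreal (2 * a * ?F)"
      unfolding ess_var_def by (auto simp: INF_less_iff)
    define g where "g x = \<bar>g0 x\<bar>" for x
    have fg: "AE x in leb01. f x = g x" using g0(1) f(2) by eventually_elim (auto simp: g_def)
    have "total_var g \<le> ennreal (2 * a * ?F)"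
      using total_var_abs[of g0] g0(2) unfolding g_def by (meson order_trans less_imp_le)
    then have "above_on_dyadic k g (?F / 2)"
      by (rule exists_dyadic_above[OF fi fg]) (use F a k in auto)
    then have "above_on_dyadic (level k y n) (cocycle \<sigma> P n y g) (?F / 2 / 2 ^ n)"
      by (intro above_on_dyadic_cocycle) (use F in \<open>auto simp: g_def\<close>)
    then have "\<forall>x\<in>dyadic 0 0. ?F / 2 / 2 ^ n \<le> cocycle \<sigma> P n y g x"
      unfolding level_eq_0[OF R mn] by (simp add: above_on_dyadic_def)
    then have "AE x in lborel. x \<noteq> 0 \<longrightarrow> x \<in> {0..<1} \<longrightarrow> ?F / 2 / 2 ^ n \<le> cocycle \<sigma> P n y g x"
      by (auto simp: dyadic_def)
    moreover have "AE x in lborel. x \<noteq> (0::real)" "AE x in lborel. x \<noteq> (1::real)" by (rule AE_lborel_singleton)+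
    ultimately have "AE x in leb01. ?F / 2 / 2 ^ n \<le> cocycle \<sigma> P n y g x"
      unfolding AE_leb01 by eventually_elim auto
    with cocycle_P(2)[OF fi fg, of n y] show ?thesis by eventually_elim simp
  qed
  moreover have [measurable]: "?u \<in> borel_measurable leb01" using cocycle_P(1)[OF fi, of f n y] by auto
  ultimately have "esssup leb01 (\<lambda>x. - ereal (?u x)) \<le> - ereal (?F / 2 / 2 ^ n)"
    by (intro esssup_I) auto
  then have "ereal (?F / 2 / 2 ^ n) \<le> essinf ?u"
    unfolding essinf_def by (metis ereal_minus_le_minus ereal_uminus_uminus)
  then show ?thesis using F0 by (simp add: L1 enn2ereal_ennreal mult.commute)
qed

end

section \<open>Correlations and the variance of the Birkhoff sums\<close>

lemma integral_phi: "(\<integral>t. phi t \<partial>leb01) = 1"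
proof -
  have "(\<integral>t. phi t \<partial>leb01) = (\<integral>t. 2 * indicator {0..1/2::real} t \<partial>lborel)"
    unfolding integral_leb01 by (intro Bochner_Integration.integral_cong) (auto simp: phi_def indicator_def)
  also have "\<dots> = 1" by simp
  finally show ?thesis .
qed

lemma psi_eq: "psi x = (if x \<in> {0..1/2} then 1 else - 1)"
  unfolding psi_def integral_phi by (simp add: phi_def)

lemma psi_measurable: "psi \<in> borel_measurable leb01"
  by (rule measurable_leb01_borel) (simp add: psi_def[abs_def] phi_def[abs_def])

lemma psi_Linf: "psi \<in> Linf"
  by (rule Linf_boundedI[OF psi_measurable, of 1]) (simp add: psi_eq)

lemma integral_psi: "(\<integral>x. psi x \<partial>leb01) = 0"
proof -
  have "phi \<in> borel_measurable leb01"
    by (rule measurable_leb01_borel) (simp add: phi_def[abs_def])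
  then have "phi \<in> Linf" by (rule Linf_boundedI[of _ 2]) (simp add: phi_def indicator_def)
  then show ?thesis
    unfolding psi_def using Linf_integrable by (simp add: integral_phi leb01.prob_space[simplified])
qed

lemma lvar_antimono:
  assumes "\<And>x y. 0 \<le> x \<Longrightarrow> x \<le> y \<Longrightarrow> g y \<le> g x" "sorted ts" "set ts \<subseteq> {0..1}" "ts \<noteq> []"
  shows "lvar g ts = g (hd ts) - g (last ts)"
  using assms by (induction ts rule: induct_list012) auto

lemma psi_BV: "psi \<in> BV"
proof -
  have "total_var psi \<le> ennreal 2"
  proof (rule total_var_leI)
    fix ts :: "real list" assume ts: "sorted ts" "set ts \<subseteq> {0..1}"
    show "ennreal (lvar psi ts) \<le> ennreal 2"
    proof (cases "ts = []")
      case False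
      have "lvar psi ts = psi (hd ts) - psi (last ts)"
        by (rule lvar_antimono[OF _ ts False]) (simp add: psi_eq)
      then show ?thesis by (intro ennreal_leI) (simp add: psi_eq)
    qed simp
  qed
  moreover have "ess_var psi \<le> total_var psi" by (rule ess_var_le) simp
  ultimately have "ess_var psi \<le> ennreal 2" by (rule order_trans[rotated])
  also have "\<dots> < \<infinity>" by simp
  finally show ?thesis using Linf_integrable[OF psi_Linf] by (simp add: BV_def)
qed

lemma transfer_one: "AE x in leb01. transfer_op T0 (\<lambda>_. 1) x = 1" "AE x in leb01. transfer_op T1 (\<lambda>_. 1) x = 1"
  using transfer_op_T0[of "\<lambda>_. 1" "\<lambda>_. 1"] transfer_op_T1[of "\<lambda>_. 1" "\<lambda>_. 1"]
  by (simp_all add: P0_def P1_def)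

text \<open>The two identities behind the theorem: under \<open>T1\<close> the observable is invariant, under \<open>T0\<close> it is forgotten.\<close>

lemma transfer_psi:
  "AE x in leb01. transfer_op T0 psi x = 0" "AE x in leb01. transfer_op T1 psi x = psi x"
proof -
  note i = Linf_integrable[OF psi_Linf]
  have "AE x in leb01. x \<noteq> 0 \<and> x \<noteq> 1 / 2 \<and> x \<noteq> 1"
    unfolding AE_leb01 using AE_lborel_singleton[of "0::real"] AE_lborel_singleton[of "1/2::real"] AE_lborel_singleton[of "1::real"]
    by eventually_elim simp
  moreover have "AE x in leb01. x \<in> {0..1}" using AE_space[of leb01] by simp
  ultimately have ae: "AE x in leb01. P0 psi x = 0 \<and> P1 psi x = psi x"
    by eventually_elim (auto simp: P0_def P1_def psi_eq)
  show "AE x in leb01. transfer_op T0 psi x = 0"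
    using transfer_op_T0[OF i, of psi] ae by auto
  show "AE x in leb01. transfer_op T1 psi x = psi x"
    using transfer_op_T1[OF i, of psi] ae by auto
qed

context two_map_cocycle
begin

lemma Linf_T: "g \<in> Linf \<Longrightarrow> (\<lambda>x. g (T y x)) \<in> Linf"
  by (simp add: T_def D0.Linf_comp D1.Linf_comp)

lemma T_dual: "integrable leb01 f \<Longrightarrow> g \<in> Linf \<Longrightarrow>
    (\<integral>x. f x * g (T y x) \<partial>leb01) = (\<integral>x. transfer_op (T y) f x * g x \<partial>leb01)"
  by (simp add: T_def D0.transfer_op_dual D1.transfer_op_dual)

lemma integral_replace:
  assumes "integrable leb01 u" "integrable leb01 v" "AE x in leb01. u x = v x" "g \<in> Linf"
  shows "(\<integral>x. u x * g x \<partial>leb01) = (\<integral>x. v x * g x \<partial>leb01)"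
  using assms(3) by (intro integral_cong_AE borel_measurable_integrable Linf_mult_integrable assms) auto

lemma T_preserves: "g \<in> Linf \<Longrightarrow> (\<integral>x. g (T y x) \<partial>leb01) = (\<integral>x. g x \<partial>leb01)"
  using T_dual[of "\<lambda>_. 1" g y] transfer_one
    integral_replace[of "transfer_op (T y) (\<lambda>_. 1)" "\<lambda>_. 1" g] transfer_integrable[of "\<lambda>_. 1" y]
  by (simp add: T_def)

lemma psi_T:
  assumes g: "g \<in> Linf"
  shows "(\<integral>x. psi x * g (T y x) \<partial>leb01) = (if R y then 0 else \<integral>x. psi x * g x \<partial>leb01)"
proof -
  note i = Linf_integrable[OF psi_Linf]
  show ?thesis
  proof (cases "R y")
    case True
    then have "AE x in leb01. transfer_op (T y) psi x = 0" using transfer_psi by (simp add: T_def)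
    from integral_replace[OF transfer_integrable[OF i] _ this g] show ?thesis
      using True by (simp add: T_dual[OF i g])
  next
    case False
    then have "AE x in leb01. transfer_op (T y) psi x = psi x" using transfer_psi by (simp add: T_def)
    from integral_replace[OF transfer_integrable[OF i] i this g] show ?thesis
      using False by (simp add: T_dual[OF i g])
  qed
qed

lemma cocycle_add: "cocycle \<sigma> A (n + k) y = cocycle \<sigma> A k ((\<sigma> ^^ n) y) \<circ> cocycle \<sigma> A n y"
  by (induction k) (simp_all add: funpow_add o_assoc add.commute)

lemma cocycle_Suc_first: "cocycle \<sigma> A (Suc k) y x = cocycle \<sigma> A k (\<sigma> y) (A y x)"
  using cocycle_add[of A 1 k y] by simp

lemma Linf_cocycle: "g \<in> Linf \<Longrightarrow> (\<lambda>x. g (cocycle \<sigma> T n y x)) \<in> Linf"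
proof (induction n arbitrary: g)
  case (Suc n)
  from Suc.IH[OF Linf_T[OF Suc.prems, of "(\<sigma> ^^ n) y"]] show ?case by simp
qed simp

lemma cocycle_preserves: "g \<in> Linf \<Longrightarrow> (\<integral>x. g (cocycle \<sigma> T n y x) \<partial>leb01) = (\<integral>x. g x \<partial>leb01)"
proof (induction n arbitrary: g)
  case (Suc n)
  from Suc.IH[OF Linf_T[OF Suc.prems, of "(\<sigma> ^^ n) y"]] show ?case by (simp add: T_preserves Suc.prems)
qed simp

text \<open>Peel off the first map: \<open>T1\<close> can be dropped since it fixes \<open>psi\<close> under transfer, whereas \<open>T0\<close> annihilates \<open>psi\<close>.\<close>

lemma psi_cocycle: "(\<integral>x. psi x * psi (cocycle \<sigma> T k y x) \<partial>leb01) = (if \<exists>j<k. R ((\<sigma> ^^ j) y) then 0 else 1)"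
proof (induction k arbitrary: y)
  case 0
  have "(\<integral>x. psi x * psi x \<partial>leb01) = (\<integral>x. 1 \<partial>leb01)"
    by (intro Bochner_Integration.integral_cong) (auto simp: psi_eq)
  then show ?case by (simp add: leb01.prob_space[simplified])
next
  case (Suc k)
  have "(\<exists>j<Suc k. R ((\<sigma> ^^ j) y)) \<longleftrightarrow> R y \<or> (\<exists>j<k. R ((\<sigma> ^^ j) (\<sigma> y)))"
    by (auto simp: less_Suc_eq_0_disj funpow_swap1)
  then show ?case
    unfolding cocycle_Suc_first
    using psi_T[OF Linf_cocycle[OF psi_Linf, of k "\<sigma> y"], of y] Suc.IH[of "\<sigma> y"] by simp
qed

text \<open>The number of the block that contains time \<open>n\<close>, blocks being separated by the \<open>T0\<close>-steps.\<close>

definition block :: "'y \<Rightarrow> nat \<Rightarrow> nat" where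
  "block y n = card {j. j < n \<and> R ((\<sigma> ^^ j) y)}"

lemma block_add: "block y (n + m) = block y n + block ((\<sigma> ^^ n) y) m"
proof -
  have "{j. j < n + m \<and> R ((\<sigma> ^^ j) y)} = {j. j < n \<and> R ((\<sigma> ^^ j) y)} \<union> (\<lambda>j. n + j) ` {j. j < m \<and> R ((\<sigma> ^^ j) ((\<sigma> ^^ n) y))}"
  proof (intro set_eqI iffI)
    fix j assume j: "j \<in> {j. j < n + m \<and> R ((\<sigma> ^^ j) y)}"
    show "j \<in> {j. j < n \<and> R ((\<sigma> ^^ j) y)} \<union> (\<lambda>j. n + j) ` {j. j < m \<and> R ((\<sigma> ^^ j) ((\<sigma> ^^ n) y))}"
    proof (cases "j < n")
      case False
      then have "j = n + (j - n)" by simp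
      moreover have "(\<sigma> ^^ (n + (j - n))) y = (\<sigma> ^^ (j - n)) ((\<sigma> ^^ n) y)"
        by (subst add.commute) (simp add: funpow_add)
      ultimately show ?thesis using j False
        by (intro UnI2 image_eqI[of _ _ "j - n"]) auto
    qed (use j in simp)
  next
    fix j assume "j \<in> {j. j < n \<and> R ((\<sigma> ^^ j) y)} \<union> (\<lambda>j. n + j) ` {j. j < m \<and> R ((\<sigma> ^^ j) ((\<sigma> ^^ n) y))}"
    moreover have "(\<sigma> ^^ (n + i)) y = (\<sigma> ^^ i) ((\<sigma> ^^ n) y)" for i
      by (subst add.commute) (simp add: funpow_add)
    ultimately show "j \<in> {j. j < n + m \<and> R ((\<sigma> ^^ j) y)}" by auto
  qed
  then have "block y (n + m) = card ({j. j < n \<and> R ((\<sigma> ^^ j) y)} \<union> (\<lambda>j. n + j) ` {j. j < m \<and> R ((\<sigma> ^^ j) ((\<sigma> ^^ n) y))})"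
    by (simp add: block_def)
  also have "\<dots> = block y n + block ((\<sigma> ^^ n) y) m"
    by (subst card_Un_disjoint) (auto simp: block_def card_image inj_on_def)
  finally show ?thesis .
qed

lemma block_mono: "n \<le> m \<Longrightarrow> block y n \<le> block y m"
  using block_add[of y n "m - n"] by simp

lemma block_eq_0_iff: "block y n = 0 \<longleftrightarrow> \<not> (\<exists>j<n. R ((\<sigma> ^^ j) y))"
  by (auto simp: block_def)

lemma psi_correlation:
  "(\<integral>x. psi (cocycle \<sigma> T n y x) * psi (cocycle \<sigma> T m y x) \<partial>leb01) = of_bool (block y n = block y m)"
proof -
  have *: "(\<integral>x. psi (cocycle \<sigma> T n y x) * psi (cocycle \<sigma> T (n + k) y x) \<partial>leb01) = of_bool (block y n = block y (n + k))" for n k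
  proof -
    have "(\<lambda>x. psi x * psi (cocycle \<sigma> T k ((\<sigma> ^^ n) y) x)) \<in> Linf"
    proof (rule Linf_boundedI[of _ 1])
      show "(\<lambda>x. psi x * psi (cocycle \<sigma> T k ((\<sigma> ^^ n) y) x)) \<in> borel_measurable leb01"
        using Linf_cocycle[OF psi_Linf, of k "(\<sigma> ^^ n) y"] psi_measurable by (auto simp: Linf_def)
    qed (simp add: psi_eq)
    from cocycle_preserves[OF this, of n y]
    have "(\<integral>x. psi (cocycle \<sigma> T n y x) * psi (cocycle \<sigma> T (n + k) y x) \<partial>leb01)
      = (if \<exists>j<k. R ((\<sigma> ^^ j) ((\<sigma> ^^ n) y)) then 0 else 1)"
      by (simp add: cocycle_add psi_cocycle)
    then show ?thesis using block_eq_0_iff[of "(\<sigma> ^^ n) y" k] by (simp add: block_add)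
  qed
  show ?thesis
  proof (cases "n \<le> m")
    case True then show ?thesis using *[of n "m - n"] by simp
  next
    case False then show ?thesis using *[of m "n - m"] by (simp add: mult.commute eq_commute)
  qed
qed

definition block_count :: "'y \<Rightarrow> nat \<Rightarrow> nat \<Rightarrow> nat" where
  "block_count y N k = card {n. n < N \<and> block y n = k}"

text \<open>Expanding the square gives the number of pairs of times that lie in the same block.\<close>

lemma variance_eq:
  "(\<integral>x. (\<Sum>n<N. psi (cocycle \<sigma> T n y x))\<^sup>2 \<partial>leb01) = (\<Sum>k\<le>block y N. (real (block_count y N k))\<^sup>2)"
proof -
  let ?c = "\<lambda>n x. psi (cocycle \<sigma> T n y x)"
  have int: "integrable leb01 (\<lambda>x. ?c n x * ?c m x)" for n m
    by (intro Linf_mult_integrable Linf_integrable Linf_cocycle psi_Linf)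
  have "(\<integral>x. (\<Sum>n<N. ?c n x)\<^sup>2 \<partial>leb01) = (\<integral>x. (\<Sum>n<N. \<Sum>m<N. ?c n x * ?c m x) \<partial>leb01)"
    by (simp add: power2_eq_square sum_product)
  also have "\<dots> = (\<Sum>n<N. \<Sum>m<N. (\<integral>x. ?c n x * ?c m x \<partial>leb01))"
    using int by (simp add: Bochner_Integration.integral_sum)
  also have "\<dots> = (\<Sum>n<N. real (block_count y N (block y n)))"
  proof (rule sum.cong)
    fix n
    have "(\<Sum>m<N. (\<integral>x. ?c n x * ?c m x \<partial>leb01)) = (\<Sum>m<N. of_bool (block y m = block y n))"
      unfolding psi_correlation by (simp add: eq_commute)
    also have "\<dots> = real (card ({..<N} \<inter> {m. block y m = block y n}))" by simp
    also have "{..<N} \<inter> {m. block y m = block y n} = {m. m < N \<and> block y m = block y n}" by auto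
    finally show "(\<Sum>m<N. (\<integral>x. ?c n x * ?c m x \<partial>leb01)) = real (block_count y N (block y n))"
      by (simp add: block_count_def)
  qed simp
  also have "\<dots> = (\<Sum>k\<le>block y N. \<Sum>n\<in>{n \<in> {..<N}. block y n = k}. real (block_count y N (block y n)))"
    by (rule sum.group[symmetric]) (auto intro: block_mono)
  also have "\<dots> = (\<Sum>k\<le>block y N. (real (block_count y N k))\<^sup>2)"
  proof (rule sum.cong)
    fix k
    have "(\<Sum>n\<in>{n \<in> {..<N}. block y n = k}. real (block_count y N (block y n))) = (\<Sum>n\<in>{n \<in> {..<N}. block y n = k}. real (block_count y N k))"
      by (rule sum.cong) auto
    also have "{n \<in> {..<N}. block y n = k} = {n. n < N \<and> block y n = k}" by auto
    finally show "(\<Sum>n\<in>{n \<in> {..<N}. block y n = k}. real (block_count y N (block y n))) = (real (block_count y N k))\<^sup>2"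
      by (simp add: block_count_def power2_eq_square)
  qed simp
  finally show ?thesis .
qed

lemma sum_block_count: "(\<Sum>k\<le>block y N. real (block_count y N k)) = real N"
proof -
  have "(\<Sum>n<N. 1::real) = (\<Sum>k\<le>block y N. \<Sum>n\<in>{n \<in> {..<N}. block y n = k}. 1)"
    by (rule sum.group[symmetric]) (auto intro: block_mono)
  also have "\<dots> = (\<Sum>k\<le>block y N. real (block_count y N k))"
    by (rule sum.cong) (auto simp: block_count_def intro!: arg_cong[where f = card])
  finally show ?thesis by simp
qed

text \<open>\<open>len\<close> prescribes the lengths of the blocks except the first one, which may be truncated by the starting point; the last block, truncated by \<open>N\<close>, only enters through the Cauchy-Schwarz inequality. There are \<open>block y N + 1\<close> blocks.\<close>

lemma variance_superlinear:
  fixes len :: "nat \<Rightarrow> nat"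
  assumes block: "\<And>k. 1 \<le> k \<Longrightarrow> \<exists>t. \<forall>l<len k. block y (t + l) = k"
    and len_pos: "\<And>k. 1 \<le> k \<Longrightarrow> 0 < len k"
    and growth: "\<And>C::real. eventually (\<lambda>K. C * (real K + 1) \<le> (\<Sum>k\<in>{1..<K}. (real (len k))\<^sup>2)) sequentially"
  shows "filterlim (\<lambda>N. (1 / real N) * (\<integral>x. (\<Sum>n<N. psi (cocycle \<sigma> T n y x))\<^sup>2 \<partial>leb01)) at_top sequentially"
proof -
  let ?V = "\<lambda>N. \<Sum>k\<le>block y N. (real (block_count y N k))\<^sup>2"
  have cnt: "len k \<le> block_count y N k" if k: "1 \<le> k" "k < block y N" for k N
  proof -
    obtain t where t: "\<And>l. l < len k \<Longrightarrow> block y (t + l) = k" using block[OF k(1)] by blast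
    have "t + l < N" if "l < len k" for l
      using t[OF that] k(2) block_mono[of N "t + l" y] by (metis not_le)
    then have "(\<lambda>l. t + l) ` {..<len k} \<subseteq> {n. n < N \<and> block y n = k}" using t by auto
    then have "card ((\<lambda>l. t + l) ` {..<len k}) \<le> block_count y N k"
      unfolding block_count_def by (rule card_mono[rotated]) simp
    then show ?thesis by (simp add: card_image inj_on_def)
  qed
  have lower: "(\<Sum>k\<in>{1..<block y N}. (real (len k))\<^sup>2) \<le> ?V N" for N
  proof -
    have "(\<Sum>k\<in>{1..<block y N}. (real (len k))\<^sup>2) \<le> (\<Sum>k\<in>{1..<block y N}. (real (block_count y N k))\<^sup>2)"
      by (intro sum_mono power_mono) (auto simp: cnt)
    also have "\<dots> \<le> ?V N" by (rule sum_mono2) auto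
    finally show ?thesis .
  qed
  have block_top: "filterlim (block y) at_top sequentially"
    unfolding filterlim_at_top
  proof
    fix k
    obtain t where "\<forall>l<len (Suc k). block y (t + l) = Suc k" using block[of "Suc k"] by auto
    then have "block y t = Suc k" using len_pos[of "Suc k"] by (metis add_0_right le_add1 plus_1_eq_Suc)
    then have "k \<le> block y N" if "t \<le> N" for N using block_mono[OF that, of y] by simp
    then show "\<forall>\<^sub>F N in sequentially. k \<le> block y N" by (auto simp: eventually_sequentially)
  qed
  have "filterlim (\<lambda>N. (1 / real N) * ?V N) at_top sequentially"
    unfolding filterlim_at_top_ge[where c = 1]
  proof (intro allI impI)
    fix C :: real assume C: "1 \<le> C"
    have "\<forall>\<^sub>F N in sequentially. C\<^sup>2 * (real (block y N) + 1) \<le> (\<Sum>k\<in>{1..<block y N}. (real (len k))\<^sup>2)"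
      using filterlim_iff[THEN iffD1, OF block_top] growth[of "C\<^sup>2"] by blast
    then show "\<forall>\<^sub>F N in sequentially. C \<le> (1 / real N) * ?V N"
      using eventually_gt_at_top[of 0]
    proof eventually_elim
      case (elim N)
      have V: "C\<^sup>2 * (real (block y N) + 1) \<le> ?V N" using elim(1) lower[of N] by linarith
      have V0: "0 \<le> ?V N" by (intro sum_nonneg) auto
      have "(real N)\<^sup>2 \<le> ?V N * (real (block y N) + 1)"
        using sum_squared_le_sum_of_squares[of "\<lambda>k. real (block_count y N k)" "{..block y N}"]
        unfolding sum_block_count by (simp add: add.commute)
      then have "C\<^sup>2 * (real N)\<^sup>2 \<le> C\<^sup>2 * (?V N * (real (block y N) + 1))" by (intro mult_left_mono) auto
      also have "\<dots> = ?V N * (C\<^sup>2 * (real (block y N) + 1))" by (simp add: mult_ac)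
      also have "\<dots> \<le> ?V N * ?V N" using V V0 by (rule mult_left_mono)
      finally have "(C * real N)\<^sup>2 \<le> (?V N)\<^sup>2"
        unfolding power_mult_distrib power2_eq_square[of "?V N"] .
      then have "C * real N \<le> ?V N" using V0 by (rule power2_le_imp_le)
      then show ?case using elim(2) by (simp add: field_simps)
    qed
  qed
  then show ?thesis unfolding variance_eq .
qed

end

section \<open>The two-sided Bernoulli shift is mixing\<close>

text \<open>Sets with the asserted limit form a Dynkin system; for disjoint unions limit and sum are interchanged by Tannery's theorem, with the values of \<open>Q\<close> as summable bound.\<close>

lemma measure_tendsto_from_generator:
  fixes N :: "nat \<Rightarrow> 'a measure" and c :: real
  assumes Q: "prob_space Q" and G: "sets Q = sigma_sets (space Q) G" "Int_stable G" "G \<subseteq> Pow (space Q)"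
    and N: "\<And>n. sets (N n) = sets Q" "\<And>n A. A \<in> sets Q \<Longrightarrow> emeasure (N n) A \<le> emeasure Q A"
    and lim: "\<And>A. A \<in> G \<Longrightarrow> (\<lambda>n. measure (N n) A) \<longlonglongrightarrow> c * measure Q A"
    and lim_space: "(\<lambda>n. measure (N n) (space Q)) \<longlonglongrightarrow> c"
    and A: "A \<in> sets Q"
  shows "(\<lambda>n. measure (N n) A) \<longlonglongrightarrow> c * measure Q A"
proof -
  interpret Q: prob_space Q by fact
  have sp: "space (N n) = space Q" for n using sets_eq_imp_space_eq[OF N(1)] .
  have fin: "finite_measure (N n)" for n
  proof (rule finite_measureI)
    have "emeasure (N n) (space Q) \<le> 1" using N(2)[of "space Q" n] by (simp add: Q.emeasure_space_1)
    then show "emeasure (N n) (space (N n)) \<noteq> \<infinity>" using sp by (auto simp: top_unique)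
  qed
  have le: "measure (N n) B \<le> measure Q B" if "B \<in> sets Q" for n B
    unfolding measure_def using N(2)[OF that, of n]
    by (intro enn2real_mono) (auto simp: Q.emeasure_eq_measure)
  have "A \<in> sigma_sets (space Q) G" using A G(1) by simp
  then show ?thesis
  proof (induction rule: sigma_sets_induct_disjoint[OF G(2,3), consumes 1, case_names basic empty compl union])
    case (basic A) then show ?case by (rule lim)
  next
    case empty then show ?case by simp
  next
    case (compl A)
    have A: "A \<in> sets Q" using compl(1) G(1) by simp
    have "(\<lambda>n. measure (N n) (space Q) - measure (N n) A) \<longlonglongrightarrow> c - c * measure Q A"
      by (intro tendsto_diff lim_space compl)
    moreover have "measure (N n) (space Q - A) = measure (N n) (space Q) - measure (N n) A" for n
      using finite_measure.finite_measure_compl[OF fin, of A n] A N(1) sp by simp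
    moreover have "c * measure Q (space Q - A) = c - c * measure Q A"
      unfolding Q.prob_compl[OF A] right_diff_distrib by simp
    ultimately show ?case by simp
  next
    case (union B)
    have B: "range B \<subseteq> sets Q" using union(2) G(1) by simp
    have sQ: "(\<lambda>i. measure Q (B i)) sums measure Q (\<Union>i. B i)"
      by (rule Q.finite_measure_UNION[OF B union(1)])
    have sN: "(\<lambda>i. measure (N n) (B i)) sums measure (N n) (\<Union>i. B i)" for n
      using finite_measure.finite_measure_UNION[OF fin, of B n] B N(1) union(1) by simp
    have "((\<lambda>n. \<Sum>i. measure (N n) (B i)) \<longlonglongrightarrow> (\<Sum>i. c * measure Q (B i)))"
    proof (rule tannerys_theorem[THEN conjunct2, THEN conjunct2])
      show "(\<lambda>n. measure (N n) (B i)) \<longlonglongrightarrow> c * measure Q (B i)" for i by (rule union(3))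
      show "summable (\<lambda>i. measure Q (B i))" using sQ by (rule sums_summable)
      show "\<forall>\<^sub>F (i, n) in at_top \<times>\<^sub>F sequentially. norm (measure (N n) (B i)) \<le> measure Q (B i)"
        using le B by (intro always_eventually) auto
    qed simp
    moreover have "(\<Sum>i. c * measure Q (B i)) = c * measure Q (\<Union>i. B i)"
      using sums_mult[OF sQ, of c] by (simp add: sums_iff)
    moreover have "(\<Sum>i. measure (N n) (B i)) = measure (N n) (\<Union>i. B i)" for n
      using sN by (simp add: sums_iff)
    ultimately show ?case by simp
  qed
qed

locale bernoulli_shift = letter: prob_space M for M :: "nat measure"
begin

definition Q :: "(int \<Rightarrow> nat) measure" where "Q = (\<Pi>\<^sub>M n\<in>UNIV. M)"

sublocale product_prob_space "\<lambda>_::int. M" UNIV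
  by unfold_locales

sublocale Q: prob_space Q
  unfolding Q_def by (rule prob_space_PiM) unfold_locales

lemma space_Q: "space Q = {\<omega>. \<forall>n. \<omega> n \<in> space M}"
  by (auto simp: Q_def space_PiM)

lemma measurable_coord [measurable]: "(\<lambda>\<omega>. \<omega> n) \<in> measurable Q M"
  unfolding Q_def by (rule measurable_component_singleton) simp

definition cyl :: "int set \<Rightarrow> (int \<Rightarrow> nat set) \<Rightarrow> (int \<Rightarrow> nat) set" where
  "cyl J X = {\<omega> \<in> space Q. \<forall>j\<in>J. \<omega> j \<in> X j}"

lemma cyl_eq_emb: "cyl J X = prod_emb UNIV (\<lambda>_. M) J (Pi\<^sub>E J X)"
  by (auto simp: cyl_def space_Q prod_emb_def PiE_iff)

lemma measure_cyl: "finite J \<Longrightarrow> (\<And>j. j \<in> J \<Longrightarrow> X j \<in> sets M) \<Longrightarrow> measure Q (cyl J X) = (\<Prod>j\<in>J. measure M (X j))"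
  unfolding cyl_eq_emb Q_def by (rule measure_PiM_emb) auto

lemma cyl_sets: "finite J \<Longrightarrow> (\<And>j. j \<in> J \<Longrightarrow> X j \<in> sets M) \<Longrightarrow> cyl J X \<in> sets Q"
  unfolding cyl_eq_emb Q_def by (rule sets_PiM_I) auto

definition cylinders :: "(int \<Rightarrow> nat) set set" where
  "cylinders = prod_algebra UNIV (\<lambda>_. M)"

lemma cylindersE:
  assumes "A \<in> cylinders"
  obtains J X where "finite J" "\<And>j. j \<in> J \<Longrightarrow> X j \<in> sets M" "A = cyl J X"
  using assms unfolding cylinders_def cyl_eq_emb by (rule prod_algebraE) blast

lemma cylinders: "sets Q = sigma_sets (space Q) cylinders" "Int_stable cylinders" "cylinders \<subseteq> Pow (space Q)"
proof -
  show "sets Q = sigma_sets (space Q) cylinders"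
    unfolding Q_def cylinders_def sets_PiM space_PiM ..
  show "Int_stable cylinders" unfolding cylinders_def by (rule Int_stable_prod_algebra)
  show "cylinders \<subseteq> Pow (space Q)"
    unfolding cylinders_def Q_def space_PiM by (rule prod_algebra_sets_into_space)
qed

definition shiftn :: "int \<Rightarrow> (int \<Rightarrow> nat) \<Rightarrow> int \<Rightarrow> nat" where
  "shiftn n \<omega> = (\<lambda>k. \<omega> (k + n))"

lemma shiftn_space: "\<omega> \<in> space Q \<Longrightarrow> shiftn n \<omega> \<in> space Q"
  by (auto simp: space_Q shiftn_def)

lemma shiftn_measurable [measurable]: "shiftn n \<in> measurable Q Q"
proof -
  have "(\<lambda>\<omega> k. \<omega> (k + n)) \<in> measurable Q (\<Pi>\<^sub>M k\<in>UNIV. M)"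
    by (rule measurable_PiM_single') (auto simp: space_Q)
  then show ?thesis by (simp add: shiftn_def[abs_def] Q_def)
qed

lemma distr_shiftn: "distr Q Q (shiftn n) = Q"
proof -
  have "distr (Pi\<^sub>M UNIV (\<lambda>_. M)) (Pi\<^sub>M UNIV (\<lambda>_. M)) (\<lambda>\<omega>. \<lambda>k\<in>UNIV. \<omega> (k + n)) = Pi\<^sub>M UNIV (\<lambda>_::int. M)"
    by (rule distr_PiM_reindex[where M = "\<lambda>_. M" and f = "\<lambda>k::int. k + n"]) (auto intro!: injI letter.prob_space_axioms)
  then show ?thesis by (simp add: Q_def shiftn_def[abs_def] restrict_UNIV)
qed

lemma measure_shiftn: "A \<in> sets Q \<Longrightarrow> measure Q (shiftn n -` A \<inter> space Q) = measure Q A"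
  using measure_distr[OF shiftn_measurable, of A n] by (simp add: distr_shiftn)

lemma shiftn_cyl: "shiftn n -` cyl J X \<inter> space Q = cyl ((\<lambda>j. j + n) ` J) (\<lambda>j. X (j - n))"
  unfolding cyl_def using shiftn_space by (auto simp: shiftn_def)

text \<open>For large \<open>n\<close> the two cylinders restrict disjoint sets of coordinates, so the sequence is eventually constant.\<close>

lemma cylinder_mixing:
  assumes "A \<in> cylinders" "B \<in> cylinders"
  shows "(\<lambda>n. measure Q (A \<inter> (shiftn (int n) -` B \<inter> space Q))) \<longlonglongrightarrow> measure Q B * measure Q A"
proof -
  obtain J X where A: "finite J" "\<And>j. j \<in> J \<Longrightarrow> X j \<in> sets M" "A = cyl J X" using cylindersE[OF assms(1)] by blast
  obtain K Y where B: "finite K" "\<And>j. j \<in> K \<Longrightarrow> Y j \<in> sets M" "B = cyl K Y" using cylindersE[OF assms(2)] by blast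
  have "finite ((\<lambda>(j, k). nat (j - k)) ` (J \<times> K))" using A B by simp
  then obtain n0 where n0: "\<And>x. x \<in> (\<lambda>(j, k). nat (j - k)) ` (J \<times> K) \<Longrightarrow> x < n0"
    by (metis finite_nat_set_iff_bounded)
  have "measure Q (A \<inter> (shiftn (int n) -` B \<inter> space Q)) = measure Q B * measure Q A" if n: "n \<ge> n0" for n
  proof -
    let ?K = "(\<lambda>j. j + int n) ` K" and ?Z = "\<lambda>j. if j \<in> J then X j else Y (j - int n)"
    have disj: "J \<inter> ?K = {}"
    proof -
      have "j \<noteq> k + int n" if "j \<in> J" "k \<in> K" for j k
      proof -
        have "nat (j - k) < n0" by (rule n0) (use that in force)
        then show ?thesis using n by auto
      qed
      then show ?thesis by auto
    qed
    have "A \<inter> (shiftn (int n) -` B \<inter> space Q) = cyl (J \<union> ?K) ?Z"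
    proof -
      have "?Z (k + int n) = Y k" if "k \<in> K" for k using that disj by auto
      moreover have "?Z j = X j" if "j \<in> J" for j using that by simp
      ultimately show ?thesis unfolding A B shiftn_cyl cyl_def
        by (auto simp add: ball_Un shiftn_def shiftn_space[unfolded shiftn_def] simp del: if_split cong: ball_cong)
    qed
    moreover have "measure Q (cyl (J \<union> ?K) ?Z) = (\<Prod>j\<in>J \<union> ?K. measure M (?Z j))"
      by (rule measure_cyl) (use A B in auto)
    moreover have "\<dots> = (\<Prod>j\<in>J. measure M (?Z j)) * (\<Prod>j\<in>?K. measure M (?Z j))"
      by (rule prod.union_disjoint) (use A B disj in auto)
    moreover have "(\<Prod>j\<in>J. measure M (?Z j)) = measure Q A" unfolding A by (subst measure_cyl) (use A in auto)
    moreover have "(\<Prod>j\<in>?K. measure M (?Z j)) = (\<Prod>j\<in>?K. measure M (Y (j - int n)))"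
      by (rule prod.cong) (use disj in auto)
    moreover have "\<dots> = measure Q B" unfolding B by (subst measure_cyl) (use B in \<open>auto simp: prod.reindex inj_on_def\<close>)
    ultimately show ?thesis by simp
  qed
  then show ?thesis by (intro tendsto_eventually) (auto simp: eventually_sequentially)
qed

text \<open>Extension from cylinders to all events in two steps, one argument at a time. In each step the quantity that converges is, as a function of the remaining argument, a measure dominated by \<open>Q\<close>.\<close>

lemma mixing:
  assumes A: "A \<in> sets Q" and B: "B \<in> sets Q"
  shows "(\<lambda>n. measure Q (A \<inter> (shiftn (int n) -` B \<inter> space Q))) \<longlonglongrightarrow> measure Q A * measure Q B"
proof -
  have cyl_Q: "C \<in> sets Q" if "C \<in> cylinders" for C using that cylindersE cyl_sets by metis
  have pre: "shiftn n -` C \<inter> space Q \<in> sets Q" if "C \<in> sets Q" for n C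
    using shiftn_measurable that by (rule measurable_sets)
  have 1: "(\<lambda>n. measure Q (A \<inter> (shiftn (int n) -` C \<inter> space Q))) \<longlonglongrightarrow> measure Q C * measure Q A"
    if A: "A \<in> sets Q" and C: "C \<in> cylinders" for A C
  proof -
    let ?D = "\<lambda>n. shiftn (int n) -` C \<inter> space Q"
    let ?N = "\<lambda>n. density Q (indicator (?D n))"
    have N: "emeasure (?N n) E = emeasure Q (E \<inter> ?D n)" if "E \<in> sets Q" for n E
      using pre[OF cyl_Q[OF C], of "int n"] that
      by (subst emeasure_density) (auto simp: nn_integral_indicator[symmetric] indicator_inter_arith mult.commute intro!: nn_integral_cong)
    then have N': "measure (?N n) E = measure Q (E \<inter> ?D n)" if "E \<in> sets Q" for n E
      using that by (simp add: measure_def)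
    have "(\<lambda>n. measure (?N n) A) \<longlonglongrightarrow> measure Q C * measure Q A"
    proof (rule measure_tendsto_from_generator[OF Q.prob_space_axioms cylinders])
      show "emeasure (?N n) E \<le> emeasure Q E" if "E \<in> sets Q" for n E
        using that by (simp add: N emeasure_mono)
      show "(\<lambda>n. measure (?N n) E) \<longlonglongrightarrow> measure Q C * measure Q E" if "E \<in> cylinders" for E
        using cylinder_mixing[OF that C] N'[OF cyl_Q[OF that]] by simp
      have "measure (?N n) (space Q) = measure Q C" for n
        using N'[of "space Q" n] measure_shiftn[OF cyl_Q[OF C], of "int n"] by (simp add: Int_absorb1 Int_commute)
      then show "(\<lambda>n. measure (?N n) (space Q)) \<longlonglongrightarrow> measure Q C" by simp
    qed (use A in auto)
    then show ?thesis using N'[OF A] by simp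
  qed
  let ?N = "\<lambda>n::nat. distr (density Q (indicator A)) Q (shiftn (int n))"
  have N: "emeasure (?N n) E = emeasure Q (A \<inter> (shiftn (int n) -` E \<inter> space Q))" if "E \<in> sets Q" for n E
  proof -
    have "emeasure (?N n) E = emeasure (density Q (indicator A)) (shiftn (int n) -` E \<inter> space Q)"
      using that shiftn_measurable by (subst emeasure_distr) (auto simp: measurable_def)
    also have "\<dots> = emeasure Q (A \<inter> (shiftn (int n) -` E \<inter> space Q))"
      using pre[OF that, of "int n"] A
      by (subst emeasure_density) (auto simp: nn_integral_indicator[symmetric] indicator_inter_arith mult.commute intro!: nn_integral_cong)
    finally show ?thesis .
  qed
  then have N': "measure (?N n) E = measure Q (A \<inter> (shiftn (int n) -` E \<inter> space Q))" if "E \<in> sets Q" for n E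
    using that by (simp add: measure_def)
  have "(\<lambda>n. measure (?N n) B) \<longlonglongrightarrow> measure Q A * measure Q B"
  proof (rule measure_tendsto_from_generator[OF Q.prob_space_axioms cylinders])
    show "emeasure (?N n) E \<le> emeasure Q E" if "E \<in> sets Q" for n E
    proof -
      have "emeasure (?N n) E \<le> emeasure Q (shiftn (int n) -` E \<inter> space Q)"
        unfolding N[OF that] using pre[OF that] by (intro emeasure_mono) auto
      also have "\<dots> = emeasure Q E"
        using emeasure_distr[OF shiftn_measurable that, of "int n"] by (simp add: distr_shiftn)
      finally show ?thesis .
    qed
    show "(\<lambda>n. measure (?N n) E) \<longlonglongrightarrow> measure Q A * measure Q E" if "E \<in> cylinders" for E
      using 1[OF A that] N'[OF cyl_Q[OF that]] by (simp add: mult.commute)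
    have "shiftn (int n) -` space Q \<inter> space Q = space Q" for n using shiftn_space by auto
    moreover have "A \<inter> space Q = A" using sets.sets_into_space[OF A] by auto
    ultimately have "measure (?N n) (space Q) = measure Q A" for n
      using N'[of "space Q" n] by simp
    then show "(\<lambda>n. measure (?N n) (space Q)) \<longlonglongrightarrow> measure Q A" by simp
  qed (use B in auto)
  then show ?thesis using N'[OF B] by simp
qed

lemma shift_eq: "shift = shiftn 1"
  by (simp add: shift_def[abs_def] shiftn_def[abs_def])

lemma shiftn_inverse: "shiftn (- n) (shiftn n \<omega>) = \<omega>" "shiftn n (shiftn (- n) \<omega>) = \<omega>"
  by (auto simp: shiftn_def)

lemma bij_shift: "bij_betw shift (space Q) (space Q)"
  unfolding shift_eq using shiftn_inverse shiftn_space
  by (intro bij_betw_byWitness[where f' = "shiftn (- 1)"]) auto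

lemma inv_shift: "\<omega> \<in> space Q \<Longrightarrow> inv_into (space Q) shift \<omega> = shiftn (- 1) \<omega>"
  using bij_shift shiftn_inverse(2)[of 1] shiftn_space
  by (intro inv_into_f_eq) (auto simp: bij_betw_def shift_eq)

text \<open>An invariant event \<open>A\<close> is mixing with itself, so its probability equals its own square.\<close>

lemma shift_invertible_ergodic: "invertible_ergodic_mps Q shift"
  unfolding invertible_ergodic_mps_def
proof (intro conjI ballI impI)
  show "prob_space Q" by unfold_locales
  show "bij_betw shift (space Q) (space Q)" by (rule bij_shift)
  show "shift \<in> measurable Q Q" "distr Q Q shift = Q" by (simp_all add: shift_eq distr_shiftn)
  show "inv_into (space Q) shift \<in> measurable Q Q"
    using shiftn_measurable[of "- 1"] by (subst measurable_cong[OF inv_shift]) auto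
  fix A assume A: "A \<in> sets Q" and inv: "shift -` A \<inter> space Q = A"
  have "shiftn (int n) -` A \<inter> space Q = A" for n
  proof (induction n)
    case 0
    then show ?case using sets.sets_into_space[OF A] by (auto simp: shiftn_def)
  next
    case (Suc n)
    have "shiftn (int (Suc n)) \<omega> = shift (shiftn (int n) \<omega>)" for \<omega>
      by (simp add: shift_eq shiftn_def algebra_simps)
    then have "shiftn (int (Suc n)) -` A \<inter> space Q = shiftn (int n) -` (shift -` A \<inter> space Q) \<inter> space Q"
      using shiftn_space by auto
    then show ?case using Suc inv by simp
  qed
  then have "(\<lambda>n::nat. measure Q A) \<longlonglongrightarrow> measure Q A * measure Q A"
    using mixing[OF A A] by simp
  then have "measure Q A * measure Q A = measure Q A"
    by (intro LIMSEQ_unique) auto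
  then show "emeasure Q A = 0 \<or> emeasure Q A = 1"
    by (auto simp: Q.emeasure_eq_measure)
qed

end

section \<open>Suspensions over ergodic systems\<close>

locale suspension =
  fixes Q :: "'w measure" and S :: "'w \<Rightarrow> 'w" and h :: "'w \<Rightarrow> nat"
  assumes base: "invertible_ergodic_mps Q S"
    and h_meas [measurable]: "h \<in> measurable Q (count_space UNIV)"
    and h_pos: "\<And>\<omega>. \<omega> \<in> space Q \<Longrightarrow> 0 < h \<omega>"
    and h_fin: "(\<integral>\<^sup>+ \<omega>. of_nat (h \<omega>) \<partial>Q) < \<infinity>"
begin

sublocale Q: prob_space Q using base by (simp add: invertible_ergodic_mps_def)

lemma S_meas [measurable]: "S \<in> measurable Q Q" using base by (simp add: invertible_ergodic_mps_def)

definition S' where "S' = inv_into (space Q) S"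

lemma S'_meas [measurable]: "S' \<in> measurable Q Q" using base by (simp add: invertible_ergodic_mps_def S'_def)

lemma S_bij: "bij_betw S (space Q) (space Q)" using base by (simp add: invertible_ergodic_mps_def)

lemma S_S' [simp]: "\<omega> \<in> space Q \<Longrightarrow> S (S' \<omega>) = \<omega>"
  unfolding S'_def by (rule bij_betw_inv_into_right[OF S_bij])

lemma S'_S [simp]: "\<omega> \<in> space Q \<Longrightarrow> S' (S \<omega>) = \<omega>"
  unfolding S'_def by (rule bij_betw_inv_into_left[OF S_bij])

lemma S_space [simp]: "\<omega> \<in> space Q \<Longrightarrow> S \<omega> \<in> space Q"
  using measurable_space[OF S_meas] .

lemma S'_space [simp]: "\<omega> \<in> space Q \<Longrightarrow> S' \<omega> \<in> space Q"
  using measurable_space[OF S'_meas] .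

lemma S_inv: "A \<in> sets Q \<Longrightarrow> emeasure Q {\<omega> \<in> space Q. S \<omega> \<in> A} = emeasure Q A"
proof -
  assume A: "A \<in> sets Q"
  have "distr Q Q S = Q" using base by (simp add: invertible_ergodic_mps_def)
  then have "emeasure Q A = emeasure Q (S -` A \<inter> space Q)" using emeasure_distr[OF S_meas A] by simp
  also have "S -` A \<inter> space Q = {\<omega> \<in> space Q. S \<omega> \<in> A}" by auto
  finally show ?thesis by simp
qed

abbreviation \<Omega> where "\<Omega> \<equiv> suspension_space Q h"
abbreviation PN where "PN \<equiv> Q \<Otimes>\<^sub>M count_space (UNIV :: nat set)"
definition M where "M = suspension_measure Q h"
definition E where "E = (\<integral>\<^sup>+ \<omega>. of_nat (h \<omega>) \<partial>Q)"
abbreviation \<sigma> where "\<sigma> \<equiv> suspension_map S h"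
definition \<tau> where "\<tau> = (\<lambda>(\<omega>, i). if 0 < i then (\<omega>, i - 1) else (S' \<omega>, h (S' \<omega>) - 1))"

lemma h_borel [measurable]: "h \<in> borel_measurable Q"
  using h_meas measurable_cong_sets[OF refl sets_borel_eq_count_space, of Q] by blast

lemma snd_borel [measurable]: "snd \<in> borel_measurable PN"
proof -
  have "snd \<in> measurable PN (count_space UNIV)" by (rule measurable_snd)
  then show ?thesis using measurable_cong_sets[OF refl sets_borel_eq_count_space, of PN] by blast
qed

lemma \<Omega>_eq: "\<Omega> = {x \<in> space PN. snd x < h (fst x)}"
  by (auto simp: suspension_space_def space_pair_measure)

lemma \<Omega>_sets: "\<Omega> \<in> sets PN"
  unfolding \<Omega>_eq by (intro borel_measurable_less) measurable

lemma slice_eq: "emeasure PN A = (\<Sum>i. emeasure Q {\<omega> \<in> space Q. (\<omega>, i) \<in> A})" if "A \<in> sets PN"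
proof -
  interpret C: sigma_finite_measure "count_space (UNIV :: nat set)"
    by (rule sigma_finite_measure_count_space_countable) simp
  interpret pair_sigma_finite Q "count_space (UNIV :: nat set)" ..
  have "(\<lambda>x. (x, i)) -` A = {\<omega> \<in> space Q. (\<omega>, i) \<in> A}" for i
    using sets.sets_into_space[OF that] by (auto simp: space_pair_measure)
  then show ?thesis
    unfolding emeasure_pair_measure_alt2[OF that] by (simp add: nn_integral_count_space_nat)
qed

lemma E_pos: "1 \<le> E" and E_fin: "E < \<infinity>"
proof -
  have "(\<integral>\<^sup>+ \<omega>. 1 \<partial>Q) \<le> E" unfolding E_def
  proof (rule nn_integral_mono)
    fix \<omega> assume "\<omega> \<in> space Q"
    then have "Suc 0 \<le> h \<omega>" using h_pos[of \<omega>] by simp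
    then have "(of_nat (Suc 0) :: ennreal) \<le> of_nat (h \<omega>)" by (rule of_nat_mono)
    then show "1 \<le> (of_nat (h \<omega>) :: ennreal)" by simp
  qed
  then show "1 \<le> E" by (simp add: Q.emeasure_space_1)
  show "E < \<infinity>" using h_fin by (simp add: E_def)
qed

lemma sets_M: "sets M = sets (restrict_space PN \<Omega>)"
  and space_M: "space M = \<Omega>"
proof -
  have s: "space (restrict_space PN \<Omega>) = \<Omega>" using \<Omega>_sets by (auto simp: space_restrict_space \<Omega>_eq)
  have sub: "sets (restrict_space PN \<Omega>) \<subseteq> Pow \<Omega>" using sets.space_closed[of "restrict_space PN \<Omega>"] by (simp add: s)
  show "sets M = sets (restrict_space PN \<Omega>)" 
    unfolding M_def suspension_measure_def using sets.sigma_sets_eq[of "restrict_space PN \<Omega>"] s by (simp add: sub)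
  show "space M = \<Omega>" unfolding M_def suspension_measure_def by (simp add: space_measure_of sub)
qed

lemma sets_M_iff: "A \<in> sets M \<longleftrightarrow> A \<in> sets PN \<and> A \<subseteq> \<Omega>"
  unfolding sets_M using \<Omega>_sets by (subst sets_restrict_space_iff) auto

text \<open>Countable additivity of the defining expression is inherited from the product of \<open>Q\<close> with counting measure, of which it is a multiple.\<close>

lemma emeasure_M:
  assumes A: "A \<in> sets M"
  shows "emeasure M A = (\<Sum>i. emeasure Q {\<omega> \<in> space Q. (\<omega>, i) \<in> A}) / E"
proof (rule emeasure_measure_of[OF M_def[unfolded suspension_measure_def, folded E_def]])
  have s: "space (restrict_space PN \<Omega>) = \<Omega>" using \<Omega>_sets by (auto simp: space_restrict_space \<Omega>_eq)
  show "sets (restrict_space PN \<Omega>) \<subseteq> Pow \<Omega>" using sets.space_closed[of "restrict_space PN \<Omega>"] by (simp add: s)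
  let ?N = "scale_measure (1 / E) (restrict_space PN \<Omega>)"
  have eq: "(\<Sum>i. emeasure Q {\<omega> \<in> space Q. (\<omega>, i) \<in> A}) / E = emeasure ?N A" if "A \<in> sets M" for A
    using that slice_eq[of A] \<Omega>_sets unfolding sets_M_iff
    by (simp add: emeasure_restrict_space divide_ennreal_def mult.commute)
  show "positive (sets M) (\<lambda>A. (\<Sum>i. emeasure Q {\<omega> \<in> space Q. (\<omega>, i) \<in> A}) / E)"
    by (simp add: positive_def)
  define F where "F A = (\<Sum>i. emeasure Q {\<omega> \<in> space Q. (\<omega>, i) \<in> A}) / E" for A
  have F: "F A = emeasure ?N A" if "A \<in> sets M" for A using eq[OF that] by (simp only: F_def)
  have "(\<Sum>i. F (A i)) = F (\<Union>i. A i)"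
    if "range A \<subseteq> sets M" "disjoint_family A" "(\<Union>i. A i) \<in> sets M" for A :: "nat \<Rightarrow> _"
  proof -
    have "A i \<in> sets M" for i using that by auto
    then have "(\<Sum>i. F (A i)) = (\<Sum>i. emeasure ?N (A i))" by (simp only: F)
    also have "\<dots> = emeasure ?N (\<Union>i. A i)"
      using that by (intro suminf_emeasure) (simp_all add: sets_M)
    finally show ?thesis using F[OF that(3)] by simp
  qed
  then have "countably_additive (sets M) F" unfolding countably_additive_def by blast
  then show "countably_additive (sets M) (\<lambda>A. (\<Sum>i. emeasure Q {\<omega> \<in> space Q. (\<omega>, i) \<in> A}) / E)"
    unfolding F_def .
qed (use A in auto)

lemma slice_sets: "A \<in> sets M \<Longrightarrow> {\<omega> \<in> space Q. (\<omega>, i) \<in> A} \<in> sets Q"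
proof -
  assume "A \<in> sets M"
  then have A: "A \<in> sets PN" by (simp add: sets_M_iff)
  have "(\<lambda>\<omega>. (\<omega>, i)) \<in> measurable Q PN" by measurable
  from measurable_sets[OF this A] have "(\<lambda>\<omega>. (\<omega>, i)) -` A \<inter> space Q \<in> sets Q" .
  also have "(\<lambda>\<omega>. (\<omega>, i)) -` A \<inter> space Q = {\<omega> \<in> space Q. (\<omega>, i) \<in> A}" by auto
  finally show ?thesis .
qed

lemma sum_levels: "(\<Sum>i. emeasure Q {\<omega> \<in> space Q. i < h \<omega> \<and> \<omega> \<in> B}) = (\<integral>\<^sup>+ \<omega>. of_nat (h \<omega>) * indicator B \<omega> \<partial>Q)"
  if [measurable]: "B \<in> sets Q"
proof -
  have "(\<Sum>i. emeasure Q {\<omega> \<in> space Q. i < h \<omega> \<and> \<omega> \<in> B}) = (\<Sum>i. \<integral>\<^sup>+ \<omega>. indicator {\<omega> \<in> space Q. i < h \<omega> \<and> \<omega> \<in> B} \<omega> \<partial>Q)"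
    by simp
  also have "\<dots> = (\<integral>\<^sup>+ \<omega>. (\<Sum>i. indicator {\<omega> \<in> space Q. i < h \<omega> \<and> \<omega> \<in> B} \<omega>) \<partial>Q)"
    by (rule nn_integral_suminf[symmetric]) measurable
  also have "\<dots> = (\<integral>\<^sup>+ \<omega>. of_nat (h \<omega>) * indicator B \<omega> \<partial>Q)"
  proof (rule nn_integral_cong)
    fix \<omega> assume w: "\<omega> \<in> space Q"
    have "(\<Sum>i. indicator {\<omega> \<in> space Q. i < h \<omega> \<and> \<omega> \<in> B} \<omega> :: ennreal) = (\<Sum>i<h \<omega>. indicator {\<omega> \<in> space Q. i < h \<omega> \<and> \<omega> \<in> B} \<omega>)"
      by (rule suminf_finite) (auto simp: indicator_def)
    also have "\<dots> = (\<Sum>i<h \<omega>. indicator B \<omega>)" using w by (intro sum.cong) (auto simp: indicator_def)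
    finally show "(\<Sum>i. indicator {\<omega> \<in> space Q. i < h \<omega> \<and> \<omega> \<in> B} \<omega> :: ennreal) = of_nat (h \<omega>) * indicator B \<omega>" by simp
  qed
  finally show ?thesis .
qed

lemma emeasure_M_fst:
  assumes B: "B \<in> sets Q"
  shows "{x \<in> \<Omega>. fst x \<in> B} \<in> sets M"
    and "emeasure M {x \<in> \<Omega>. fst x \<in> B} = (\<integral>\<^sup>+ \<omega>. of_nat (h \<omega>) * indicator B \<omega> \<partial>Q) / E"
proof -
  have "{x \<in> \<Omega>. fst x \<in> B} = {x \<in> space PN. snd x < h (fst x) \<and> fst x \<in> B}" by (auto simp: \<Omega>_eq)
  also have "\<dots> = \<Omega> \<inter> (fst -` B \<inter> space PN)" by (auto simp: \<Omega>_eq)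
  also have "\<dots> \<in> sets PN" using \<Omega>_sets measurable_sets[OF measurable_fst B] by blast
  finally show s: "{x \<in> \<Omega>. fst x \<in> B} \<in> sets M" by (simp add: sets_M_iff)
  have "{\<omega> \<in> space Q. (\<omega>, i) \<in> {x \<in> \<Omega>. fst x \<in> B}} = {\<omega> \<in> space Q. i < h \<omega> \<and> \<omega> \<in> B}" for i
    by (auto simp: suspension_space_def)
  then show "emeasure M {x \<in> \<Omega>. fst x \<in> B} = (\<integral>\<^sup>+ \<omega>. of_nat (h \<omega>) * indicator B \<omega> \<partial>Q) / E"
    unfolding emeasure_M[OF s] by (simp add: sum_levels[OF B])
qed

sublocale M: prob_space M
proof (rule prob_spaceI)
  have "{x \<in> \<Omega>. fst x \<in> space Q} = \<Omega>" by (auto simp: suspension_space_def)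
  then have "emeasure M \<Omega> = (\<integral>\<^sup>+ \<omega>. of_nat (h \<omega>) * indicator (space Q) \<omega> \<partial>Q) / E"
    using emeasure_M_fst(2)[of "space Q"] by simp
  also have "(\<integral>\<^sup>+ \<omega>. of_nat (h \<omega>) * indicator (space Q) \<omega> \<partial>Q) = E"
    unfolding E_def by (intro nn_integral_cong) auto
  also have "E / E = 1" using E_pos E_fin by (intro ennreal_divide_self) auto
  finally show "emeasure M (space M) = 1" by (simp add: space_M)
qed

lemma AE_fst:
  assumes "AE \<omega> in Q. P \<omega>" shows "AE y in M. P (fst y)"
proof -
  obtain N where N: "{\<omega> \<in> space Q. \<not> P \<omega>} \<subseteq> N" "N \<in> sets Q" "emeasure Q N = 0"
    using assms by (auto elim: AE_E)
  have "AE \<omega> in Q. of_nat (h \<omega>) * indicator N \<omega> = (0::ennreal)"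
    using N by (intro AE_I[of _ _ N]) (auto simp: indicator_def)
  then have "(\<integral>\<^sup>+ \<omega>. of_nat (h \<omega>) * indicator N \<omega> \<partial>Q) = 0"
    by (subst nn_integral_cong_AE[of _ "\<lambda>_. 0"]) auto
  then have "emeasure M {x \<in> \<Omega>. fst x \<in> N} = 0" using emeasure_M_fst(2)[OF N(2)] by simp
  then show ?thesis
    using N(1) emeasure_M_fst(1)[OF N(2)]
    by (intro AE_I[of _ _ "{x \<in> \<Omega>. fst x \<in> N}"]) (auto simp: space_M suspension_space_def)
qed

lemma measurable_M:
  assumes "f \<in> measurable PN PN" "\<And>x. x \<in> \<Omega> \<Longrightarrow> f x \<in> \<Omega>" shows "f \<in> measurable M M"
proof -
  have "f \<in> measurable (restrict_space PN \<Omega>) (restrict_space PN \<Omega>)"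
    using assms by (intro measurable_restrict_space3) auto
  then show ?thesis using measurable_cong_sets[OF sets_M sets_M] by simp
qed

lemma \<sigma>_space: "x \<in> \<Omega> \<Longrightarrow> \<sigma> x \<in> \<Omega>"
  using h_pos by (cases x) (auto simp: suspension_space_def suspension_map_def)

lemma \<tau>_space: "x \<in> \<Omega> \<Longrightarrow> \<tau> x \<in> \<Omega>"
  using h_pos by (cases x) (auto simp: suspension_space_def \<tau>_def)

lemma \<tau>_\<sigma>: "x \<in> \<Omega> \<Longrightarrow> \<tau> (\<sigma> x) = x"
  by (auto simp: suspension_space_def suspension_map_def \<tau>_def)

lemma \<sigma>_\<tau>: "x \<in> \<Omega> \<Longrightarrow> \<sigma> (\<tau> x) = x"
  using h_pos by (auto simp: suspension_space_def suspension_map_def \<tau>_def)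

lemma \<sigma>_meas: "\<sigma> \<in> measurable M M"
proof (rule measurable_M)
  have "(\<lambda>x. if snd x < h (fst x) - 1 then (fst x, snd x + 1) else (S (fst x), 0)) \<in> measurable PN PN"
    by measurable
  then show "\<sigma> \<in> measurable PN PN" by (simp add: suspension_map_def case_prod_beta')
qed (rule \<sigma>_space)

lemma \<tau>_meas: "\<tau> \<in> measurable M M"
proof (rule measurable_M)
  have "(\<lambda>x. if 0 < snd x then (fst x, snd x - 1) else (S' (fst x), h (S' (fst x)) - 1)) \<in> measurable PN PN"
    by measurable
  then show "\<tau> \<in> measurable PN PN" by (simp add: \<tau>_def case_prod_beta')
qed (rule \<tau>_space)

lemma \<sigma>_bij: "bij_betw \<sigma> \<Omega> \<Omega>"
  by (rule bij_betw_byWitness[where f' = \<tau>]) (use \<tau>_\<sigma> \<sigma>_\<tau> \<sigma>_space \<tau>_space in auto)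

lemma inv_\<sigma>: "x \<in> \<Omega> \<Longrightarrow> inv_into \<Omega> \<sigma> x = \<tau> x"
  using \<sigma>_bij \<sigma>_\<tau> \<tau>_space by (intro inv_into_f_eq) (auto simp: bij_betw_def)

text \<open>The floor \<open>i\<close> of the preimage of \<open>A\<close> consists of points climbing to floor \<open>i + 1\<close> of \<open>A\<close> and of points with \<open>h \<omega> = i + 1\<close> that fall to its ground floor; summed over \<open>i\<close>, the latter have the measure of the ground floor of \<open>A\<close> because \<open>S\<close> preserves \<open>Q\<close>.\<close>

lemma \<sigma>_preserves:
  assumes A: "A \<in> sets M" shows "emeasure M (\<sigma> -` A \<inter> \<Omega>) = emeasure M A"
proof -
  let ?A = "\<lambda>i. {\<omega> \<in> space Q. (\<omega>, i) \<in> A}"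
  have sA [measurable]: "?A i \<in> sets Q" for i by (rule slice_sets[OF A])
  have A\<Omega>: "(\<omega>, i) \<in> A \<Longrightarrow> \<omega> \<in> space Q \<and> i < h \<omega>" for \<omega> i using A by (auto simp: sets_M_iff suspension_space_def)
  let ?D = "\<lambda>i. {\<omega> \<in> space Q. h \<omega> = Suc i \<and> S \<omega> \<in> ?A 0}"
  have D [measurable]: "?D i \<in> sets Q" for i by measurable
  have pre: "\<sigma> -` A \<inter> \<Omega> \<in> sets M" using measurable_sets[OF \<sigma>_meas A] by (simp add: space_M)
  have "{\<omega> \<in> space Q. (\<omega>, i) \<in> \<sigma> -` A \<inter> \<Omega>} = ?A (Suc i) \<union> ?D i" for i
  proof (intro set_eqI iffI)
    fix \<omega> assume "\<omega> \<in> {\<omega> \<in> space Q. (\<omega>, i) \<in> \<sigma> -` A \<inter> \<Omega>}"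
    then have "\<omega> \<in> space Q" "i < h \<omega>" "\<sigma> (\<omega>, i) \<in> A" by (auto simp: suspension_space_def)
    then show "\<omega> \<in> ?A (Suc i) \<union> ?D i"
      by (cases "i < h \<omega> - 1") (auto simp: suspension_map_def)
  next
    fix \<omega> assume "\<omega> \<in> ?A (Suc i) \<union> ?D i"
    then show "\<omega> \<in> {\<omega> \<in> space Q. (\<omega>, i) \<in> \<sigma> -` A \<inter> \<Omega>}"
      using A\<Omega>[of \<omega> "Suc i"] by (auto simp: suspension_map_def suspension_space_def)
  qed
  moreover have "emeasure Q (?A (Suc i) \<union> ?D i) = emeasure Q (?A (Suc i)) + emeasure Q (?D i)" for i
    using A\<Omega> by (intro plus_emeasure[symmetric] sA D) force
  moreover have "(\<Sum>i. emeasure Q (?A (Suc i)) + emeasure Q (?D i)) = (\<Sum>i. emeasure Q (?A (Suc i))) + (\<Sum>i. emeasure Q (?D i))"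
    by (rule suminf_add[symmetric]) auto
  moreover have "(\<Sum>i. emeasure Q (?D i)) = emeasure Q (?A 0)"
  proof -
    have "(\<Sum>i. emeasure Q (?D i)) = emeasure Q (\<Union>i. ?D i)"
      by (rule suminf_emeasure) (auto simp: disjoint_family_on_def)
    also have "(\<Union>i. ?D i) = {\<omega> \<in> space Q. S \<omega> \<in> ?A 0}"
      using h_pos gr0_implies_Suc by auto
    also have "emeasure Q \<dots> = emeasure Q (?A 0)" by (rule S_inv) measurable
    finally show ?thesis .
  qed
  moreover have "(\<Sum>i. emeasure Q (?A i)) = (\<Sum>i. emeasure Q (?A (Suc i))) + emeasure Q (?A 0)"
    using suminf_offset[of "\<lambda>i. emeasure Q (?A i)" 1] by simp
  ultimately show ?thesis unfolding emeasure_M[OF pre] emeasure_M[OF A] by simp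
qed

text \<open>An invariant set is a union of full columns over an \<open>S\<close>-invariant set \<open>?B\<close>.\<close>

lemma \<sigma>_ergodic:
  assumes A: "A \<in> sets M" and inv: "\<sigma> -` A \<inter> \<Omega> = A"
  shows "emeasure M A = 0 \<or> emeasure M A = 1"
proof -
  let ?B = "{\<omega> \<in> space Q. (\<omega>, 0) \<in> A}"
  have B: "?B \<in> sets Q" by (rule slice_sets[OF A])
  have iff: "x \<in> A \<longleftrightarrow> \<sigma> x \<in> A" if "x \<in> \<Omega>" for x
  proof -
    have "x \<in> A \<longleftrightarrow> x \<in> \<sigma> -` A \<inter> \<Omega>" using inv by simp
    then show ?thesis using that by simp
  qed
  have up: "(\<omega>, i) \<in> A \<longleftrightarrow> \<omega> \<in> ?B" if "\<omega> \<in> space Q" "i < h \<omega>" for \<omega> i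
    using that(2)
  proof (induction i)
    case (Suc i)
    then have "(\<omega>, i) \<in> \<Omega>" "\<sigma> (\<omega>, i) = (\<omega>, Suc i)" using that(1) by (auto simp: suspension_space_def suspension_map_def)
    then have "(\<omega>, i) \<in> A \<longleftrightarrow> (\<omega>, Suc i) \<in> A" using iff[of "(\<omega>, i)"] by (simp only:)
    with Suc show ?case by simp
  qed (use that in simp)
  have "S -` ?B \<inter> space Q = ?B"
  proof -
    have "S \<omega> \<in> ?B \<longleftrightarrow> \<omega> \<in> ?B" if w: "\<omega> \<in> space Q" for \<omega>
    proof -
      have "(\<omega>, h \<omega> - 1) \<in> \<Omega>" "\<sigma> (\<omega>, h \<omega> - 1) = (S \<omega>, 0)" using w h_pos[OF w] by (auto simp: suspension_space_def suspension_map_def)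
      then have "(\<omega>, h \<omega> - 1) \<in> A \<longleftrightarrow> (S \<omega>, 0) \<in> A" using iff[of "(\<omega>, h \<omega> - 1)"] by (simp only:)
      then show ?thesis using up[OF w, of "h \<omega> - 1"] h_pos[OF w] w by simp
    qed
    then show ?thesis by auto
  qed
  then have 01: "emeasure Q ?B = 0 \<or> emeasure Q ?B = 1"
    using base B unfolding invertible_ergodic_mps_def by blast
  have A': "x \<in> A \<longleftrightarrow> fst x \<in> ?B" if "x \<in> space M" for x
  proof -
    have "fst x \<in> space Q" "snd x < h (fst x)" using that by (auto simp: space_M suspension_space_def)
    from up[OF this] show ?thesis by simp
  qed
  from 01 show ?thesis
  proof
    assume "emeasure Q ?B = 0"
    then have "AE \<omega> in Q. \<omega> \<notin> ?B" using B by (intro AE_not_in) (auto simp: null_sets_def)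
    from AE_fst[OF this] have "AE y in M. y \<notin> A"
    proof (rule AE_mp, intro AE_I2 impI)
      fix y assume "y \<in> space M" "fst y \<notin> ?B" then show "y \<notin> A" using A'[of y] by blast
    qed
    then show ?thesis using AE_iff_null_sets[OF A] by auto
  next
    assume "emeasure Q ?B = 1"
    then have "AE \<omega> in Q. \<omega> \<in> ?B" unfolding Q.AE_in_set_eq_1[OF B] Q.emeasure_eq_measure by simp
    from AE_fst[OF this] have "AE y in M. y \<in> A"
    proof (rule AE_mp, intro AE_I2 impI)
      fix y assume "y \<in> space M" "fst y \<in> ?B" then show "y \<in> A" using A'[of y] by blast
    qed
    then show ?thesis using M.AE_in_set_eq_1[OF A] by (simp add: M.emeasure_eq_measure)
  qed
qed

lemma suspension_invertible_ergodic: "invertible_ergodic_mps M \<sigma>"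
  unfolding invertible_ergodic_mps_def space_M
proof (intro conjI ballI impI)
  show "prob_space M" by (rule M.prob_space_axioms)
  show "bij_betw \<sigma> \<Omega> \<Omega>" by (rule \<sigma>_bij)
  show "\<sigma> \<in> measurable M M" by (rule \<sigma>_meas)
  show "inv_into \<Omega> \<sigma> \<in> measurable M M"
    using \<tau>_meas inv_\<sigma> by (subst measurable_cong[of _ _ \<tau>]) (auto simp: space_M)
  show "distr M M \<sigma> = M"
    by (rule measure_eqI) (auto simp: emeasure_distr \<sigma>_meas space_M \<sigma>_preserves)
qed (rule \<sigma>_ergodic)

lemma top_floor:
  shows "{x \<in> \<Omega>. \<not> snd x < h (fst x) - 1} \<in> sets M"
    and "emeasure M {x \<in> \<Omega>. \<not> snd x < h (fst x) - 1} > 0"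
proof -
  have "{x \<in> \<Omega>. \<not> snd x < h (fst x) - 1} = {x \<in> space PN. snd x < h (fst x) \<and> \<not> snd x < h (fst x) - 1}"
    by (auto simp: \<Omega>_eq)
  also have "\<dots> \<in> sets PN" by measurable
  finally show s: "{x \<in> \<Omega>. \<not> snd x < h (fst x) - 1} \<in> sets M" by (simp add: sets_M_iff)
  have "{\<omega> \<in> space Q. (\<omega>, i) \<in> {x \<in> \<Omega>. \<not> snd x < h (fst x) - 1}} = {\<omega> \<in> space Q. h \<omega> = Suc i}" for i
    by (auto simp: suspension_space_def)
  then have "emeasure M {x \<in> \<Omega>. \<not> snd x < h (fst x) - 1} = (\<Sum>i. emeasure Q {\<omega> \<in> space Q. h \<omega> = Suc i}) / E"
    unfolding emeasure_M[OF s] by simp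
  also have "(\<Sum>i. emeasure Q {\<omega> \<in> space Q. h \<omega> = Suc i}) = emeasure Q (\<Union>i. {\<omega> \<in> space Q. h \<omega> = Suc i})"
    by (rule suminf_emeasure) (auto simp: disjoint_family_on_def)
  also have "(\<Union>i. {\<omega> \<in> space Q. h \<omega> = Suc i}) = space Q"
    using h_pos gr0_implies_Suc by auto
  finally show "emeasure M {x \<in> \<Omega>. \<not> snd x < h (fst x) - 1} > 0"
    using E_fin by (simp add: Q.emeasure_space_1 ennreal_zero_less_divide)
qed

end

section \<open>A lower law of large numbers and the letter distribution\<close>

context bernoulli_shift
begin

lemma distr_coord: "distr Q M (\<lambda>\<omega>. \<omega> n) = M"
  unfolding Q_def by (rule distr_PiM_component) (auto intro: letter.prob_space_axioms)

lemma indep_coord: "Q.indep_vars (\<lambda>_. M) (\<lambda>n \<omega>. \<omega> n) UNIV"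
proof (subst Q.indep_vars_iff_distr_eq_PiM)
  have "distr Q (\<Pi>\<^sub>M i\<in>UNIV. M) (\<lambda>x. \<lambda>i\<in>UNIV. x i) = Q"
    unfolding Q_def by (simp add: restrict_UNIV)
  then show "distr Q (\<Pi>\<^sub>M i\<in>UNIV. M) (\<lambda>x. \<lambda>i\<in>UNIV. x i) = (\<Pi>\<^sub>M i\<in>UNIV. distr Q M (\<lambda>\<omega>. \<omega> i))"
    by (simp only: distr_coord) (simp add: Q_def)
qed auto

lemma expectation_coord:
  "g \<in> borel_measurable M \<Longrightarrow> (\<integral>\<omega>. g (\<omega> n) \<partial>Q) = (\<integral>x. g x \<partial>M :: real)"
  using integral_distr[OF measurable_coord, of g n] by (simp add: distr_coord)

text \<open>Hoeffding's inequality bounds the exceptional probabilities by a geometric series, and the Borel-Cantelli lemma applies.\<close>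

lemma coord_sum_lower:
  fixes g :: "nat \<Rightarrow> real"
  assumes [measurable]: "g \<in> borel_measurable M" and g: "\<And>x. 0 \<le> g x" "\<And>x. g x \<le> B"
    and \<mu>: "0 < (\<integral>x. g x \<partial>M)"
  shows "AE \<omega> in Q. eventually (\<lambda>n. real n * ((\<integral>x. g x \<partial>M) / 2) \<le> (\<Sum>k\<in>{1..n}. g (\<omega> (int k)))) sequentially"
proof -
  let ?\<mu> = "\<integral>x. g x \<partial>M"
  have B: "0 < B"
  proof (rule ccontr)
    assume "\<not> 0 < B"
    then have "g x = 0" for x using g[of x] by linarith
    then show False using \<mu> by simp
  qed
  let ?A = "\<lambda>n. {\<omega> \<in> space Q. (\<Sum>k\<in>{1..n}. g (\<omega> (int k))) \<le> n * ?\<mu> - n * (?\<mu> / 2)}"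
  have A [measurable]: "?A n \<in> sets Q" for n by measurable
  have bound: "measure Q (?A n) \<le> exp (- (?\<mu>\<^sup>2 / (2 * B\<^sup>2))) ^ n" if n: "n \<ge> 1" for n
  proof -
    have iv: "Q.indep_vars (\<lambda>_. borel) (\<lambda>k \<omega>. g (\<omega> k)) UNIV"
      by (rule Q.indep_vars_compose2[OF indep_coord]) simp
    have re: "(\<Sum>i\<in>int ` {1..n}. F i) = (\<Sum>k\<in>{1..n}. F (int k))" for F :: "int \<Rightarrow> real"
      by (simp add: sum.reindex)
    interpret H: Hoeffding_ineq Q "int ` {1..n}" "\<lambda>k \<omega>. g (\<omega> k)" "\<lambda>_. 0" "\<lambda>_. B" "\<Sum>k\<in>int ` {1..n}. Q.expectation (\<lambda>\<omega>. g (\<omega> k))"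
    proof (unfold_locales)
      show "Q.indep_vars (\<lambda>_. borel) (\<lambda>k \<omega>. g (\<omega> k)) (int ` {1..n})"
        using iv by (rule Q.indep_vars_subset) simp
    qed (use g in auto)
    have "measure Q (?A n) \<le> exp (- 2 * (n * (?\<mu> / 2))\<^sup>2 / (\<Sum>i\<in>{1..n}. (B - 0)\<^sup>2))"
      using H.Hoeffding_ineq_le[of "n * (?\<mu> / 2)"] \<mu> B n unfolding re by (simp add: expectation_coord)
    also have "- 2 * (n * (?\<mu> / 2))\<^sup>2 / (\<Sum>i\<in>{1..n}. (B - 0)\<^sup>2) = real n * - (?\<mu>\<^sup>2 / (2 * B\<^sup>2))"
      using n B by (simp add: field_simps power2_eq_square)
    also have "exp \<dots> = exp (- (?\<mu>\<^sup>2 / (2 * B\<^sup>2))) ^ n" by (rule exp_of_nat_mult)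
    finally show ?thesis .
  qed
  have "summable (\<lambda>n. exp (- (?\<mu>\<^sup>2 / (2 * B\<^sup>2))) ^ n)"
    using \<mu> B by (intro summable_geometric) simp
  then have "summable (\<lambda>n. measure Q (?A n))"
    by (rule summable_comparison_test[rotated]) (use bound in \<open>auto intro!: exI[of _ 1]\<close>)
  then have "AE \<omega> in Q. eventually (\<lambda>n. \<omega> \<in> space Q - ?A n) sequentially"
    by (intro borel_cantelli_AE1 A) (auto simp: Q.emeasure_eq_measure)
  then show ?thesis
  proof (rule AE_mp, intro AE_I2 impI)
    fix \<omega> assume "eventually (\<lambda>n. \<omega> \<in> space Q - ?A n) sequentially"
    then show "eventually (\<lambda>n. real n * (?\<mu> / 2) \<le> (\<Sum>k\<in>{1..n}. g (\<omega> (int k)))) sequentially"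
      by eventually_elim (auto simp: field_simps)
  qed
qed

text \<open>Truncation at \<open>c\<close> makes the squares bounded while keeping their mean above any prescribed value.\<close>

lemma coord_squares_superlinear:
  assumes inf: "\<And>C::real. \<exists>c. C \<le> (\<integral>n. (if n \<le> c then (real n)\<^sup>2 else 0) \<partial>M)"
    and [measurable_cong]: "sets M = sets (count_space (space M))"
  shows "AE \<omega> in Q. \<forall>C::real. eventually (\<lambda>K. C * (real K + 1) \<le> (\<Sum>k\<in>{1..<K}. (real (\<omega> (int k)))\<^sup>2)) sequentially"
proof -
  have "AE \<omega> in Q. eventually (\<lambda>K. real C * (real K + 1) \<le> (\<Sum>k\<in>{1..<K}. (real (\<omega> (int k)))\<^sup>2)) sequentially" for C :: nat
  proof -
    obtain c where c: "4 * real C + 1 \<le> (\<integral>n. (if n \<le> c then (real n)\<^sup>2 else 0) \<partial>M)" using inf by blast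
    let ?g = "\<lambda>n. if n \<le> c then (real n)\<^sup>2 else 0"
    have "AE \<omega> in Q. eventually (\<lambda>n. real n * ((\<integral>x. ?g x \<partial>M) / 2) \<le> (\<Sum>k\<in>{1..n}. ?g (\<omega> (int k)))) sequentially"
      by (rule coord_sum_lower[of _ "(real c)\<^sup>2"]) (use c in \<open>auto intro: power_mono\<close>)
    then show ?thesis
    proof eventually_elim
      case (elim \<omega>)
      then obtain n0 where n0: "\<And>n. n \<ge> n0 \<Longrightarrow> real n * ((\<integral>x. ?g x \<partial>M) / 2) \<le> (\<Sum>k\<in>{1..n}. ?g (\<omega> (int k)))"
        by (auto simp: eventually_sequentially)
      have "real C * (real K + 1) \<le> (\<Sum>k\<in>{1..<K}. (real (\<omega> (int k)))\<^sup>2)" if K: "K \<ge> n0 + 3" for K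
      proof -
        have "real C * (real K + 1) \<le> real C * (2 * real (K - 1))" using K by (intro mult_left_mono) auto
        also have "\<dots> = real (K - 1) * (4 * real C / 2)" by simp
        also have "\<dots> \<le> real (K - 1) * ((\<integral>x. ?g x \<partial>M) / 2)" using c by (intro mult_left_mono) auto
        also have "\<dots> \<le> (\<Sum>k\<in>{1..K - 1}. ?g (\<omega> (int k)))" using K by (intro n0) auto
        also have "\<dots> \<le> (\<Sum>k\<in>{1..K - 1}. (real (\<omega> (int k)))\<^sup>2)" by (rule sum_mono) simp
        also have "{1..K - 1} = {1..<K}" using K by auto
        finally show ?thesis .
      qed
      then show ?case by (auto simp: eventually_sequentially)
    qed
  qed
  then have "AE \<omega> in Q. \<forall>C::nat. eventually (\<lambda>K. real C * (real K + 1) \<le> (\<Sum>k\<in>{1..<K}. (real (\<omega> (int k)))\<^sup>2)) sequentially"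
    by (subst AE_all_countable) blast
  then show ?thesis
  proof eventually_elim
    case (elim \<omega>)
    show ?case
    proof
      fix C :: real
      obtain C' :: nat where C': "C \<le> real C'" using real_arch_simple by blast
      from elim have "eventually (\<lambda>K. real C' * (real K + 1) \<le> (\<Sum>k\<in>{1..<K}. (real (\<omega> (int k)))\<^sup>2)) sequentially" by blast
      then show "eventually (\<lambda>K. C * (real K + 1) \<le> (\<Sum>k\<in>{1..<K}. (real (\<omega> (int k)))\<^sup>2)) sequentially"
      proof eventually_elim
        case (elim K)
        have "C * (real K + 1) \<le> real C' * (real K + 1)" using C' by (intro mult_right_mono) auto
        with elim show ?case by linarith
      qed
    qed
  qed
qed

end

definition letter_prob :: "real \<Rightarrow> nat \<Rightarrow> real" where
  "letter_prob \<delta> n = (1 / (\<Sum>n. 1 / real (Suc n) powr (2 + \<delta>))) / real n powr (2 + \<delta>)"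

lemma summable_letter: "s > 1 \<Longrightarrow> summable (\<lambda>n. 1 / real (Suc n) powr s)"
proof -
  assume "s > 1"
  then have "summable (\<lambda>n. real n powr (- s))" by (simp add: summable_real_powr_iff)
  then have "summable (\<lambda>n. real (Suc n) powr (- s))" by (subst summable_Suc_iff)
  then show ?thesis by (simp add: powr_minus_divide)
qed

locale letters =
  fixes \<delta> :: real
  assumes \<delta>: "0 < \<delta>" "\<delta> \<le> 1"
begin

abbreviation "Z \<equiv> 1 / (\<Sum>n. 1 / real (Suc n) powr (2 + \<delta>))"

lemma Z_pos: "0 < Z"
proof -
  have "0 < (\<Sum>n. 1 / real (Suc n) powr (2 + \<delta>))"
    using \<delta> by (intro suminf_pos summable_letter) auto
  then show ?thesis by simp
qed

lemma letter_prob_nonneg: "0 \<le> letter_prob \<delta> n"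
  using Z_pos by (simp add: letter_prob_def)

lemma letter_eq: "letter_measure \<delta> = density (count_space {1..}) (\<lambda>n. ennreal (letter_prob \<delta> n))"
  by (simp add: letter_measure_def Let_def point_measure_def letter_prob_def)

lemma space_letter: "space (letter_measure \<delta>) = {1..}"
  by (simp add: letter_eq)

lemma sets_letter: "sets (letter_measure \<delta>) = sets (count_space (space (letter_measure \<delta>)))"
  by (simp add: letter_eq)

lemma nn_integral_letter: "(\<integral>\<^sup>+ n. f n \<partial>letter_measure \<delta>) = (\<Sum>i. ennreal (letter_prob \<delta> (Suc i)) * f (Suc i))"
proof -
  have "bij_betw Suc UNIV {1..}"
    by (rule bij_betwI[of _ _ _ "\<lambda>n. n - 1"]) auto
  then have "(\<integral>\<^sup>+ n. f n \<partial>letter_measure \<delta>) = (\<integral>\<^sup>+ i. ennreal (letter_prob \<delta> (Suc i)) * f (Suc i) \<partial>count_space UNIV)"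
    unfolding letter_eq
    by (simp add: nn_integral_density nn_integral_bij_count_space[of Suc UNIV "{1..}" "\<lambda>n. ennreal (letter_prob \<delta> n) * f n"])
  then show ?thesis by (simp add: nn_integral_count_space_nat)
qed

lemma prob_letter: "prob_space (letter_measure \<delta>)"
proof (rule prob_spaceI)
  have s: "summable (\<lambda>n. 1 / real (Suc n) powr (2 + \<delta>))" using \<delta> by (intro summable_letter) auto
  have "emeasure (letter_measure \<delta>) (space (letter_measure \<delta>)) = (\<Sum>i. ennreal (letter_prob \<delta> (Suc i)))"
    using nn_integral_letter[of "\<lambda>_. 1"] by simp
  also have "\<dots> = ennreal (\<Sum>i. letter_prob \<delta> (Suc i))"
  proof (rule suminf_ennreal2)
    show "summable (\<lambda>i. letter_prob \<delta> (Suc i))"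
      using summable_mult[OF s, of Z] by (simp add: letter_prob_def)
  qed (rule letter_prob_nonneg)
  also have "(\<Sum>i. letter_prob \<delta> (Suc i)) = Z * (\<Sum>n. 1 / real (Suc n) powr (2 + \<delta>))"
    by (subst suminf_mult[OF s, symmetric]) (simp add: letter_prob_def)
  also have "\<dots> = 1" using Z_pos by auto
  finally show "emeasure (letter_measure \<delta>) (space (letter_measure \<delta>)) = 1" by simp
qed

sublocale B: bernoulli_shift "letter_measure \<delta>"
  using prob_letter by (simp add: bernoulli_shift_def)

lemma Q_eq: "B.Q = bernoulli_measure \<delta>"
  by (simp add: B.Q_def bernoulli_measure_def)

text \<open>The mean is \<open>Z\<close> times the convergent series of \<open>1 / n powr (1 + \<delta>)\<close>.\<close>

lemma letter_mean: "(\<integral>\<^sup>+ n. of_nat n \<partial>letter_measure \<delta>) < \<infinity>"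
proof -
  have s: "summable (\<lambda>n. 1 / real (Suc n) powr (1 + \<delta>))" using \<delta> by (intro summable_letter) auto
  have eq: "letter_prob \<delta> (Suc i) * real (Suc i) = Z * (1 / real (Suc i) powr (1 + \<delta>))" for i
  proof -
    have "real (Suc i) powr (2 + \<delta>) = real (Suc i) powr (1 + \<delta>) * real (Suc i)"
      using powr_add[of "real (Suc i)" "1 + \<delta>" 1] by (simp add: algebra_simps)
    then show ?thesis by (simp add: letter_prob_def)
  qed
  have "(\<integral>\<^sup>+ n. of_nat n \<partial>letter_measure \<delta>) = (\<Sum>i. ennreal (letter_prob \<delta> (Suc i)) * ennreal (real (Suc i)))"
    unfolding nn_integral_letter by (simp add: ennreal_of_nat_eq_real_of_nat)
  also have "\<dots> = (\<Sum>i. ennreal (Z * (1 / real (Suc i) powr (1 + \<delta>))))"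
    by (intro suminf_cong) (simp only: ennreal_mult[OF letter_prob_nonneg, symmetric] of_nat_0_le_iff eq)
  also have "\<dots> = ennreal (\<Sum>i. Z * (1 / real (Suc i) powr (1 + \<delta>)))"
    by (rule suminf_ennreal2) (use summable_mult[OF s, of Z] Z_pos in auto)
  finally show ?thesis by simp
qed

text \<open>Since \<open>\<delta> \<le> 1\<close>, the terms \<open>n\<^sup>2 / n powr (2 + \<delta>)\<close> dominate the harmonic series.\<close>

lemma letter_second_moment: "\<exists>c. C \<le> (\<integral>n. (if n \<le> c then (real n)\<^sup>2 else 0) \<partial>letter_measure \<delta>)"
proof -
  obtain c where c: "C / Z \<le> (\<Sum>i<c. 1 / real (Suc i))"
  proof -
    have "\<not> summable (\<lambda>i. 1 / real (Suc i))"
    proof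
      assume "summable (\<lambda>i. 1 / real (Suc i))"
      then have "summable (\<lambda>n. 1 / real n)" by (subst (asm) summable_Suc_iff[of "\<lambda>n. 1 / real n"])
      then show False using not_summable_harmonic[where 'a = real] by (simp add: inverse_eq_divide)
    qed
    then have "\<not> bounded_above" if "bounded_above = (\<exists>b. \<forall>c. (\<Sum>i<c. 1 / real (Suc i)) \<le> b)" for bounded_above
      using that by (auto intro!: summableI_nonneg_bounded)
    then show ?thesis using that by (meson less_imp_le not_le)
  qed
  let ?g = "\<lambda>n. if n \<le> c then (real n)\<^sup>2 else 0"
  have g: "?g \<in> borel_measurable (letter_measure \<delta>)"
    using sets_letter by (simp add: measurable_cong_sets[OF sets_letter refl])
  have int: "integrable (letter_measure \<delta>) ?g"
    by (rule B.letter.integrable_const_bound[of _ "(real c)\<^sup>2"]) (use g in \<open>auto intro: power_mono\<close>)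
  have "C \<le> (\<Sum>i<c. 1 / real (Suc i)) * Z" using c unfolding pos_divide_le_eq[OF Z_pos] .
  also have "\<dots> = (\<Sum>i<c. Z * (1 / real (Suc i)))" unfolding sum_distrib_right by (simp only: mult.commute)
  finally have "ennreal C \<le> ennreal (\<Sum>i<c. Z * (1 / real (Suc i)))" by (rule ennreal_leI)
  also have "ennreal (\<Sum>i<c. Z * (1 / real (Suc i))) = (\<Sum>i<c. ennreal (Z * (1 / real (Suc i))))"
    using Z_pos by (subst sum_ennreal) auto
  also have "\<dots> \<le> (\<Sum>i<c. ennreal (letter_prob \<delta> (Suc i)) * ennreal (?g (Suc i)))"
  proof (rule sum_mono)
    fix i assume i: "i \<in> {..<c}"
    have "real (Suc i) powr (2 + \<delta>) \<le> real (Suc i) powr 3" using \<delta> by (intro powr_mono) auto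
    also have "\<dots> = real (Suc i) * (real (Suc i))\<^sup>2" by (simp add: powr_realpow[of "real (Suc i)" 3, simplified] power3_eq_cube power2_eq_square)
    finally have "1 / real (Suc i) \<le> (real (Suc i))\<^sup>2 / real (Suc i) powr (2 + \<delta>)"
      by (simp add: field_simps)
    then have "Z * (1 / real (Suc i)) \<le> Z * ((real (Suc i))\<^sup>2 / real (Suc i) powr (2 + \<delta>))"
      using Z_pos by (intro mult_left_mono) auto
    also have "\<dots> = letter_prob \<delta> (Suc i) * ?g (Suc i)" using i by (simp add: letter_prob_def)
    finally show "ennreal (Z * (1 / real (Suc i))) \<le> ennreal (letter_prob \<delta> (Suc i)) * ennreal (?g (Suc i))"
      unfolding ennreal_mult'[OF letter_prob_nonneg, symmetric] by (rule ennreal_leI)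
  qed
  also have "\<dots> \<le> (\<Sum>i. ennreal (letter_prob \<delta> (Suc i)) * ennreal (?g (Suc i)))"
    by (rule sum_le_suminf) auto
  also have "\<dots> = (\<integral>\<^sup>+ n. ennreal (?g n) \<partial>letter_measure \<delta>)" by (simp only: nn_integral_letter)
  also have "\<dots> = ennreal (\<integral>n. ?g n \<partial>letter_measure \<delta>)" by (rule nn_integral_eq_integral[OF int]) simp
  finally have "C \<le> (\<integral>n. ?g n \<partial>letter_measure \<delta>)"
    by (subst (asm) ennreal_le_iff) (auto intro!: integral_nonneg_AE)
  then show ?thesis by blast
qed

lemma roof_measurable: "roof \<in> measurable B.Q (count_space UNIV)"
proof -
  have "(\<lambda>\<omega>. \<omega> 0) \<in> measurable B.Q (letter_measure \<delta>)" by (rule B.measurable_coord)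
  moreover have "(\<lambda>x. x) \<in> measurable (letter_measure \<delta>) (count_space UNIV)"
    by (simp add: measurable_cong_sets[OF sets_letter refl])
  ultimately show ?thesis unfolding roof_def[abs_def] by (rule measurable_compose)
qed

sublocale S: suspension B.Q shift roof
proof
  show "invertible_ergodic_mps B.Q shift" by (rule B.shift_invertible_ergodic)
  show "roof \<in> measurable B.Q (count_space UNIV)" by (rule roof_measurable)
  show "0 < roof \<omega>" if "\<omega> \<in> space B.Q" for \<omega> 
  proof -
    have "\<omega> 0 \<in> {1..}" using that unfolding B.space_Q space_letter by blast
    then show ?thesis by (simp add: roof_def)
  qed
  have "(\<integral>\<^sup>+ \<omega>. of_nat (roof \<omega>) \<partial>B.Q) = (\<integral>\<^sup>+ n. of_nat n \<partial>distr B.Q (letter_measure \<delta>) (\<lambda>\<omega>. \<omega> 0))"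
    unfolding roof_def by (subst nn_integral_distr) (auto simp: measurable_cong_sets[OF sets_letter refl])
  then show "(\<integral>\<^sup>+ \<omega>. of_nat (roof \<omega>) \<partial>B.Q) < \<infinity>"
    using letter_mean by (simp add: B.distr_coord)
qed

lemma M_eq: "S.M = base_measure \<delta>"
  by (subst S.M_def) (simp only: Q_eq)

end

section \<open>Topology and Borel structure of the suspension space\<close>

lemma base_space_polish:
  "completely_metrizable_space (euclidean :: ((int \<Rightarrow> nat) \<times> nat) topology)"
  "separable_space (euclidean :: ((int \<Rightarrow> nat) \<times> nat) topology)"
proof -
  have nat: "(euclidean :: nat topology) = discrete_topology UNIV"
    by (simp add: topology_eq discrete_topology_class.open_discrete)
  have c: "completely_metrizable_space (euclidean :: nat topology)"
    unfolding nat by (rule completely_metrizable_space_discrete_topology)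
  have "completely_metrizable_space (product_topology (\<lambda>_::int. euclidean :: nat topology) UNIV)"
    unfolding completely_metrizable_space_product_topology using c by (auto intro: countableI_type)
  then have "completely_metrizable_space (euclidean :: (int \<Rightarrow> nat) topology)"
    by (simp only: euclidean_product_topology)
  then have "completely_metrizable_space (prod_topology (euclidean :: (int \<Rightarrow> nat) topology) (euclidean :: nat topology))"
    unfolding completely_metrizable_space_prod_topology using c by blast
  then show "completely_metrizable_space (euclidean :: ((int \<Rightarrow> nat) \<times> nat) topology)"
    by (simp only: prod_topology_euclidean)
  obtain D :: "((int \<Rightarrow> nat) \<times> nat) set" where D: "countable D" "\<And>X. open X \<Longrightarrow> X \<noteq> {} \<Longrightarrow> \<exists>d\<in>D. d \<in> X"
    using countable_dense_setE by blast
  have "closure D = UNIV"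
  proof (rule ccontr)
    assume "closure D \<noteq> UNIV"
    then have "\<exists>d\<in>D. d \<in> - closure D" by (intro D(2)) auto
    then show False using closure_subset by blast
  qed
  then show "separable_space (euclidean :: ((int \<Rightarrow> nat) \<times> nat) topology)"
    unfolding separable_space_def using D(1) by auto
qed

text \<open>A condition on two discrete coordinates cuts out a clopen set; hence the pieces of the suspension map are clopen.\<close>

lemma open_pred2:
  fixes f g :: "'a::topological_space \<Rightarrow> 'b::discrete_topology"
  assumes "continuous_on UNIV f" "continuous_on UNIV g" shows "open {x. P (f x) (g x)}"
proof -
  have "{x. P (f x) (g x)} = (\<Union>(a, b)\<in>{(a, b). P a b}. (f -` {a}) \<inter> (g -` {b}))" by auto
  moreover have "open (f -` {a})" "open (g -` {b})" for a b
    using assms by (auto intro!: open_vimage discrete_topology_class.open_discrete)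
  ultimately show ?thesis by (simp only:) (intro open_UN ballI, auto intro: open_Int)
qed

lemma continuous_on_discrete_comp:
  fixes f :: "'a::topological_space \<Rightarrow> 'b::discrete_topology" and q :: "'b \<Rightarrow> 'c::topological_space"
  assumes "continuous_on UNIV f" shows "continuous_on UNIV (\<lambda>x. q (f x))"
proof -
  have "continuous_on UNIV q" unfolding continuous_on_open_vimage[OF open_UNIV] by (simp add: discrete_topology_class.open_discrete)
  from continuous_on_compose2[OF this assms] show ?thesis by simp
qed

lemma continuous_on_If_clopen:
  fixes f g :: "'a::topological_space \<Rightarrow> 'b::topological_space"
  assumes "open {x. P x}" "open {x. \<not> P x}" "continuous_on UNIV f" "continuous_on UNIV g"
  shows "continuous_on UNIV (\<lambda>x. if P x then f x else g x)"
proof -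
  have "continuous_on ({x. P x} \<union> {x. \<not> P x}) (\<lambda>x. if P x then f x else g x)"
    using assms by (intro continuous_on_If) (auto simp: closed_def Compl_eq intro: continuous_on_subset)
  moreover have "{x. P x} \<union> {x. \<not> P x} = UNIV" by auto
  ultimately show ?thesis by simp
qed

lemma continuous_coord_fst: "continuous_on UNIV (\<lambda>x::(int \<Rightarrow> nat) \<times> nat. fst x n)"
  by (rule continuous_on_compose2[OF continuous_on_product_coordinates continuous_on_fst[OF continuous_on_id]]) auto

context letters
begin

lemma space_Q: "space B.Q = {\<omega>. \<forall>n. 1 \<le> \<omega> n}"
  unfolding B.space_Q space_letter by auto

lemma continuous_base_map: "continuous_on UNIV base_map"
proof -
  have 1: "continuous_on UNIV (\<lambda>x::(int \<Rightarrow> nat) \<times> nat. snd x)" by (intro continuous_intros)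
  have "continuous_on UNIV (\<lambda>x::(int \<Rightarrow> nat) \<times> nat. if snd x < fst x 0 - 1 then (fst x, snd x + 1) else (shift (fst x), 0))"
    unfolding shift_def
    by (intro continuous_on_If_clopen open_pred2[where P = "\<lambda>a b. a < b - 1"] open_pred2[where P = "\<lambda>a b. \<not> a < b - 1"] 1 continuous_coord_fst
      continuous_on_Pair continuous_on_discrete_comp[OF 1, of "\<lambda>a. a + 1"] continuous_on_coordinatewise_then_product continuous_intros)
  then show ?thesis by (simp add: suspension_map_def roof_def case_prod_beta')
qed

text \<open>The inverse of the suspension map in a form that is continuous on the whole ambient space; on the suspension space it agrees with \<open>S.\<tau>\<close>, which refers to an abstract inverse of the shift.\<close>

definition inv_map :: "(int \<Rightarrow> nat) \<times> nat \<Rightarrow> (int \<Rightarrow> nat) \<times> nat" where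
  "inv_map x = (if 0 < snd x then (fst x, snd x - 1) else (B.shiftn (- 1) (fst x), fst x (- 1) - 1))"

lemma continuous_inv_map: "continuous_on UNIV inv_map"
proof -
  have 1: "continuous_on UNIV (\<lambda>x::(int \<Rightarrow> nat) \<times> nat. snd x)" by (intro continuous_intros)
  show ?thesis
    unfolding inv_map_def[abs_def] B.shiftn_def
    by (intro continuous_on_If_clopen open_pred2[where P = "\<lambda>a b. 0 < a", OF 1 1] open_pred2[where P = "\<lambda>a b. \<not> 0 < a", OF 1 1] continuous_coord_fst
      continuous_on_Pair continuous_on_discrete_comp[OF 1, of "\<lambda>a. a - 1"] continuous_on_discrete_comp[OF continuous_coord_fst, of "\<lambda>a. a - 1"]
      continuous_on_coordinatewise_then_product continuous_intros)
qed

lemma inv_map_eq: "x \<in> S.\<Omega> \<Longrightarrow> inv_map x = S.\<tau> x"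
  by (cases x) (auto simp: inv_map_def S.\<tau>_def S.S'_def B.inv_shift suspension_space_def roof_def B.shiftn_def)

lemma homeomorphism_base_map: "homeomorphism S.\<Omega> S.\<Omega> base_map inv_map"
  unfolding homeomorphism_def
proof (intro conjI ballI)
  show "base_map ` S.\<Omega> = S.\<Omega>" using S.\<sigma>_bij by (simp add: bij_betw_def)
  show "inv_map ` S.\<Omega> = S.\<Omega>"
  proof (intro equalityI subsetI)
    fix x assume "x \<in> S.\<Omega>"
    then have "x = inv_map (base_map x)" "base_map x \<in> S.\<Omega>"
      using S.\<tau>_\<sigma> S.\<sigma>_space inv_map_eq by auto
    then show "x \<in> inv_map ` S.\<Omega>" by blast
  qed (use S.\<tau>_space inv_map_eq in auto)
  show "continuous_on S.\<Omega> base_map" "continuous_on S.\<Omega> inv_map"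
    using continuous_base_map continuous_inv_map continuous_on_subset by blast+
qed (use S.\<tau>_\<sigma> S.\<sigma>_\<tau> S.\<sigma>_space inv_map_eq in auto)

lemma space_Q_borel: "space B.Q \<in> sets borel"
proof -
  have "{\<omega> :: int \<Rightarrow> nat. 1 \<le> \<omega> n} \<in> sets borel" for n
  proof -
    have "open ((\<lambda>\<omega>::int \<Rightarrow> nat. \<omega> n) -` {1..})"
      by (intro open_vimage discrete_topology_class.open_discrete continuous_on_product_coordinates)
    moreover have "(\<lambda>\<omega>::int \<Rightarrow> nat. \<omega> n) -` {1..} = {\<omega>. 1 \<le> \<omega> n}" by auto
    ultimately show ?thesis by (intro borel_open) (simp only:)
  qed
  then have "(\<Inter>n::int. {\<omega>. (1::nat) \<le> \<omega> n}) \<in> sets borel" by (intro sets.countable_INT) auto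
  also have "(\<Inter>n::int. {\<omega>. (1::nat) \<le> \<omega> n}) = space B.Q" by (auto simp: space_Q)
  finally show ?thesis .
qed

text \<open>The letter measure lives on \<open>{1..}\<close>, so the product \<open>\<sigma>\<close>-algebra is a trace of the Borel one; both inclusions express measurability of the identity.\<close>

lemma sets_Q_borel: "sets B.Q = sets (restrict_space borel (space B.Q))"
proof (intro equalityI subsetI)
  have sp: "space (restrict_space borel (space B.Q)) = space B.Q" by (simp add: space_restrict_space)
  fix A assume A: "A \<in> sets B.Q"
  have "(\<lambda>x. x) \<in> measurable (restrict_space borel (space B.Q)) (\<Pi>\<^sub>M n\<in>UNIV. letter_measure \<delta>)"
  proof (rule measurable_PiM_single')
    fix n :: int
    have "(\<lambda>x. x n) \<in> measurable (restrict_space borel (space B.Q)) (borel :: nat measure)"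
      by (intro measurable_restrict_space1 borel_measurable_continuous_onI) simp
    moreover have "X \<in> sets (borel :: nat measure)" for X by (simp add: sets_borel_eq_count_space)
    ultimately have "(\<lambda>x. x n) -` X \<inter> space B.Q \<in> sets (restrict_space borel (space B.Q))" for X
      using measurable_sets[of "\<lambda>x. x n" "restrict_space borel (space B.Q)" borel X] by (simp only: sp)
    then show "(\<lambda>x. x n) \<in> measurable (restrict_space borel (space B.Q)) (letter_measure \<delta>)"
      by (intro measurableI) (simp_all only: sp, auto simp: B.space_Q)
  qed (simp_all only: sp, auto simp: B.space_Q)
  from measurable_sets[OF this, of A] A show "A \<in> sets (restrict_space borel (space B.Q))"
    using sets.sets_into_space[OF A] by (simp add: sp B.Q_def[symmetric] Int_absorb2)
next
  fix A assume "A \<in> sets (restrict_space borel (space B.Q))"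
  then obtain X where X: "X \<in> sets borel" "A = X \<inter> space B.Q" by (auto simp: sets_restrict_space)
  have "(\<lambda>x. x) \<in> measurable B.Q (\<Pi>\<^sub>M n\<in>UNIV. (borel :: nat measure))"
  proof (rule measurable_PiM_single')
    fix n :: int
    have "(\<lambda>x. x) \<in> measurable (letter_measure \<delta>) (borel :: nat measure)"
      by (simp add: measurable_cong_sets[OF sets_letter refl])
    with B.measurable_coord[of n] show "(\<lambda>x. x n) \<in> measurable B.Q (borel :: nat measure)" by (rule measurable_compose)
  qed auto
  from measurable_sets[OF this, of X] X show "A \<in> sets B.Q" by (simp add: sets_PiM_equal_borel)
qed

lemma \<Omega>_borel: "S.\<Omega> \<in> sets borel"
proof -
  have "open {x::(int \<Rightarrow> nat) \<times> nat. snd x < fst x 0}"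
    by (intro open_pred2[where P = "\<lambda>a b. a < b"] continuous_coord_fst continuous_intros)
  moreover have "fst -` space B.Q \<in> sets (borel :: ((int \<Rightarrow> nat) \<times> nat) measure)"
    using measurable_sets[OF borel_measurable_continuous_onI[of fst] space_Q_borel]
    by (simp add: continuous_on_fst)
  moreover have "S.\<Omega> = {x. snd x < fst x 0} \<inter> fst -` space B.Q"
    by (auto simp: suspension_space_def roof_def)
  ultimately show ?thesis by auto
qed

lemma sets_M_borel: "sets S.M = sets (restrict_space borel S.\<Omega>)"
proof (intro equalityI subsetI)
  have sp: "space (restrict_space borel S.\<Omega>) = S.\<Omega>" by (simp add: space_restrict_space)
  fix A assume A: "A \<in> sets S.M"
  have "(\<lambda>x. (fst x, snd x)) \<in> measurable (restrict_space borel S.\<Omega>) S.PN"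
  proof (rule measurable_Pair)
    have "fst \<in> measurable (restrict_space borel S.\<Omega>) (restrict_space borel (space B.Q))"
      by (intro measurable_restrict_space3 borel_measurable_continuous_onI) (auto intro: continuous_intros simp: suspension_space_def)
    then show "fst \<in> measurable (restrict_space borel S.\<Omega>) B.Q"
      using measurable_cong_sets[OF refl sets_Q_borel] by blast
    have "snd \<in> measurable (restrict_space borel S.\<Omega>) (borel :: nat measure)"
      by (intro measurable_restrict_space1 borel_measurable_continuous_onI) (auto intro: continuous_intros)
    then show "snd \<in> measurable (restrict_space borel S.\<Omega>) (count_space UNIV)"
      using measurable_cong_sets[OF refl sets_borel_eq_count_space] by blast
  qed
  from measurable_sets[OF this, of A] A show "A \<in> sets (restrict_space borel S.\<Omega>)"
    by (simp add: S.sets_M_iff sp Int_absorb2)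
next
  fix A assume "A \<in> sets (restrict_space borel S.\<Omega>)"
  then obtain X where X: "X \<in> sets borel" "A = X \<inter> S.\<Omega>" by (auto simp: sets_restrict_space)
  have id: "(\<lambda>x. x) \<in> measurable B.Q borel"
  proof (rule measurableI)
    fix Y :: "(int \<Rightarrow> nat) set" assume "Y \<in> sets borel"
    then have "Y \<inter> space B.Q \<in> sets (restrict_space borel (space B.Q))" by (auto simp: sets_restrict_space)
    then show "(\<lambda>x. x) -` Y \<inter> space B.Q \<in> sets B.Q" by (simp add: sets_Q_borel)
  qed simp
  have "(\<lambda>x. (fst x, snd x)) \<in> measurable S.PN (borel \<Otimes>\<^sub>M borel)"
    using measurable_compose[OF measurable_fst id, of "count_space UNIV"] by (intro measurable_Pair S.snd_borel) simp
  then have "(\<lambda>x. x) \<in> measurable S.PN borel" by (simp add: borel_prod)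
  from measurable_sets[OF this X(1)] have "X \<inter> space S.PN \<in> sets S.PN" by simp
  then have "X \<inter> space S.PN \<inter> S.\<Omega> \<in> sets S.PN" using S.\<Omega>_sets by blast
  moreover have "X \<inter> space S.PN \<inter> S.\<Omega> = A" using X by (auto simp: S.\<Omega>_eq)
  ultimately show "A \<in> sets S.M" using X by (simp add: S.sets_M_iff)
qed

end

section \<open>The random cocycle\<close>

definition at_top_floor :: "(int \<Rightarrow> nat) \<times> nat \<Rightarrow> bool" where
  "at_top_floor y \<longleftrightarrow> \<not> snd y < roof (fst y) - 1"

interpretation F: two_map_cocycle base_map at_top_floor fibre_map
  by unfold_locales (auto simp: fibre_map_def at_top_floor_def case_prod_beta')

context letters
begin

lemma at_top_floor_sets: "{x \<in> space S.M. at_top_floor x} \<in> sets S.M"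
  unfolding at_top_floor_def S.space_M by (rule S.top_floor)

lemma at_top_floor_meas [measurable]: "Measurable.pred S.M at_top_floor"
  using at_top_floor_sets by (simp add: pred_def)

lemma BV_integrable: "f \<in> BV \<Longrightarrow> integrable leb01 f"
  by (simp add: BV_def)

lemma ess_var_fibre:
  "integrable leb01 f \<Longrightarrow> ess_var (transfer_op (fibre_map y) f) \<le> ennreal (if at_top_floor y then 1 / 2 else 1) * ess_var f"
  using ess_var_T0[of f] ess_var_T1[of f] by (simp add: F.T_def)

lemma L1_norm_fibre: "integrable leb01 f \<Longrightarrow> L1_norm (transfer_op (fibre_map y) f) \<le> L1_norm f"
  by (simp add: F.T_def D0.L1_norm_transfer_op D1.L1_norm_transfer_op)

lemma BV_norm_fibre:
  assumes "f \<in> BV" shows "BV_norm (transfer_op (fibre_map y) f) \<le> BV_norm f"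
proof -
  have i: "integrable leb01 f" using assms by (rule BV_integrable)
  have "ess_var (transfer_op (fibre_map y) f) \<le> ennreal (if at_top_floor y then 1 / 2 else 1) * ess_var f"
    by (rule ess_var_fibre[OF i])
  also have "\<dots> \<le> 1 * ess_var f" by (intro mult_right_mono) (auto simp: ennreal_le_1)
  finally show ?thesis unfolding BV_norm_def using L1_norm_fibre[OF i] by (intro add_mono) simp_all
qed

text \<open>The operator takes only two values, so the space splits into two pieces on which it is constant.\<close>

lemma good_regular_base: "good_regular S.M base_map (\<lambda>y. transfer_op (fibre_map y))"
  unfolding good_regular_def S.space_M
proof (intro conjI ballI)
  show "S.\<Omega> \<in> sets borel" by (rule \<Omega>_borel)
  show "sets S.M = sets (restrict_space borel S.\<Omega>)" by (rule sets_M_borel)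
  show "\<exists>\<tau>. homeomorphism S.\<Omega> S.\<Omega> base_map \<tau>" using homeomorphism_base_map by blast
  show "BV_opnorm (transfer_op (fibre_map y)) < \<infinity>" for y
  proof -
    have "BV_opnorm (transfer_op (fibre_map y)) \<le> 1"
      unfolding BV_opnorm_def by (rule SUP_least) (use BV_norm_fibre order_trans in blast)
    also have "\<dots> < \<infinity>" by simp
    finally show ?thesis .
  qed
  let ?U = "\<lambda>k::nat. if k = 0 then {x \<in> space S.M. at_top_floor x} else {x \<in> space S.M. \<not> at_top_floor x}"
  have zero: "BV_norm (\<lambda>x. 0) = 0"
  proof -
    have "lvar (\<lambda>x. 0) ts = 0" for ts by (induction ts rule: induct_list012) auto
    then have "total_var (\<lambda>x. 0) \<le> 0" by (intro total_var_leI) simp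
    moreover have "ess_var (\<lambda>x. 0) \<le> total_var (\<lambda>x. 0)" by (rule ess_var_le) simp
    ultimately show ?thesis by (simp add: BV_norm_def L1_norm_def)
  qed
  show "\<exists>U :: nat \<Rightarrow> _. (\<forall>k. U k \<in> sets S.M) \<and> (\<Union>k. U k) = S.\<Omega> \<and>
        (\<forall>k. \<forall>y\<in>U k. ((\<lambda>z. BV_opnorm (\<lambda>f x. transfer_op (fibre_map z) f x - transfer_op (fibre_map y) f x)) \<longlongrightarrow> 0) (at y within U k))"
  proof (intro exI[of _ ?U] conjI allI ballI)
    show "?U k \<in> sets S.M" for k
      using at_top_floor_meas by (auto simp: pred_def)
    show "(\<Union>k. ?U k) = S.\<Omega>" by (auto simp: S.space_M split: if_splits)
    fix k y assume y: "y \<in> ?U k"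
    have "BV_opnorm (\<lambda>f x. transfer_op (fibre_map z) f x - transfer_op (fibre_map y) f x) = 0" if "z \<in> ?U k" for z
    proof -
      have "fibre_map z = fibre_map y" using y that by (auto simp: F.T_def split: if_splits)
      moreover have "BV_opnorm (\<lambda>f x. 0) \<le> 0" unfolding BV_opnorm_def by (rule SUP_least) (simp add: zero)
      ultimately show ?thesis by simp
    qed
    then show "((\<lambda>z. BV_opnorm (\<lambda>f x. transfer_op (fibre_map z) f x - transfer_op (fibre_map y) f x)) \<longlongrightarrow> 0) (at y within ?U k)"
      by (intro tendsto_eventually) (auto simp: eventually_at_filter)
  qed
qed (rule base_space_polish)+

lemma good_bounded_base: "good_bounded S.M (\<lambda>y. transfer_op (fibre_map y))"
  unfolding good_bounded_def by (rule exI[of _ "\<lambda>_. 1"]) (auto intro: BV_norm_fibre)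

text \<open>One step suffices, with the constant factor \<open>K = 1\<close>; the logarithm of \<open>\<alpha>\<close> vanishes off the top floor and equals \<open>- ln 2\<close> on it.\<close>

lemma good_lasota_yorke_base: "good_lasota_yorke S.M base_map (\<lambda>y. transfer_op (fibre_map y))"
  unfolding good_lasota_yorke_def
proof (rule exI[of _ 1], intro conjI, simp, rule bexI[of _ "\<lambda>y. if at_top_floor y then 1 / 2 else 1"], rule bexI[of _ "\<lambda>_. 1"], intro conjI)
  let ?\<alpha> = "\<lambda>y. if at_top_floor y then 1 / 2 else 1 :: real"
  show \<alpha>: "?\<alpha> \<in> borel_measurable S.M" by measurable
  have ln: "ln (?\<alpha> y) = - ln 2 * indicator {x \<in> space S.M. at_top_floor x} y" if "y \<in> space S.M" for y
    using that by (simp add: indicator_def ln_div)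
  show "integrable S.M (\<lambda>y. ln (?\<alpha> y))"
    by (rule S.M.integrable_const_bound[of _ "ln 2"]) (auto simp: ln_div)
  have "(\<integral>y. ln (?\<alpha> y) \<partial>S.M) = (\<integral>y. - ln 2 * indicator {x \<in> space S.M. at_top_floor x} y \<partial>S.M)"
    by (rule Bochner_Integration.integral_cong) (use ln in auto)
  also have "\<dots> = - ln 2 * S.M.prob {x \<in> space S.M. at_top_floor x}" using at_top_floor_sets by simp
  also have "\<dots> < 0"
    using S.top_floor(2) unfolding at_top_floor_def S.space_M
    by (simp add: S.M.emeasure_eq_measure ennreal_less_zero_iff)
  finally show "(\<integral>y. ln (?\<alpha> y) \<partial>S.M) < 0" .
  show "AE y in S.M. \<forall>f\<in>BV. ess_var (cocycle base_map (\<lambda>y. transfer_op (fibre_map y)) 1 y f) \<le> ennreal (?\<alpha> y) * ess_var f + ennreal 1 * L1_norm f"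
  proof (intro AE_I2 ballI)
    fix y f assume "f \<in> BV"
    then have i: "integrable leb01 f" by (rule BV_integrable)
    have "cocycle base_map (\<lambda>y. transfer_op (fibre_map y)) 1 y f = transfer_op (fibre_map y) f" by simp
    then show "ess_var (cocycle base_map (\<lambda>y. transfer_op (fibre_map y)) 1 y f) \<le> ennreal (?\<alpha> y) * ess_var f + ennreal 1 * L1_norm f"
      using ess_var_fibre[OF i, of y] by (simp only:) (rule add_increasing2, simp)
  qed
qed auto

lemma orbit_climb: "(\<omega>, i) \<in> S.\<Omega> \<Longrightarrow> i + l < roof \<omega> \<Longrightarrow> (base_map ^^ l) (\<omega>, i) = (\<omega>, i + l)"
  by (induction l) (auto simp: suspension_map_def)

lemma orbit_space: "y \<in> S.\<Omega> \<Longrightarrow> (base_map ^^ n) y \<in> S.\<Omega>"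
  by (induction n) (auto simp: S.\<sigma>_space)

lemma block_climb: "(\<omega>, i) \<in> S.\<Omega> \<Longrightarrow> i + l < roof \<omega> \<Longrightarrow> F.block (\<omega>, i) l = 0"
  unfolding F.block_eq_0_iff by (auto simp: orbit_climb at_top_floor_def)

lemma block_return:
  assumes "(\<omega>, i) \<in> S.\<Omega>"
  shows "(base_map ^^ (roof \<omega> - i)) (\<omega>, i) = (shift \<omega>, 0)" "F.block (\<omega>, i) (roof \<omega> - i) = 1"
proof -
  define l where "l = roof \<omega> - i - 1"
  have i: "i < roof \<omega>" using assms by (simp add: suspension_space_def)
  then have l: "roof \<omega> - i = l + 1" "i + l = roof \<omega> - 1" "i + l < roof \<omega>" by (auto simp: l_def)
  show "(base_map ^^ (roof \<omega> - i)) (\<omega>, i) = (shift \<omega>, 0)"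
    unfolding l(1) using orbit_climb[OF assms l(3)] l(2) by (simp add: suspension_map_def)
  have "{j. j < 1 \<and> at_top_floor ((base_map ^^ j) (\<omega>, i + l))} = {0}" using l(2) by (auto simp: at_top_floor_def)
  then have "F.block (\<omega>, i + l) 1 = 1" unfolding F.block_def by simp
  then show "F.block (\<omega>, i) (roof \<omega> - i) = 1"
    unfolding l(1) F.block_add using orbit_climb[OF assms l(3)] block_climb[OF assms l(3)] by simp
qed

lemma shiftn_shift: "shift (B.shiftn (int k) \<omega>) = B.shiftn (int (Suc k)) \<omega>"
  by (simp add: shift_def B.shiftn_def algebra_simps)

text \<open>Block \<open>Suc k\<close> starts when the orbit reaches the ground floor over the \<open>Suc k\<close>-th shift of \<open>\<omega>\<close>. Block \<open>0\<close> is excluded: it starts at height \<open>i\<close> and is in general incomplete.\<close>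

lemma block_start:
  assumes y: "(\<omega>, i) \<in> S.\<Omega>"
  shows "\<exists>t. (base_map ^^ t) (\<omega>, i) = (B.shiftn (int (Suc k)) \<omega>, 0) \<and> F.block (\<omega>, i) t = Suc k"
proof (induction k)
  case 0
  have "shift \<omega> = B.shiftn (int (Suc 0)) \<omega>" using B.shift_eq by simp
  then show ?case using block_return[OF y] by (intro exI[of _ "roof \<omega> - i"]) simp
next
  case (Suc k)
  then obtain t where t: "(base_map ^^ t) (\<omega>, i) = (B.shiftn (int (Suc k)) \<omega>, 0)" "F.block (\<omega>, i) t = Suc k" by blast
  let ?w = "B.shiftn (int (Suc k)) \<omega>"
  have w: "(?w, 0) \<in> S.\<Omega>" using orbit_space[OF y, of t] t by simp
  have "(base_map ^^ (roof ?w + t)) (\<omega>, i) = (base_map ^^ roof ?w) ((base_map ^^ t) (\<omega>, i))"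
    by (simp add: funpow_add)
  then have "(base_map ^^ (t + roof ?w)) (\<omega>, i) = (B.shiftn (int (Suc (Suc k))) \<omega>, 0)"
    using block_return(1)[OF w] t(1) unfolding shiftn_shift[of "Suc k"] by (simp only: add.commute diff_zero)
  moreover have "F.block (\<omega>, i) (t + roof ?w) = Suc (Suc k)"
    using block_return(2)[OF w] t by (simp add: F.block_add)
  ultimately show ?case by blast
qed

lemma block_full:
  assumes y: "(\<omega>, i) \<in> S.\<Omega>" and k: "1 \<le> k"
  shows "\<exists>t. \<forall>l<\<omega> (int k). F.block (\<omega>, i) (t + l) = k"
proof -
  obtain k' where k': "k = Suc k'" using k by (cases k) auto
  obtain t where t: "(base_map ^^ t) (\<omega>, i) = (B.shiftn (int k) \<omega>, 0)" "F.block (\<omega>, i) t = k"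
    using block_start[OF y, of k'] k' by blast
  have w: "(B.shiftn (int k) \<omega>, 0) \<in> S.\<Omega>" using orbit_space[OF y, of t] t by simp
  have "roof (B.shiftn (int k) \<omega>) = \<omega> (int k)" by (simp add: roof_def B.shiftn_def)
  then have "F.block (\<omega>, i) (t + l) = k" if "l < \<omega> (int k)" for l
    using block_climb[OF w, of l] that t by (simp add: F.block_add)
  then show ?thesis by blast
qed

lemma at_top_floor_recurrent:
  assumes y: "y \<in> S.\<Omega>" shows "\<exists>m\<ge>k. at_top_floor ((base_map ^^ m) y)"
proof -
  obtain \<omega> i where z: "(base_map ^^ k) y = (\<omega>, i)" by fastforce
  have O: "(\<omega>, i) \<in> S.\<Omega>" using orbit_space[OF y, of k] z by simp
  then have "i < roof \<omega>" by (simp add: suspension_space_def)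
  then have "(base_map ^^ (roof \<omega> - 1 - i)) (\<omega>, i) = (\<omega>, roof \<omega> - 1)"
    using orbit_climb[OF O, of "roof \<omega> - 1 - i"] by simp
  then have "at_top_floor ((base_map ^^ (roof \<omega> - 1 - i + k)) y)"
    by (simp add: funpow_add z at_top_floor_def)
  then show ?thesis by (intro exI[of _ "roof \<omega> - 1 - i + k"]) simp
qed

text \<open>The waiting time is one step more than the first passage through the top floor at a time \<open>\<ge> k\<close>, where \<open>k\<close> is the level of the dyadic interval provided by the variation bound; each step costs a factor \<open>1/2\<close>.\<close>

lemma good_covering_base: "good_covering S.M base_map (\<lambda>y. transfer_op (fibre_map y))"
  unfolding good_covering_def
proof (intro allI impI)
  fix a :: real assume a: "0 < a"
  obtain k where k: "4 * a < 2 ^ k" using real_arch_pow[of 2 "4 * a"] by auto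
  let ?P = "\<lambda>m y. k \<le> m \<and> at_top_floor ((base_map ^^ m) y)"
  let ?n = "\<lambda>y. Suc (LEAST m. ?P m y)"
  have pow: "base_map ^^ m \<in> measurable S.M S.M" for m
    by (induction m) (use S.\<sigma>_meas in auto)
  have meas: "?n \<in> measurable S.M (count_space UNIV)"
  proof -
    have "Measurable.pred S.M (?P m)" for m
      using measurable_compose[OF pow at_top_floor_meas, of m] by simp
    then show ?thesis by measurable
  qed
  show "\<exists>n\<^sub>c\<in>measurable S.M (count_space UNIV). \<exists>\<alpha> :: nat \<Rightarrow> _ \<Rightarrow> real.
      (\<forall>n. \<alpha> n \<in> borel_measurable S.M) \<and> (\<forall>n. \<forall>y\<in>space S.M. 0 < \<alpha> n y) \<and>
      (AE y in S.M. \<forall>n\<ge>n\<^sub>c y. \<forall>f\<in>Linf. (AE x in leb01. 0 \<le> f x) \<longrightarrow> ess_var f \<le> ennreal a * L1_norm f \<longrightarrow>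
        ereal (\<alpha> n y) * enn2ereal (L1_norm f) \<le> essinf (cocycle base_map (\<lambda>y. transfer_op (fibre_map y)) n y f))"
  proof (intro bexI[OF _ meas] exI[of _ "\<lambda>n _. 1 / 2 ^ Suc n"] conjI AE_I2 allI impI ballI)
    fix y n f assume y: "y \<in> space S.M" and n: "?n y \<le> n"
      and f: "f \<in> Linf" "AE x in leb01. 0 \<le> f x" "ess_var f \<le> ennreal a * L1_norm f"
    have "\<exists>m. ?P m y" using at_top_floor_recurrent[of y k] y by (simp add: S.space_M)
    then have m: "?P (LEAST m. ?P m y) y" by (rule LeastI_ex)
    have mn: "(LEAST m. ?P m y) < n" using n by simp
    show "ereal (1 / 2 ^ Suc n) * enn2ereal (L1_norm f) \<le> essinf (cocycle base_map (\<lambda>y. transfer_op (fibre_map y)) n y f)"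
      by (rule F.covering[OF a k conjunct2[OF m] conjunct1[OF m] mn f])
  qed auto
qed

lemma transfer_one_fibre: "AE x in leb01. transfer_op (fibre_map y) (\<lambda>_. 1) x = 1"
  using transfer_one by (simp add: F.T_def)

lemma essinf_one: "essinf (transfer_op (fibre_map y) (\<lambda>_. 1)) = 1"
proof -
  have [measurable]: "transfer_op (fibre_map y) (\<lambda>_. 1) \<in> borel_measurable leb01"
    using F.transfer_integrable[of "\<lambda>_. 1" y] by auto
  have "esssup leb01 (\<lambda>x. - ereal (transfer_op (fibre_map y) (\<lambda>_. 1) x)) = esssup leb01 (\<lambda>x. - 1)"
    by (rule esssup_AE_cong) (use transfer_one_fibre[of y] in \<open>auto elim!: eventually_mono simp: one_ereal_def\<close>)
  also have "\<dots> = - 1" by (rule esssup_const) (simp add: leb01.emeasure_space_1[simplified])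
  finally show ?thesis by (simp add: essinf_def)
qed

lemma good_essinf_base: "good_essinf S.M (\<lambda>y. transfer_op (fibre_map y))"
  unfolding good_essinf_def essinf_one by simp

lemma good_cocycle_base: "good_cocycle S.M base_map fibre_map"
  unfolding good_cocycle_def
  using S.suspension_invertible_ergodic good_regular_base good_bounded_base good_lasota_yorke_base
    good_covering_base good_essinf_base D0.nonsingular D1.nonsingular
  by (auto simp: F.T_def)

lemma equivariant_base: "equivariant_ac_measures S.M base_map fibre_map (\<lambda>_. leb01)"
  unfolding equivariant_ac_measures_def
proof (intro exI[of _ "\<lambda>_ _. 1"] ballI conjI)
  show "leb01 = density leb01 (\<lambda>x. ennreal 1)" by (simp add: density_1)
qed (use transfer_one_fibre in \<open>auto simp: leb01.prob_space[simplified]\<close>)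

lemma variance_base:
  "AE y in S.M. filterlim (\<lambda>N. (1 / real N) * (\<integral>x. (\<Sum>n<N. psi (cocycle base_map fibre_map n y x))\<^sup>2 \<partial>leb01)) at_top sequentially"
proof -
  have "AE \<omega> in B.Q. \<forall>C::real. eventually (\<lambda>K. C * (real K + 1) \<le> (\<Sum>k\<in>{1..<K}. (real (\<omega> (int k)))\<^sup>2)) sequentially"
    by (rule B.coord_squares_superlinear[OF letter_second_moment sets_letter])
  from S.AE_fst[OF this] show ?thesis
  proof (rule AE_mp, intro AE_I2 impI)
    fix y assume y: "y \<in> space S.M"
      and g: "\<forall>C::real. eventually (\<lambda>K. C * (real K + 1) \<le> (\<Sum>k\<in>{1..<K}. (real (fst y (int k)))\<^sup>2)) sequentially"
    obtain \<omega> i where yy: "y = (\<omega>, i)" by fastforce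
    have O: "(\<omega>, i) \<in> S.\<Omega>" using y yy by (simp add: S.space_M)
    then have pos: "1 \<le> \<omega> n" for n by (auto simp: suspension_space_def space_Q)
    show "filterlim (\<lambda>N. (1 / real N) * (\<integral>x. (\<Sum>n<N. psi (cocycle base_map fibre_map n y x))\<^sup>2 \<partial>leb01)) at_top sequentially"
    proof (rule F.variance_superlinear[where y = y and len = "\<lambda>k. \<omega> (int k)"])
      show "\<exists>t. \<forall>l<\<omega> (int k). F.block y (t + l) = k" if "1 \<le> k" for k
        using block_full[OF O that] yy by simp
      show "0 < \<omega> (int k)" for k using pos[of "int k"] by simp
      show "eventually (\<lambda>K. C * (real K + 1) \<le> (\<Sum>k\<in>{1..<K}. (real (\<omega> (int k)))\<^sup>2)) sequentially" for C :: real
        using g yy by simp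
    qed
  qed
qed

end

theorem mainTheorem3:
  fixes \<delta> :: real
  assumes "0 < \<delta>" and "\<delta> \<le> 1"
  shows "good_cocycle (base_measure \<delta>) base_map fibre_map \<and>
    equivariant_ac_measures (base_measure \<delta>) base_map fibre_map (\<lambda>_. leb01) \<and>
    psi \<in> BV \<and> (\<integral>x. psi x \<partial>leb01) = 0 \<and>
    (AE y in base_measure \<delta>.
      filterlim
        (\<lambda>N. (1 / real N) *
          (\<integral>x. (\<Sum>n<N. psi (cocycle base_map fibre_map n y x))\<^sup>2 \<partial>leb01))
        at_top sequentially)"
proof -
  interpret letters \<delta> using assms by unfold_locales
  show ?thesis
    using good_cocycle_base equivariant_base variance_base psi_BV integral_psi
    unfolding M_eq by blast
qed

end
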